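(* Consider a quantum network with finitely many nodes and finitely many edges, each edge being a mixed entangled two-qubit state shared between two different nodes. Let $A\neq B$ be two nodes of the network. Then a perfect singlet between $A$ and $B$ can be generated with non-zero probability by local operations at the nodes and classical communication between the nodes if and only if there are at least two edge-disjoint paths of edges linking $A$ and $B$ such that every edge on these paths is, up to local unitaries, in a state of the form $$\rho(\alpha,\gamma,\lambda)=\lambda\,|\alpha,\gamma\rangle\langle\alpha,\gamma|+(1-\lambda)\,|01\rangle\langle 01|,\qquad |\alpha,\gamma\rangle=\sqrt{\alpha}\,|00\rangle+\sqrt{1-\alpha-\gamma}\,|11\rangle+\sqrt{\gamma}\,|01\rangle,$$ with $0\le\lambda\le 1$, $\alpha,\gamma\ge 0$, $\alpha+\gamma\le 1$ (the parameters may differ from edge to edge).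
   Context: A network consists of nodes, each holding finitely many qubits. An edge is a two-qubit density operator shared by two qubits located in two different nodes; distinct edges use distinct qubits, two nodes may be joined by several edges, and the initial state of the network is the tensor product of all the edge states. Mixed means of rank at least $2$; entangled means not separable. "Up to local unitaries" means up to conjugation by $U\otimes V$ with $U,V$ single-qubit unitaries. A path linking $A$ and $B$ is a finite sequence of edges, consecutive ones sharing a node, starting at node $A$ and ending at node $B$; two paths are edge-disjoint if they have no edge in common (they may share nodes). LOCC: each node may apply arbitrary quantum operations (including measurements and use of local ancillas) to all the qubits it holds, and classical communication between nodes is unrestricted. A perfect singlet between $A$ and $B$ is a maximally entangled pure state of one qubit at $A$ and one qubit at $B$, i.e. $(|00\rangle+|11\rangle)/\sqrt2$ up to local unitaries. Generating it with non-zero probability means that some LOCC protocol has an outcome of strictly positive probability, conditioned on which the state of such a pair of qubits is exactly this state. *)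

theory Defs
  imports "HOL-Analysis.Analysis"
begin

section \<open>One and two qubits\<close>

text \<open>
  A qubit has the computational basis indexed by \<^typ>\<open>bool\<close>, where \<^term>\<open>False\<close> is
  the basis vector 0 and \<^term>\<open>True\<close> is the basis vector 1.  Two qubits are indexed by
  \<^typ>\<open>bool \<times> bool\<close>.
\<close>

type_synonym qubit_op = "complex ^ bool ^ bool"
type_synonym two_qubit_vec = "complex ^ (bool \<times> bool)"
type_synonym two_qubit_op = "complex ^ (bool \<times> bool) ^ (bool \<times> bool)"

definition dagger :: "complex ^ 'n ^ 'm \<Rightarrow> complex ^ 'm ^ 'n" where
  "dagger M = (\<chi> i j. cnj (M $ j $ i))"

definition unitary_op :: "complex ^ 'n ^ 'n \<Rightarrow> bool" where
  "unitary_op U \<longleftrightarrow> dagger U ** U = mat 1 \<and> U ** dagger U = mat 1"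

definition density_op :: "complex ^ 'n ^ 'n \<Rightarrow> bool" where
  "density_op \<rho> \<longleftrightarrow>
     dagger \<rho> = \<rho> \<and>
     (\<forall>v. 0 \<le> Re (\<Sum>i\<in>UNIV. \<Sum>j\<in>UNIV. cnj (v $ i) * \<rho> $ i $ j * v $ j)) \<and>
     trace \<rho> = 1"

definition tensor_op :: "complex ^ 'n ^ 'n \<Rightarrow> complex ^ 'm ^ 'm \<Rightarrow>
    complex ^ ('n \<times> 'm) ^ ('n \<times> 'm)" where
  "tensor_op S T = (\<chi> i j. S $ fst i $ fst j * T $ snd i $ snd j)"

definition separable :: "two_qubit_op \<Rightarrow> bool" where
  "separable \<rho> \<longleftrightarrow>
     \<rho> \<in> convex hull {tensor_op S T | (S :: qubit_op) (T :: qubit_op). density_op S \<and> density_op T}"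

definition entangled :: "two_qubit_op \<Rightarrow> bool" where
  "entangled \<rho> \<longleftrightarrow> \<not> separable \<rho>"

definition mixed :: "complex ^ 'n ^ 'n \<Rightarrow> bool" where
  "mixed \<rho> \<longleftrightarrow> rank \<rho> \<ge> 2"

definition lu_equivalent :: "two_qubit_op \<Rightarrow> two_qubit_op \<Rightarrow> bool" where
  "lu_equivalent \<rho> \<sigma> \<longleftrightarrow>
     (\<exists>(U :: qubit_op) (V :: qubit_op). unitary_op U \<and> unitary_op V \<and>
        \<rho> = tensor_op U V ** \<sigma> ** dagger (tensor_op U V))"

definition ket :: "bool \<Rightarrow> bool \<Rightarrow> two_qubit_vec" where
  "ket a b = axis (a, b) 1"

text \<open>The rank-one operator of a (normalised) state vector.\<close>
definition pure_op :: "complex ^ 'n \<Rightarrow> complex ^ 'n ^ 'n" where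
  "pure_op v = (\<chi> i j. v $ i * cnj (v $ j))"

definition ket_ag :: "real \<Rightarrow> real \<Rightarrow> two_qubit_vec" where
  "ket_ag \<alpha> \<gamma> =
     sqrt \<alpha> *\<^sub>R ket False False + sqrt (1 - \<alpha> - \<gamma>) *\<^sub>R ket True True + sqrt \<gamma> *\<^sub>R ket False True"

definition rho_agl :: "real \<Rightarrow> real \<Rightarrow> real \<Rightarrow> two_qubit_op" where
  "rho_agl \<alpha> \<gamma> l = l *\<^sub>R pure_op (ket_ag \<alpha> \<gamma>) + (1 - l) *\<^sub>R pure_op (ket False True)"

definition perfect_singlet :: "two_qubit_op \<Rightarrow> bool" where
  "perfect_singlet \<tau> \<longleftrightarrow>
     lu_equivalent \<tau> (pure_op ((1 / sqrt 2) *\<^sub>R (ket False False + ket True True)))"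

section \<open>Networks\<close>

text \<open>
  An edge \<open>e\<close> is a pair of qubits, one at node \<open>end1 N e\<close> and one at node \<open>end2 N e\<close>; the
  order of the ends only fixes which tensor factor of \<open>edge_state N e\<close> is held by which node.
  Distinct edges may have the same ends.
\<close>

record ('v, 'e) network =
  nodes :: "'v set"
  edges :: "'e set"
  end1 :: "'e \<Rightarrow> 'v"
  end2 :: "'e \<Rightarrow> 'v"
  edge_state :: "'e \<Rightarrow> two_qubit_op"

definition quantum_network :: "('v, 'e) network \<Rightarrow> bool" where
  "quantum_network N \<longleftrightarrow>
     finite (nodes N) \<and> finite (edges N) \<and>
     (\<forall>e\<in>edges N. end1 N e \<in> nodes N \<and> end2 N e \<in> nodes N \<and> end1 N e \<noteq> end2 N e \<and>
        density_op (edge_state N e))"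

fun edge_path :: "('v, 'e) network \<Rightarrow> 'v \<Rightarrow> 'e list \<Rightarrow> 'v \<Rightarrow> bool" where
  "edge_path N u [] w \<longleftrightarrow> u = w"
| "edge_path N u (e # es) w \<longleftrightarrow> e \<in> edges N \<and>
     (end1 N e = u \<and> edge_path N (end2 N e) es w \<or> end2 N e = u \<and> edge_path N (end1 N e) es w)"

section \<open>Registers of qubits\<close>

text \<open>
  For a finite set \<open>Q\<close> of qubit labels, the computational basis of the register \<open>Q\<close> consists
  of the extensional functions from \<open>Q\<close> to \<^typ>\<open>bool\<close>.  An operator is given by its matrix
  entries (row, column); only the entries on the basis of its register matter.
\<close>

type_synonym 'q reg_op = "('q \<Rightarrow> bool) \<Rightarrow> ('q \<Rightarrow> bool) \<Rightarrow> complex"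

abbreviation basis_states :: "'q set \<Rightarrow> ('q \<Rightarrow> bool) set" where
  "basis_states Q \<equiv> Q \<rightarrow>\<^sub>E (UNIV :: bool set)"

definition trace_reg :: "'q set \<Rightarrow> 'q reg_op \<Rightarrow> real" where
  "trace_reg Q \<sigma> = Re (\<Sum>x\<in>basis_states Q. \<sigma> x x)"

text \<open>The operator \<open>K\<close> on the subregister \<open>S\<close>, tensored with the identity on the rest of \<open>Q\<close>.\<close>
definition extend_op :: "'q set \<Rightarrow> 'q set \<Rightarrow> 'q reg_op \<Rightarrow> 'q reg_op" where
  "extend_op Q S K x y =
     (if \<forall>q\<in>Q - S. x q = y q then K (restrict x S) (restrict y S) else 0)"

text \<open>The completely positive map on \<open>Q\<close> with Kraus operators \<open>Ks\<close> acting on \<open>S\<close>.\<close>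
definition apply_kraus :: "'q set \<Rightarrow> 'q set \<Rightarrow> 'q reg_op list \<Rightarrow> 'q reg_op \<Rightarrow> 'q reg_op" where
  "apply_kraus Q S Ks \<sigma> x y =
     (\<Sum>K\<leftarrow>Ks. \<Sum>x'\<in>basis_states Q. \<Sum>y'\<in>basis_states Q.
        extend_op Q S K x x' * \<sigma> x' y' * cnj (extend_op Q S K y y'))"

text \<open>
  A quantum instrument on \<open>S\<close>: one list of Kraus operators for every classical outcome, the
  sum of all outcome maps being trace preserving.
\<close>
definition instrument :: "'q set \<Rightarrow> 'q reg_op list list \<Rightarrow> bool" where
  "instrument S Kss \<longleftrightarrow>
     (\<forall>x\<in>basis_states S. \<forall>y\<in>basis_states S.
        (\<Sum>K\<leftarrow>concat Kss. \<Sum>z\<in>basis_states S. cnj (K z x) * K z y) = (if x = y then 1 else 0))"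

text \<open>Partial trace over all qubits of \<open>Q\<close> except \<open>a\<close> (first factor) and \<open>b\<close> (second factor).\<close>
definition reduce_pair :: "'q set \<Rightarrow> 'q \<Rightarrow> 'q \<Rightarrow> 'q reg_op \<Rightarrow> two_qubit_op" where
  "reduce_pair Q a b \<sigma> =
     (\<chi> i j. \<Sum>x\<in>basis_states (Q - {a, b}).
        \<sigma> (x(a := fst i, b := snd i)) (x(a := fst j, b := snd j)))"

section \<open>LOCC protocols on a network\<close>

text \<open>
  Besides the two qubits of every edge, each node \<open>v\<close> may use any finite number \<open>k v\<close> of
  ancilla qubits, prepared in the basis state 0.
\<close>

datatype ('v, 'e) qubit = End1 'e | End2 'e | Ancilla 'v nat

primrec holder :: "('v, 'e) network \<Rightarrow> ('v, 'e) qubit \<Rightarrow> 'v" where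
  "holder N (End1 e) = end1 N e"
| "holder N (End2 e) = end2 N e"
| "holder N (Ancilla v i) = v"

definition qubits :: "('v, 'e) network \<Rightarrow> ('v \<Rightarrow> nat) \<Rightarrow> ('v, 'e) qubit set" where
  "qubits N k = End1 ` edges N \<union> End2 ` edges N \<union> {Ancilla v i | v i. v \<in> nodes N \<and> i < k v}"

definition held :: "('v, 'e) network \<Rightarrow> ('v \<Rightarrow> nat) \<Rightarrow> 'v \<Rightarrow> ('v, 'e) qubit set" where
  "held N k v = {q \<in> qubits N k. holder N q = v}"

definition initial_state ::
    "('v, 'e) network \<Rightarrow> ('v \<Rightarrow> nat) \<Rightarrow> ('v, 'e) qubit reg_op" where
  "initial_state N k x y =
     (\<Prod>e\<in>edges N. edge_state N e $ (x (End1 e), x (End2 e)) $ (y (End1 e), y (End2 e))) *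
     (\<Prod>(v, i)\<in>(SIGMA v:nodes N. {..<k v}).
        if \<not> x (Ancilla v i) \<and> \<not> y (Ancilla v i) then 1 else 0)"

text \<open>
  A protocol is a finite tree.  In \<open>Local v bs\<close> the node \<open>v\<close> applies an instrument whose
  outcomes are the entries of \<open>bs\<close>; the outcome is announced to all nodes, and each entry
  carries its Kraus operators and the protocol with which the network then continues.
\<close>

datatype ('v, 'q) protocol =
  Done
| Local 'v "('q reg_op list \<times> ('v, 'q) protocol) list"

inductive locc_protocol ::
    "('v, 'e) network \<Rightarrow> ('v \<Rightarrow> nat) \<Rightarrow> ('v, ('v, 'e) qubit) protocol \<Rightarrow> bool"
  for N :: "('v, 'e) network" and k :: "'v \<Rightarrow> nat" where
  Done: "locc_protocol N k Done"
| Local: "locc_protocol N k (Local v bs)"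
    if "v \<in> nodes N"
      and "instrument (held N k v) (map fst bs)"
      and "\<forall>b\<in>set bs. locc_protocol N k (snd b)"

text \<open>
  \<open>outcome N k \<rho> P \<sigma>\<close>: started in \<open>\<rho>\<close>, the protocol \<open>P\<close> has a complete sequence of measurement
  results leading to the unnormalised state \<open>\<sigma>\<close>.  For \<open>\<rho>\<close> of trace one, the trace of \<open>\<sigma>\<close> is
  the probability of this sequence.
\<close>

inductive outcome ::
    "('v, 'e) network \<Rightarrow> ('v \<Rightarrow> nat) \<Rightarrow> ('v, 'e) qubit reg_op \<Rightarrow>
     ('v, ('v, 'e) qubit) protocol \<Rightarrow> ('v, 'e) qubit reg_op \<Rightarrow> bool"
  for N :: "('v, 'e) network" and k :: "'v \<Rightarrow> nat" where
  Done: "outcome N k \<rho> Done \<rho>"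
| Local: "outcome N k \<rho> (Local v bs) \<sigma>"
    if "(Ks, P) \<in> set bs"
      and "outcome N k (apply_kraus (qubits N k) (held N k v) Ks \<rho>) P \<sigma>"

definition singlet_generable :: "('v, 'e) network \<Rightarrow> 'v \<Rightarrow> 'v \<Rightarrow> bool" where
  "singlet_generable N A B \<longleftrightarrow>
     (\<exists>k P \<sigma> a b.
        locc_protocol N k P \<and>
        outcome N k (initial_state N k) P \<sigma> \<and>
        a \<in> held N k A \<and> b \<in> held N k B \<and>
        trace_reg (qubits N k) \<sigma> > 0 \<and>
        perfect_singlet
          ((1 / trace_reg (qubits N k) \<sigma>) *\<^sub>R reduce_pair (qubits N k) a b \<sigma>))"

end

theory Submission
  imports Defs
begin

text \<open>
  Writing a mixed two-qubit state as a sum of rank-one operators, let \<open>V\<close> be the complex span of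
  the vectors that occur.  The determinant of the coefficient matrix is a quadratic form on
  \<open>V\<close> that vanishes exactly on product vectors.  Since \<open>dim V \<ge> 2\<close>, it has a non-trivial zero, and
  either \<open>V\<close> is spanned by its product vectors, or \<open>V\<close> is two-dimensional with a single product
  direction; the second case is the form \<open>\<rho>(\<alpha>,\<gamma>,\<lambda>)\<close> up to local unitaries.

  Necessity.  If the edges of that form contain no two edge-disjoint paths, then by Menger's
  theorem some cut between \<open>A\<close> and \<open>B\<close> is crossed by at most one of them.  A branch of a protocol
  is a sum of terms \<open>L \<rho> L\<^sup>*\<close> with \<open>L\<close> a product over the cut, and a pure outcome forces every
  vector of the range of \<open>\<rho>\<close> to be mapped to a multiple of the singlet.  By multilinearity all
  other crossing edges can be replaced by product vectors; a product vector in the range of the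
  last crossing edge is mapped to a product vector, hence to \<open>0\<close>, so one of the two sides has rank
  at most one and no entanglement is left.

  Sufficiency.  In suitable local frames an edge of the form \<open>\<rho>(\<alpha>,\<gamma>,\<lambda>)\<close> has no component
  \<open>|10\<rangle>\<close>, and a local filter equalises its entries between \<open>|00\<rangle>\<close> and \<open>|11\<rangle>\<close>.  All nodes then
  project onto the configurations in which the qubits of the first path all carry the same bit
  and those of the second path its negation.  Bits can only increase along each of the two paths,
  so the bit chosen at different nodes must agree, and only a maximally entangled superposition survives.
\<close>

section \<open>Positive semidefinite kernels\<close>

text \<open>A branch may contain many Kraus terms, and the traced-out qubits may be found in many
  basis states, so the averaged outcome says little by itself. Purity is what helps: vectors whose
  rank-one operators sum to a multiple of \<open>|\<phi>><\<phi>|\<close> are all multiples of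
  \<open>\<phi>\<close>. One Kraus product and one state of the traced-out qubits with nonzero
  amplitude can therefore be fixed, and the rest is linear algebra of 2x2 determinants: the singlet
  has nonzero determinant, so an amplitude of determinant 0 must vanish.

  In the other direction the unwanted term \<open>|01><01|\<close> is the reason for two paths.
  Along a single path the bit may jump from 0 to 1 somewhere between \<open>A\<close> and
  \<open>B\<close>. The second path carries negated bits, so the bit of a node can only decrease
  along it; both paths together form a closed loop from \<open>A\<close> to \<open>B\<close> and
  back around which the bit is monotone, hence constant. Probabilities need no tracking, since every
  filter is, up to a positive factor, one outcome of an instrument.\<close>

text \<open>Cholesky factorisation: the column of the pivot \<open>a\<close>, divided by the root of
  \<open>M a a\<close>, is one vector, and the Schur complement supplies the others. Kernels on a
  finite set rather than matrices, because register operators are needed too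
  (\<open>instrument_completion\<close>).\<close>

lemma psd_kernel_decomposition:
  fixes M :: "'a \<Rightarrow> 'a \<Rightarrow> complex"
  assumes "finite J"
    and "\<And>i j. i \<in> J \<Longrightarrow> j \<in> J \<Longrightarrow> M j i = cnj (M i j)"
    and "\<And>v. 0 \<le> Re (\<Sum>i\<in>J. \<Sum>j\<in>J. cnj (v i) * M i j * v j)"
  shows "\<exists>W. \<forall>i\<in>J. \<forall>j\<in>J. M i j = (\<Sum>k\<in>J. W k i * cnj (W k j))"
  using assms
proof (induction J arbitrary: M rule: finite_induct)
  case empty
  then show ?case by simp
next
  case (insert a J)
  note herm = insert.prems(1) and psd = insert.prems(2)
  define m where "m = Re (M a a)"
  have maa: "M a a = complex_of_real m"
    using herm[of a a] by (simp add: m_def complex_eq_iff)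
  have herma: "M i a = cnj (M a i)" if "i \<in> J" for i using herm[of a i] that by simp
  have split: "(\<Sum>i\<in>insert a J. \<Sum>j\<in>insert a J. cnj (v i) * M i j * v j)
     = cnj (v a) * m * v a + cnj (v a) * (\<Sum>j\<in>J. M a j * v j)
       + v a * cnj (\<Sum>j\<in>J. M a j * v j) + (\<Sum>i\<in>J. \<Sum>j\<in>J. cnj (v i) * M i j * v j)" for v
    using insert.hyps
    by (simp add: maa herma sum.distrib sum_distrib_left algebra_simps)
  have m0: "m \<ge> 0"
  proof -
    define v where "v i = (if i = a then 1 else 0 :: complex)" for i
    have "v i = 0" if "i \<in> J" for i using that insert.hyps by (auto simp: v_def)
    then show ?thesis using psd[of v] unfolding split by (simp add: v_def)
  qed
  have zero: "M a j = 0" if "m = 0" and j: "j \<in> J" for j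
  proof (rule ccontr)
    assume nz: "M a j \<noteq> 0"
    \<comment> \<open>With \<open>- r * M a j\<close> at \<open>a\<close> and 1 at \<open>j\<close>
      the form is \<open>M j j - 2 * r * |M a j|^2\<close>. This \<open>r\<close> makes it
      \<open>- M j j - 2\<close>, although both the form and \<open>M j j\<close> are
      nonnegative.\<close>
    define r where "r = (Re (M j j) + 1) / (cmod (M a j))\<^sup>2"
    define v where "v i = (if i = a then - complex_of_real r * M a j else if i = j then 1 else 0)" for i
    have va: "v a = - complex_of_real r * M a j" by (simp add: v_def)
    have ja: "j \<noteq> a" using j insert.hyps by auto
    have vJ: "v i = (if i = j then 1 else 0)" if "i \<in> J" for i
      using that insert.hyps by (auto simp: v_def)
    have s: "(\<Sum>i\<in>J. M a i * v i) = M a j"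
      using j insert.hyps(1) by (simp add: vJ if_distrib cong: if_cong)
    have q: "(\<Sum>i\<in>J. \<Sum>k\<in>J. cnj (v i) * M i k * v k) = M j j"
    proof -
      have "(\<Sum>i\<in>J. \<Sum>k\<in>J. cnj (v i) * M i k * v k)
        = (\<Sum>i\<in>J. \<Sum>k\<in>J. (if i = j then (if k = j then M i k else 0) else 0))"
        by (intro sum.cong refl) (auto simp: vJ)
      also have "\<dots> = (\<Sum>i\<in>J. (if i = j then M i j else 0))"
        using j insert.hyps(1) by (intro sum.cong refl) auto
      finally show ?thesis using j insert.hyps(1) by simp
    qed
    have "0 \<le> Re (cnj (v a) * M a j + v a * cnj (M a j) + M j j)"
      using psd[of v] unfolding split s q using \<open>m = 0\<close> by simp
    also have "\<dots> = - 2 * r * (cmod (M a j))\<^sup>2 + Re (M j j)"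
      unfolding cmod_power2 by (simp add: va power2_eq_square algebra_simps)
    also have "\<dots> = - Re (M j j) - 2" using nz by (simp add: r_def field_simps)
    finally have "Re (M j j) < 0" by simp
    moreover have "0 \<le> Re (M j j)"
    proof -
      define w where "w i = (if i = j then 1 else 0 :: complex)" for i
      have "(\<Sum>i\<in>J. \<Sum>k\<in>J. cnj (w i) * M i k * w k) = M j j"
      proof -
        have "(\<Sum>i\<in>J. \<Sum>k\<in>J. cnj (w i) * M i k * w k)
          = (\<Sum>i\<in>J. \<Sum>k\<in>J. (if i = j then (if k = j then M i k else 0) else 0))"
          by (intro sum.cong refl) (auto simp: w_def)
        also have "\<dots> = (\<Sum>i\<in>J. (if i = j then M i j else 0))"
          using j insert.hyps(1) by (intro sum.cong refl) auto
        finally show ?thesis using j insert.hyps(1) by simp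
      qed
      then show ?thesis using psd[of w] unfolding split by (simp add: w_def ja[symmetric])
    qed
    ultimately show False by simp
  qed
  \<comment> \<open>Schur complement of the entry at \<open>a\<close>; for \<open>m = 0\<close> the junk value of the division gives \<open>M' = M\<close>.\<close>
  define M' where "M' i j = M i j - M i a * M a j / m" for i j
  have "\<exists>W. \<forall>i\<in>J. \<forall>j\<in>J. M' i j = (\<Sum>k\<in>J. W k i * cnj (W k j))"
  proof (rule insert.IH)
    show "M' j i = cnj (M' i j)" if "i \<in> J" "j \<in> J" for i j
      using herm[of i j] that by (simp add: M'_def herma)
    fix v :: "'a \<Rightarrow> complex"
    define s where "s = (\<Sum>j\<in>J. M a j * v j)"
    \<comment> \<open>Completing the square: for \<open>m > 0\<close> this value at \<open>a\<close>
      minimises the form, and the minimum is the form of \<open>M'\<close> at \<open>v\<close>. For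
      \<open>m = 0\<close> the value is 0 and the two forms coincide.\<close>
    define u where "u = v(a := - s / m)"
    have uJ: "u i = v i" if "i \<in> J" for i using that insert.hyps by (auto simp: u_def)
    have s': "(\<Sum>j\<in>J. M a j * u j) = s" by (simp add: s_def uJ)
    have "(\<Sum>i\<in>J. \<Sum>j\<in>J. cnj (v i) * M' i j * v j)
       = (\<Sum>i\<in>J. \<Sum>j\<in>J. cnj (v i) * M i j * v j) - (\<Sum>i\<in>J. \<Sum>j\<in>J. cnj (v i) * M i a * (M a j * v j)) / m"
      by (simp add: M'_def algebra_simps sum_subtractf sum_divide_distrib)
    also have "(\<Sum>i\<in>J. \<Sum>j\<in>J. cnj (v i) * M i a * (M a j * v j)) = cnj s * s"
      unfolding s_def cnj_sum sum_product by (intro sum.cong refl) (simp add: herma)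
    finally have f: "(\<Sum>i\<in>J. \<Sum>j\<in>J. cnj (v i) * M' i j * v j)
       = (\<Sum>i\<in>J. \<Sum>j\<in>J. cnj (v i) * M i j * v j) - cnj s * s / m" .
    have "(\<Sum>i\<in>insert a J. \<Sum>j\<in>insert a J. cnj (u i) * M i j * u j)
       = cnj (u a) * m * u a + cnj (u a) * s + u a * cnj s
         + (\<Sum>i\<in>J. \<Sum>j\<in>J. cnj (v i) * M i j * v j)"
      unfolding split s' by (simp add: uJ)
    also have "\<dots> = (\<Sum>i\<in>J. \<Sum>j\<in>J. cnj (v i) * M' i j * v j)"
      unfolding f by (cases "m = 0") (simp_all add: u_def field_simps)
    finally show "0 \<le> Re (\<Sum>i\<in>J. \<Sum>j\<in>J. cnj (v i) * M' i j * v j)"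
      using psd[of u] by simp
  qed
  then obtain W where W: "\<And>i j. i \<in> J \<Longrightarrow> j \<in> J \<Longrightarrow> M' i j = (\<Sum>k\<in>J. W k i * cnj (W k j))"
    by blast
  \<comment> \<open>The old vectors are extended by 0 at \<open>a\<close>. For \<open>m = 0\<close>
    division makes the new one zero, which is right because of \<open>zero\<close>.\<close>
  define W' where "W' k i = (if k = a then M i a / sqrt m else if i = a then 0 else W k i)" for k i
  have sq: "complex_of_real (sqrt m) * complex_of_real (sqrt m) = m"
    using m0 by (metis of_real_mult real_sqrt_mult_self abs_of_nonneg)
  have "M i j = (\<Sum>k\<in>insert a J. W' k i * cnj (W' k j))"
    if i: "i \<in> insert a J" and j: "j \<in> insert a J" for i j
  proof -
    have ne: "k \<noteq> a" if "k \<in> J" for k using that insert.hyps by auto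
    have "(\<Sum>k\<in>insert a J. W' k i * cnj (W' k j))
       = M i a * cnj (M j a) / m + (\<Sum>k\<in>J. W' k i * cnj (W' k j))"
      using insert.hyps by (simp add: W'_def sq)
    also have "cnj (M j a) = M a j" using herm[of a j] j by simp
    also have "(\<Sum>k\<in>J. W' k i * cnj (W' k j)) = (if i = a \<or> j = a then 0 else M' i j)"
      using i j by (auto simp: W'_def ne W intro!: sum.cong sum.neutral)
    also have "M i a * M a j / m + \<dots> = M i j"
    proof (cases "m = 0")
      case True
      then show ?thesis using i j zero herma maa by (auto simp: M'_def)
    next
      case False
      then show ?thesis using i j by (auto simp: M'_def maa)
    qed
    finally show ?thesis by simp
  qed
  then show ?case by blast
qed

section \<open>Two edge-disjoint paths\<close>

text \<open>Unlike \<open>edge_path\<close>, a walk records the direction of each traversal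
  (\<open>True\<close>: from \<open>s\<close> to \<open>t\<close>). It gives the sign of a flow and,
  later, the direction in which bits may increase.\<close>

fun arc_walk :: "('e \<Rightarrow> 'v) \<Rightarrow> ('e \<Rightarrow> 'v) \<Rightarrow> 'v \<Rightarrow> ('e \<times> bool) list \<Rightarrow> 'v \<Rightarrow> bool" where
  "arc_walk s t u [] w \<longleftrightarrow> u = w"
| "arc_walk s t u ((e, d) # es) w \<longleftrightarrow>
     (if d then s e else t e) = u \<and> arc_walk s t (if d then t e else s e) es w"

lemma arc_walk_append:
  "arc_walk s t u (xs @ ys) w \<longleftrightarrow> (\<exists>v. arc_walk s t u xs v \<and> arc_walk s t v ys w)"
  by (induction xs arbitrary: u) (auto split: if_splits)

text \<open>Shortcutting. If an edge recurs in the same direction, the part between and one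
  occurrence are cut out; if in opposite directions, both occurrences and all between, since the
  walk is back where it was.\<close>

lemma arc_walk_distinct:
  assumes "arc_walk s t u es w"
  shows "\<exists>es'. arc_walk s t u es' w \<and> set es' \<subseteq> set es \<and> distinct (map fst es')"
  using assms
proof (induction es rule: length_induct)
  case (1 es)
  show ?case
  proof (cases "distinct (map fst es)")
    case True
    then show ?thesis using 1 by blast
  next
    case False
    then obtain xs e ys zs where "map fst es = xs @ [e] @ ys @ [e] @ zs"
      using not_distinct_decomp by blast
    then obtain xs ys zs d d' where es: "es = xs @ (e, d) # ys @ (e, d') # zs"
      by (auto simp: map_eq_append_conv append_eq_map_conv map_eq_Cons_conv Cons_eq_map_conv)
    show ?thesis
    proof (cases "d = d'")
      case True
      then have "arc_walk s t u (xs @ (e, d') # zs) w"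
        using "1.prems" unfolding es by (auto simp: arc_walk_append)
      then obtain es' where "arc_walk s t u es' w" "set es' \<subseteq> set (xs @ (e, d') # zs)"
          "distinct (map fst es')"
        using "1.IH"[rule_format, of "xs @ (e, d') # zs"] by (auto simp: es)
      then show ?thesis by (intro exI[of _ es']) (auto simp: es)
    next
      case False
      then have "arc_walk s t u (xs @ zs) w"
        using "1.prems" unfolding es by (cases d; cases d') (auto simp: arc_walk_append)
      then obtain es' where "arc_walk s t u es' w" "set es' \<subseteq> set (xs @ zs)"
          "distinct (map fst es')"
        using "1.IH"[rule_format, of "xs @ zs"] by (auto simp: es)
      then show ?thesis by (intro exI[of _ es']) (auto simp: es)
    qed
  qed
qed

lemma arc_walk_to_edge_path:
  "arc_walk (end1 N) (end2 N) u es w \<Longrightarrow> fst ` set es \<subseteq> edges N \<Longrightarrow> edge_path N u (map fst es) w"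
  by (induction es arbitrary: u) (auto split: if_splits)

lemma edge_path_to_arc_walk:
  "edge_path N u p w \<Longrightarrow> \<exists>es. arc_walk (end1 N) (end2 N) u es w \<and> map fst es = p"
proof (induction p arbitrary: u)
  case Nil
  then show ?case by auto
next
  case (Cons e p)
  from Cons.prems show ?case
  proof (simp, elim conjE disjE)
    assume "end1 N e = u" "edge_path N (end2 N e) p w"
    with Cons.IH obtain es where "arc_walk (end1 N) (end2 N) (end2 N e) es w" "map fst es = p" by blast
    then show ?thesis using \<open>end1 N e = u\<close> by (intro exI[of _ "(e, True) # es"]) auto
  next
    assume "end2 N e = u" "edge_path N (end1 N e) p w"
    with Cons.IH obtain es where "arc_walk (end1 N) (end2 N) (end1 N e) es w" "map fst es = p" by blast
    then show ?thesis using \<open>end2 N e = u\<close> by (intro exI[of _ "(e, False) # es"]) auto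
  qed
qed

definition arc_sign :: "bool \<Rightarrow> int" where
  "arc_sign d = (if d then 1 else -1)"

definition walk_flow :: "('e \<times> bool) list \<Rightarrow> 'e \<Rightarrow> int" where
  "walk_flow es e = (\<Sum>(e', d)\<leftarrow>es. if e' = e then arc_sign d else 0)"

definition net_flow :: "'e set \<Rightarrow> ('e \<Rightarrow> 'v) \<Rightarrow> ('e \<Rightarrow> 'v) \<Rightarrow> ('e \<Rightarrow> int) \<Rightarrow> 'v set \<Rightarrow> int" where
  "net_flow E s t f X = (\<Sum>e\<in>E. f e * (of_bool (s e \<in> X) - of_bool (t e \<in> X)))"

text \<open>An integral flow of value \<open>c\<close> through undirected edges of capacity one; the
  sign of \<open>f e\<close> is the direction. Conservation is imposed on all node sets, so that the
  flow across a cut needs no summation over nodes.\<close>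

definition unit_flow ::
    "'e set \<Rightarrow> ('e \<Rightarrow> 'v) \<Rightarrow> ('e \<Rightarrow> 'v) \<Rightarrow> 'v \<Rightarrow> 'v \<Rightarrow> int \<Rightarrow> ('e \<Rightarrow> int) \<Rightarrow> bool" where
  "unit_flow E s t A B c f \<longleftrightarrow> (\<forall>e\<in>E. f e \<in> {-1, 0, 1}) \<and>
     (\<forall>X. net_flow E s t f X = c * (of_bool (A \<in> X) - of_bool (B \<in> X)))"

lemma net_flow_walk:
  assumes "finite E" "arc_walk s t u es w" "fst ` set es \<subseteq> E"
  shows "net_flow E s t (walk_flow es) X = of_bool (u \<in> X) - of_bool (w \<in> X)"
  using assms(2,3)
proof (induction es arbitrary: u)
  case Nil
  then show ?case by (simp add: net_flow_def walk_flow_def)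
next
  case (Cons a es)
  obtain e d where a: "a = (e, d)" by force
  have "net_flow E s t (walk_flow (a # es)) X
     = (\<Sum>e'\<in>E. (if e' = e then arc_sign d * (of_bool (s e' \<in> X) - of_bool (t e' \<in> X)) else 0))
       + net_flow E s t (walk_flow es) X"
    unfolding net_flow_def sum.distrib[symmetric]
    by (intro sum.cong refl) (auto simp: a walk_flow_def algebra_simps)
  also have "\<dots> = arc_sign d * (of_bool (s e \<in> X) - of_bool (t e \<in> X)) + net_flow E s t (walk_flow es) X"
    using Cons.prems assms(1) by (simp add: a)
  also have "net_flow E s t (walk_flow es) X = of_bool ((if d then t e else s e) \<in> X) - of_bool (w \<in> X)"
    by (rule Cons.IH) (use Cons.prems in \<open>auto simp: a\<close>)
  finally show ?case using Cons.prems by (auto simp: a arc_sign_def)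
qed

lemma walk_flow_eq:
  assumes "distinct (map fst es)"
  shows "(e, d) \<in> set es \<Longrightarrow> walk_flow es e = arc_sign d"
    and "e \<notin> fst ` set es \<Longrightarrow> walk_flow es e = 0"
proof -
  show z: "e \<notin> fst ` set es \<Longrightarrow> walk_flow es e = 0" for e and es :: "('a \<times> bool) list"
    unfolding walk_flow_def by (induction es) auto
  show "(e, d) \<in> set es \<Longrightarrow> walk_flow es e = arc_sign d"
    using assms
  proof (induction es)
    case (Cons a es)
    then show ?case using z[of e es] by (cases a) (force simp: walk_flow_def)
  qed simp
qed

lemma net_flow_add:
  "net_flow E s t (\<lambda>e. f e + g e) X = net_flow E s t f X + net_flow E s t g X"
  "net_flow E s t (\<lambda>e. f e - g e) X = net_flow E s t f X - net_flow E s t g X"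
  by (simp_all add: net_flow_def algebra_simps sum.distrib sum_subtractf)

text \<open>\<open>X\<close> consists of the nodes reachable from \<open>A\<close> through
  \<open>R\<close>. Used with residual arcs to enlarge a flow and with flow-carrying arcs to
  decompose one.\<close>

lemma arc_reachable_cases:
  fixes R :: "('e \<times> bool) set"
  obtains (walk) es where "arc_walk s t A es B" "set es \<subseteq> R" "distinct (map fst es)"
  | (cut) X where "A \<in> X" "B \<notin> X"
      "\<And>e d. (e, d) \<in> R \<Longrightarrow> (if d then s e else t e) \<in> X \<Longrightarrow> (if d then t e else s e) \<in> X"
proof -
  define X where "X = {v. \<exists>es. arc_walk s t A es v \<and> set es \<subseteq> R}"
  have cl: "(if d then t e else s e) \<in> X" if r: "(e, d) \<in> R" and "(if d then s e else t e) \<in> X" for e d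
  proof -
    obtain es where es: "arc_walk s t A es (if d then s e else t e)" "set es \<subseteq> R"
      using \<open>(if d then s e else t e) \<in> X\<close> unfolding X_def by blast
    then have "arc_walk s t A (es @ [(e, d)]) (if d then t e else s e)" "set (es @ [(e, d)]) \<subseteq> R"
      using r by (auto simp: arc_walk_append)
    then show ?thesis unfolding X_def by blast
  qed
  have "A \<in> X" unfolding X_def by (auto intro!: exI[of _ "[]"])
  show thesis
  proof (cases "B \<in> X")
    case True
    then obtain es where "arc_walk s t A es B" "set es \<subseteq> R" unfolding X_def by blast
    then show thesis using arc_walk_distinct[of s t A es B] walk by (meson subset_trans)
  next
    case False
    then show thesis using \<open>A \<in> X\<close> cl cut by blast
  qed
qed

text \<open>A Ford-Fulkerson step: an arc is residual unless \<open>f\<close> saturates its edge in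
  that direction. If \<open>B\<close> is unreachable, every edge crossing the cut is saturated
  outwards, so their number is the flow value.\<close>

lemma augment_unit_flow:
  assumes fin: "finite E" and f: "unit_flow E s t A B c f"
  shows "(\<exists>f'. unit_flow E s t A B (c + 1) f') \<or>
    (\<exists>X. A \<in> X \<and> B \<notin> X \<and> int (card {e\<in>E. (s e \<in> X) \<noteq> (t e \<in> X)}) = c)"
proof (cases rule: arc_reachable_cases[of s t A B "{(e, d). e \<in> E \<and> f e \<noteq> arc_sign d}"])
  case (walk es)
  have "unit_flow E s t A B (c + 1) (\<lambda>e. f e + walk_flow es e)"
    unfolding unit_flow_def
  proof (intro conjI ballI allI)
    fix e assume e: "e \<in> E"
    have fe: "f e \<in> {-1, 0, 1}" using f e by (auto simp: unit_flow_def)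
    show "f e + walk_flow es e \<in> {-1, 0, 1}"
    proof (cases "e \<in> fst ` set es")
      case True
      then obtain d where d: "(e, d) \<in> set es" by force
      then have "f e \<noteq> arc_sign d" using walk(2) by auto
      then show ?thesis using fe walk_flow_eq(1)[OF walk(3) d] by (cases d) (auto simp: arc_sign_def)
    next
      case False
      then show ?thesis using fe walk_flow_eq(2)[OF walk(3)] by auto
    qed
  next
    fix X
    have "fst ` set es \<subseteq> E" using walk(2) by auto
    note w = net_flow_walk[OF fin walk(1) this, of X]
    have "net_flow E s t f X = c * (of_bool (A \<in> X) - of_bool (B \<in> X))"
      using f by (simp add: unit_flow_def)
    then show "net_flow E s t (\<lambda>e. f e + walk_flow es e) X = (c + 1) * (of_bool (A \<in> X) - of_bool (B \<in> X))"
      unfolding net_flow_add w by (simp only: algebra_simps)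
  qed
  then show ?thesis by blast
next
  case (cut X)
  have sat: "f e = arc_sign d"
    if "e \<in> E" "(if d then s e else t e) \<in> X" "(if d then t e else s e) \<notin> X" for e d
    using cut(3)[of e d] that by auto
  have "net_flow E s t f X = (\<Sum>e\<in>E. of_bool ((s e \<in> X) \<noteq> (t e \<in> X)))"
    unfolding net_flow_def
    by (intro sum.cong refl) (use sat[of _ True] sat[of _ False] in \<open>auto simp: arc_sign_def\<close>)
  also have "\<dots> = int (card {e\<in>E. (s e \<in> X) \<noteq> (t e \<in> X)})"
    using fin by (simp add: sum.If_cases of_bool_def Int_def)
  finally have "int (card {e\<in>E. (s e \<in> X) \<noteq> (t e \<in> X)}) = c"
    using f cut(1,2) by (simp add: unit_flow_def)
  then show ?thesis using cut(1,2) by blast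
qed

text \<open>If flow-carrying arcs did not lead to \<open>B\<close>, no flow would leave the
  reachable set, against \<open>c > 0\<close>.\<close>

lemma extract_walk_from_unit_flow:
  assumes fin: "finite E" and f: "unit_flow E s t A B c f" and c: "c > 0"
  obtains es where "arc_walk s t A es B" "set es \<subseteq> {(e, d). e \<in> E \<and> f e = arc_sign d}"
    "distinct (map fst es)" "unit_flow E s t A B (c - 1) (\<lambda>e. f e - walk_flow es e)"
proof (cases rule: arc_reachable_cases[of s t A B "{(e, d). e \<in> E \<and> f e = arc_sign d}"])
  case (walk es)
  have "unit_flow E s t A B (c - 1) (\<lambda>e. f e - walk_flow es e)"
    unfolding unit_flow_def
  proof (intro conjI ballI allI)
    fix e assume e: "e \<in> E"
    have fe: "f e \<in> {-1, 0, 1}" using f e by (auto simp: unit_flow_def)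
    show "f e - walk_flow es e \<in> {-1, 0, 1}"
    proof (cases "e \<in> fst ` set es")
      case True
      then obtain d where d: "(e, d) \<in> set es" by force
      then have "f e = arc_sign d" using walk(2) by auto
      then show ?thesis using walk_flow_eq(1)[OF walk(3) d] by auto
    next
      case False
      then show ?thesis using fe walk_flow_eq(2)[OF walk(3)] by auto
    qed
  next
    fix X
    have "fst ` set es \<subseteq> E" using walk(2) by auto
    note w = net_flow_walk[OF fin walk(1) this, of X]
    have "net_flow E s t f X = c * (of_bool (A \<in> X) - of_bool (B \<in> X))"
      using f by (simp add: unit_flow_def)
    then show "net_flow E s t (\<lambda>e. f e - walk_flow es e) X = (c - 1) * (of_bool (A \<in> X) - of_bool (B \<in> X))"
      unfolding net_flow_add w by (simp only: algebra_simps)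
  qed
  then show ?thesis using walk that by blast
next
  case (cut X)
  have sat: "f e \<noteq> arc_sign d"
    if "e \<in> E" "(if d then s e else t e) \<in> X" "(if d then t e else s e) \<notin> X" for e d
    using cut(3)[of e d] that by auto
  have "net_flow E s t f X \<le> 0"
    unfolding net_flow_def
  proof (intro sum_nonpos)
    fix e assume e: "e \<in> E"
    have "f e \<in> {-1, 0, 1}" using f e by (auto simp: unit_flow_def)
    then show "f e * (of_bool (s e \<in> X) - of_bool (t e \<in> X)) \<le> 0"
      using sat[of e True] sat[of e False] e by (auto simp: arc_sign_def)
  qed
  then show ?thesis using f cut(1,2) c by (simp add: unit_flow_def)
qed

text \<open>Menger's theorem for two paths, by augmenting the zero flow twice.\<close>

lemma two_disjoint_paths_or_cut:
  assumes fin: "finite G" and sub: "G \<subseteq> edges N"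
  shows "(\<exists>p q. edge_path N A p B \<and> edge_path N A q B \<and> set p \<inter> set q = {} \<and> set p \<union> set q \<subseteq> G) \<or>
    (\<exists>X. A \<in> X \<and> B \<notin> X \<and> card {e\<in>G. (end1 N e \<in> X) \<noteq> (end2 N e \<in> X)} \<le> 1)"
proof -
  let ?F = "unit_flow G (end1 N) (end2 N) A B"
  let ?cut = "\<lambda>c. \<exists>X. A \<in> X \<and> B \<notin> X \<and> int (card {e\<in>G. (end1 N e \<in> X) \<noteq> (end2 N e \<in> X)}) = c"
  have "?F 0 (\<lambda>_. 0)" by (simp add: unit_flow_def net_flow_def)
  from augment_unit_flow[OF fin this] have "?cut 0 \<or> (\<exists>f. ?F 1 f)"
    unfolding add_0 by (rule disj_commute[THEN iffD1])
  moreover have "?cut 1 \<or> (\<exists>f'. ?F 2 f')" if "?F 1 f" for f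
    using augment_unit_flow[OF fin that] unfolding one_add_one by (rule disj_commute[THEN iffD1])
  ultimately have "?cut 0 \<or> ?cut 1 \<or> (\<exists>f. ?F 2 f)" by blast
  then show ?thesis
  proof (elim disjE)
    assume "\<exists>f. ?F 2 f"
    then obtain f where 3: "?F 2 f" ..
    have F1: "?F (2 - 1) = ?F 1" by simp
    obtain p where p: "arc_walk (end1 N) (end2 N) A p B" "set p \<subseteq> {(e, d). e \<in> G \<and> f e = arc_sign d}"
        "distinct (map fst p)" "?F 1 (\<lambda>e. f e - walk_flow p e)"
      by (rule extract_walk_from_unit_flow[OF fin 3, unfolded F1]) simp_all
    obtain q where q: "arc_walk (end1 N) (end2 N) A q B"
        "set q \<subseteq> {(e, d). e \<in> G \<and> f e - walk_flow p e = arc_sign d}"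
      by (rule extract_walk_from_unit_flow[OF fin p(4)]) simp_all
    \<comment> \<open>Subtracting the first walk leaves flow 0 on its edges, whereas
      \<open>q\<close> uses edges whose remaining flow is 1 or -1.\<close>
    have "fst ` set p \<inter> fst ` set q = {}"
    proof (rule ccontr)
      assume "fst ` set p \<inter> fst ` set q \<noteq> {}"
      then obtain e d d' where "(e, d) \<in> set p" "(e, d') \<in> set q" by fastforce
      then have "walk_flow p e = arc_sign d" "f e = arc_sign d" "f e - walk_flow p e = arc_sign d'"
        using walk_flow_eq(1)[OF p(3), of e d] p(2) q(2) by blast+
      then have "arc_sign d' = 0" by simp
      then show False by (simp add: arc_sign_def split: if_splits)
    qed
    moreover have "fst ` set p \<subseteq> G" "fst ` set q \<subseteq> G" using p(2) q(2) by auto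
    ultimately show ?thesis
      using arc_walk_to_edge_path[OF p(1)] arc_walk_to_edge_path[OF q(1)] sub
      by (intro disjI1 exI[of _ "map fst p"] exI[of _ "map fst q"]) auto
  next
    assume "?cut 0"
    then obtain X where "A \<in> X" "B \<notin> X" "int (card {e\<in>G. (end1 N e \<in> X) \<noteq> (end2 N e \<in> X)}) = 0"
      by blast
    then show ?thesis by (intro disjI2 exI[of _ X]) simp
  next
    assume "?cut 1"
    then obtain X where "A \<in> X" "B \<notin> X" "int (card {e\<in>G. (end1 N e \<in> X) \<noteq> (end2 N e \<in> X)}) = 1"
      by blast
    then show ?thesis by (intro disjI2 exI[of _ X]) simp
  qed
qed

section \<open>Ranges of two-qubit states\<close>

definition qdet :: "(bool \<times> bool \<Rightarrow> complex) \<Rightarrow> complex" where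
  "qdet v = v (False, False) * v (True, True) - v (False, True) * v (True, False)"

text \<open>The polarisation of \<open>qdet\<close>. For product vectors \<open>u\<close>,
  \<open>v\<close> it vanishes exactly when all their combinations are product vectors.\<close>

definition qpol :: "(bool \<times> bool \<Rightarrow> complex) \<Rightarrow> (bool \<times> bool \<Rightarrow> complex) \<Rightarrow> complex" where
  "qpol u v = u (False, False) * v (True, True) + u (True, True) * v (False, False)
     - u (False, True) * v (True, False) - u (True, False) * v (False, True)"

definition vec_space :: "('a \<Rightarrow> complex) set \<Rightarrow> bool" where
  "vec_space V \<longleftrightarrow> V \<noteq> {} \<and> (\<forall>u\<in>V. \<forall>v\<in>V. \<forall>c d. (\<lambda>i. c * u i + d * v i) \<in> V)"

text \<open>For the Gram vectors \<open>W\<close> of a density operator this is its range.\<close>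

definition combos :: "('k \<Rightarrow> 'a \<Rightarrow> complex) \<Rightarrow> ('a \<Rightarrow> complex) set" where
  "combos W = {(\<lambda>i. \<Sum>k\<in>UNIV. c k * W k i) | c. True}"

text \<open>No coefficients, as product vectors are closed under scaling. Three summands, because
  \<open>not_product_spanned_form\<close> subtracts up to two product vectors and asks whether the
  rest is one.\<close>

definition product_spanned :: "(bool \<times> bool \<Rightarrow> complex) set \<Rightarrow> bool" where
  "product_spanned V \<longleftrightarrow> (\<forall>v\<in>V. \<exists>p\<in>V. \<exists>q\<in>V. \<exists>r\<in>V. qdet p = 0 \<and> qdet q = 0 \<and> qdet r = 0 \<and>
     (\<forall>i. v i = p i + q i + r i))"

lemma vec_spaceD:
  assumes "vec_space V"
  shows "u \<in> V \<Longrightarrow> v \<in> V \<Longrightarrow> (\<lambda>i. c * u i + d * v i) \<in> V"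
    and "u \<in> V \<Longrightarrow> (\<lambda>i. c * u i) \<in> V"
    and "(\<lambda>_. 0) \<in> V"
proof -
  show *: "u \<in> V \<Longrightarrow> v \<in> V \<Longrightarrow> (\<lambda>i. c * u i + d * v i) \<in> V" for u v c d
    using assms by (simp add: vec_space_def)
  show "u \<in> V \<Longrightarrow> (\<lambda>i. c * u i) \<in> V" using *[of u u c 0] by simp
  show "(\<lambda>_. 0) \<in> V" using assms *[of _ _ 0 0] unfolding vec_space_def by auto
qed

lemma vec_space_combos: "vec_space (combos W)"
  unfolding vec_space_def
proof (intro conjI ballI allI)
  show "combos W \<noteq> {}" by (auto simp: combos_def)
  fix u v c d assume "u \<in> combos W" "v \<in> combos W"
  then obtain a b where "u = (\<lambda>i. \<Sum>k\<in>UNIV. a k * W k i)" "v = (\<lambda>i. \<Sum>k\<in>UNIV. b k * W k i)"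
    by (auto simp: combos_def)
  then have "(\<lambda>i. c * u i + d * v i) = (\<lambda>i. \<Sum>k\<in>UNIV. (c * a k + d * b k) * W k i)"
    by (simp add: algebra_simps sum.distrib sum_distrib_left)
  then show "(\<lambda>i. c * u i + d * v i) \<in> combos W"
    unfolding combos_def by (intro CollectI exI[of _ "\<lambda>k. c * a k + d * b k"]) simp
qed

lemma generator_in_combos: "W k \<in> combos (W :: 'k::finite \<Rightarrow> 'a \<Rightarrow> complex)"
proof -
  have "W k = (\<lambda>i. \<Sum>j\<in>UNIV. (if j = k then 1 else 0) * W j i)"
    by (simp add: if_distrib if_distribR cong: if_cong)
  then show ?thesis unfolding combos_def by (intro CollectI exI[of _ "\<lambda>j. if j = k then 1 else 0"] conjI TrueI)
qed

lemma sum_two_qubits: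
  "(\<Sum>i\<in>UNIV. f i) = f (False, False) + f (False, True) + f (True, False) + (f (True, True) :: 'a::comm_monoid_add)"
  by (simp add: UNIV_Times_UNIV[symmetric] sum.cartesian_product' UNIV_bool ac_simps del: UNIV_Times_UNIV)

lemma qdet_line: "qdet (\<lambda>i. u i + t * v i) = qdet u + t * qpol u v + t\<^sup>2 * qdet v"
  by (simp add: qdet_def qpol_def power2_eq_square algebra_simps)

lemma qpol_sym: "qpol u v = qpol v u"
  by (simp add: qpol_def)

lemma qpol_linear: "qpol w (\<lambda>i. c * u i + d * v i) = c * qpol w u + d * qpol w v"
  by (simp add: qpol_def algebra_simps)

lemma qdet_scale: "qdet (\<lambda>i. c * v i) = c\<^sup>2 * qdet v"
  by (simp add: qdet_def power2_eq_square algebra_simps)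

lemma qdet_eq_0_iff_product:
  "qdet p = 0 \<longleftrightarrow> (\<exists>f g. \<forall>s t. p (s, t) = f s * g t)"
proof
  assume d: "qdet p = 0"
  show "\<exists>f g. \<forall>s t. p (s, t) = f s * g t"
  proof (cases "\<exists>a b. p (a, b) \<noteq> 0")
    case True
    then obtain a b where ab: "p (a, b) \<noteq> 0" by blast
    have *: "p (s, t) = p (s, b) * (p (a, t) / p (a, b))" for s t
      using d ab unfolding qdet_def
      by (cases s; cases t; cases a; cases b) (auto simp: field_simps)
    show ?thesis
      by (intro exI[of _ "\<lambda>s. p (s, b)"] exI[of _ "\<lambda>t. p (a, t) / p (a, b)"] allI) (rule *)
  qed (auto intro: exI[of _ "\<lambda>_. 0"])
qed (auto simp: qdet_def)

lemma complex_quadratic_root: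
  fixes a b c :: complex
  assumes "a \<noteq> 0"
  shows "\<exists>s. c + s * b + s\<^sup>2 * a = 0"
proof
  define r where "r = csqrt (b\<^sup>2 - 4 * a * c)"
  have r: "r * r = b * b - 4 * a * c" unfolding r_def by (metis power2_csqrt power2_eq_square)
  have "4 * a * (c + ((r - b) / (2 * a)) * b + ((r - b) / (2 * a))\<^sup>2 * a) = r * r - b * b + 4 * a * c"
    using assms by (simp add: power2_eq_square field_simps)
  also have "\<dots> = 0" by (simp add: r)
  finally show "c + ((r - b) / (2 * a)) * b + ((r - b) / (2 * a))\<^sup>2 * a = 0" using assms by simp
qed

text \<open>On a plane a complex quadratic form has a nontrivial zero: if \<open>qdet u\<close> is
  nonzero, the determinant of \<open>v + s u\<close> is a genuine quadratic in \<open>s\<close>, and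
  the vector at its root is not 0 because \<open>v\<close> is no multiple of
  \<open>u\<close>.\<close>

lemma product_vector_exists:
  assumes V: "vec_space V" and dim: "\<nexists>v. \<forall>u\<in>V. \<exists>c. u = (\<lambda>i. c * v i)"
  obtains p where "p \<in> V" "p \<noteq> (\<lambda>_. 0)" "qdet p = 0"
proof -
  obtain u where u: "u \<in> V" "u \<noteq> (\<lambda>_. 0)"
    using dim by (metis mult_zero_right)
  show thesis
  proof (cases "qdet u = 0")
    case True
    then show ?thesis using u that by blast
  next
    case False
    obtain v where v: "v \<in> V" "\<And>c. v \<noteq> (\<lambda>i. c * u i)" using dim by blast
    obtain s where s: "qdet v + s * qpol v u + s\<^sup>2 * qdet u = 0"
      using complex_quadratic_root[OF False] by blast
    have "(\<lambda>i. v i + s * u i) \<in> V" using vec_spaceD(1)[OF V v(1) u(1), of 1 s] by simp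
    moreover have "(\<lambda>i. v i + s * u i) \<noteq> (\<lambda>_. 0)"
    proof
      assume "(\<lambda>i. v i + s * u i) = (\<lambda>_. 0)"
      then have "v = (\<lambda>i. - s * u i)" by (auto simp: fun_eq_iff add_eq_0_iff)
      then show False using v(2) by blast
    qed
    moreover have "qdet (\<lambda>i. v i + s * u i) = 0" using s by (simp add: qdet_line)
    ultimately show ?thesis using that by blast
  qed
qed

text \<open>Take \<open>w\<close> that is not a sum of three product vectors. Then
  \<open>qpol\<close> vanishes between \<open>w\<close> and the product vectors of \<open>V\<close>,
  and between any two of these; otherwise adding suitable multiples to \<open>w\<close> would reach
  determinant 0. Orthogonality to \<open>|01>\<close> kills the \<open>|10>\<close> component, and a
  quadratic along \<open>w\<close> shows that \<open>w\<close> and \<open>|01>\<close> span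
  \<open>V\<close>.\<close>

lemma not_product_spanned_form:
  assumes V: "vec_space V" and e01: "(\<lambda>i. if i = (False, True) then 1 else 0) \<in> V"
    and not: "\<not> product_spanned V"
  obtains w where "w \<in> V" "w (True, False) = 0" "w (False, False) \<noteq> 0" "w (True, True) \<noteq> 0"
    "\<And>u. u \<in> V \<Longrightarrow> \<exists>c d. \<forall>i. u i = c * w i + (if i = (False, True) then d else 0)"
proof -
  define p :: "bool \<times> bool \<Rightarrow> complex" where "p = (\<lambda>i. if i = (False, True) then 1 else 0)"
  have p: "p \<in> V" "qdet p = 0" using e01 by (simp_all add: p_def qdet_def)
  have z: "(\<lambda>_. 0) \<in> V" "qdet (\<lambda>_. 0) = 0" using vec_spaceD(3)[OF V] by (simp_all add: qdet_def)
  from not obtain w where w: "w \<in> V" and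
    nw: "\<And>a b c. a \<in> V \<Longrightarrow> b \<in> V \<Longrightarrow> c \<in> V \<Longrightarrow> qdet a = 0 \<Longrightarrow> qdet b = 0 \<Longrightarrow> qdet c = 0
        \<Longrightarrow> \<exists>i. w i \<noteq> a i + b i + c i"
    unfolding product_spanned_def by metis
  have dw: "qdet w \<noteq> 0" using nw[OF w z(1) z(1) _ z(2) z(2)] by auto
  have sc: "(\<lambda>i. c * a i) \<in> V" "qdet (\<lambda>i. c * a i) = 0" if "a \<in> V" "qdet a = 0" for a c
    using that vec_spaceD(2)[OF V] by (auto simp: qdet_scale)
  have Bw: "qpol w a = 0" if a: "a \<in> V" "qdet a = 0" for a
  proof (rule ccontr)
    assume nz: "qpol w a \<noteq> 0"
    \<comment> \<open>As \<open>qdet a = 0\<close>, the determinant of \<open>w + t a\<close> is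
      affine in \<open>t\<close>; this is its zero.\<close>
    define t where "t = - qdet w / qpol w a"
    have 1: "(\<lambda>i. w i + t * a i) \<in> V" using vec_spaceD(1)[OF V w a(1), of 1 t] by simp
    have 2: "qdet (\<lambda>i. w i + t * a i) = 0" unfolding qdet_line using nz a by (simp add: t_def)
    show False using nw[OF 1 sc(1)[OF a, of "- t"] z(1) 2 sc(2)[OF a] z(2)] by simp
  qed
  have Bp: "qpol a b = 0" if a: "a \<in> V" "qdet a = 0" and b: "b \<in> V" "qdet b = 0" for a b
  proof (rule ccontr)
    assume nz: "qpol a b \<noteq> 0"
    \<comment> \<open>By \<open>Bw\<close>, adding \<open>a\<close> to \<open>w\<close> does not
      change the determinant, and \<open>w + a\<close> pairs with \<open>b\<close> to
      \<open>qpol a b\<close>. So \<open>w + a + t b\<close> is a product vector and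
      \<open>w\<close> a sum of three.\<close>
    define t where "t = - qdet w / qpol a b"
    have 0: "(\<lambda>i. w i + 1 * a i) \<in> V" using vec_spaceD(1)[OF V w a(1), of 1 1] by simp
    have 1: "(\<lambda>i. (w i + 1 * a i) + t * b i) \<in> V" using vec_spaceD(1)[OF V 0 b(1), of 1 t] by simp
    have "qpol (\<lambda>i. w i + 1 * a i) b = qpol a b"
      using qpol_linear[of b 1 w 1 a] Bw[OF b] by (simp add: qpol_sym)
    then have 2: "qdet (\<lambda>i. (w i + 1 * a i) + t * b i) = 0"
      unfolding qdet_line using Bw[OF a] a b nz by (simp add: t_def)
    show False
      using nw[OF 1 sc(1)[OF a, of "-1"] sc(1)[OF b, of "- t"] 2 sc(2)[OF a] sc(2)[OF b]] by simp
  qed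
  \<comment> \<open>Pairing with \<open>|01>\<close> reads off minus the \<open>|10>\<close>
    component.\<close>
  have wTF: "w (True, False) = 0" using Bw[OF p] by (simp add: qpol_def p_def)
  have wd: "w (False, False) \<noteq> 0" "w (True, True) \<noteq> 0" using dw wTF by (auto simp: qdet_def)
  have "\<exists>c d. \<forall>i. u i = c * w i + (if i = (False, True) then d else 0)" if u: "u \<in> V" for u
  proof -
    obtain s where s: "qdet u + s * qpol u w + s\<^sup>2 * qdet w = 0"
      using complex_quadratic_root[OF dw] by blast
    define q where "q = (\<lambda>i. u i + s * w i)"
    have q: "q \<in> V" "qdet q = 0"
      using vec_spaceD(1)[OF V u w, of 1 s] s by (simp_all add: q_def qdet_line)
    have q1: "q (True, False) = 0" using Bp[OF q p] by (simp add: qpol_def p_def)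
    have q2: "q (False, False) * q (True, True) = 0" using q(2) q1 by (simp add: qdet_def)
    have q3: "w (False, False) * q (True, True) + w (True, True) * q (False, False) = 0"
      using Bw[OF q] q1 wTF by (simp add: qpol_def)
    \<comment> \<open>The diagonal entries have product 0 and obey a linear relation with nonzero
      coefficients; so \<open>q\<close> is a multiple of \<open>|01>\<close>.\<close>
    have q4: "q (False, False) = 0" "q (True, True) = 0" using q2 q3 wd by auto
    have "u i = - s * w i + (if i = (False, True) then q (False, True) else 0)" for i
    proof -
      have "q i = (if i = (False, True) then q (False, True) else 0)"
        using q1 q4 by (cases i rule: prod.exhaust) (metis (full_types))
      then show ?thesis by (simp add: q_def algebra_simps split: if_splits)
    qed
    then show ?thesis by blast
  qed
  then show thesis using that w wTF wd by blast
qed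

section \<open>Matrix algebra of local unitaries and their action on vectors\<close>

lemma matrix_eqI: "(\<And>i j. A $ i $ j = B $ i $ j) \<Longrightarrow> A = B"
  by (simp add: vec_eq_iff)

lemma dagger_nth [simp]: "dagger M $ i $ j = cnj (M $ j $ i)"
  by (simp add: dagger_def)

lemma tensor_op_nth [simp]: "tensor_op S T $ i $ j = S $ fst i $ fst j * T $ snd i $ snd j"
  by (simp add: tensor_op_def)

lemma matrix_mult_nth: "(A ** B) $ i $ j = (\<Sum>k\<in>UNIV. A $ i $ k * B $ k $ j)"
  by (simp add: matrix_matrix_mult_def)

lemma tensor_op_mult: "tensor_op A B ** tensor_op C D = tensor_op (A ** C) (B ** D)"
  by (rule matrix_eqI)
    (simp add: matrix_mult_nth sum_product UNIV_Times_UNIV[symmetric] sum.cartesian_product'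
      mult_ac del: UNIV_Times_UNIV)

lemma dagger_mult: "dagger (A ** B) = dagger B ** dagger A"
  by (rule matrix_eqI) (simp add: matrix_mult_nth mult.commute)

lemma dagger_tensor_op: "dagger (tensor_op A B) = tensor_op (dagger A) (dagger B)"
  by (rule matrix_eqI) simp

lemma dagger_dagger [simp]: "dagger (dagger A) = A"
  by (rule matrix_eqI) simp

lemma tensor_op_mat_1: "tensor_op (mat 1) (mat 1) = mat 1"
  by (rule matrix_eqI) (auto simp: mat_def prod_eq_iff)

lemma unitary_op_mult:
  assumes "unitary_op U" "unitary_op V"
  shows "unitary_op (U ** V)"
proof -
  have "(dagger V ** dagger U) ** (U ** V) = dagger V ** (dagger U ** U) ** V"
    by (simp add: matrix_mul_assoc)
  moreover have "(U ** V) ** (dagger V ** dagger U) = U ** (V ** dagger V) ** dagger U"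
    by (simp add: matrix_mul_assoc)
  ultimately show ?thesis using assms by (simp add: unitary_op_def dagger_mult)
qed

lemma lu_equivalent_trans:
  assumes "lu_equivalent \<rho> \<sigma>" "lu_equivalent \<sigma> \<tau>"
  shows "lu_equivalent \<rho> \<tau>"
proof -
  obtain U V where 1: "unitary_op U" "unitary_op V" "\<rho> = tensor_op U V ** \<sigma> ** dagger (tensor_op U V)"
    using assms(1) by (auto simp: lu_equivalent_def)
  obtain U' V' where 2: "unitary_op U'" "unitary_op V'" "\<sigma> = tensor_op U' V' ** \<tau> ** dagger (tensor_op U' V')"
    using assms(2) by (auto simp: lu_equivalent_def)
  have "\<rho> = tensor_op (U ** U') (V ** V') ** \<tau> ** dagger (tensor_op (U ** U') (V ** V'))"
    unfolding 1(3) 2(3) by (simp add: tensor_op_mult[symmetric] dagger_mult matrix_mul_assoc)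
  then show ?thesis using 1 2 unitary_op_mult by (auto simp: lu_equivalent_def)
qed

lemma unitary_with_column:
  assumes "f b \<noteq> (0::complex) \<or> f (\<not> b) \<noteq> 0"
  obtains U :: qubit_op and n where "unitary_op U" "n \<noteq> 0" "\<And>s. f s = n * U $ s $ b"
proof -
  define n where "n = sqrt ((cmod (f True))\<^sup>2 + (cmod (f False))\<^sup>2)"
  have pos: "(cmod (f True))\<^sup>2 + (cmod (f False))\<^sup>2 > 0"
    using assms by (cases b) (auto simp: add_pos_nonneg add_nonneg_pos)
  then have n0: "n > 0" by (simp add: n_def)
  have nn: "complex_of_real n * complex_of_real n = f True * cnj (f True) + f False * cnj (f False)"
  proof -
    have "complex_of_real n * complex_of_real n = complex_of_real ((cmod (f True))\<^sup>2 + (cmod (f False))\<^sup>2)"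
      using pos unfolding n_def of_real_mult[symmetric] by (simp add: real_sqrt_mult_self)
    then show ?thesis by (simp only: of_real_add complex_norm_square)
  qed
  \<comment> \<open>The other column is \<open>f\<close> with its entries exchanged and conjugated
    and one sign changed, hence orthogonal to \<open>f\<close>.\<close>
  define U :: qubit_op where "U = (\<chi> s j. (if j = b then f s
      else if s then cnj (f False) else - cnj (f True)) / n)"
  have nz: "f False * cnj (f False) + f True * cnj (f True) \<noteq> 0"
    using nn n0 by (metis add.commute mult_eq_0_iff of_real_eq_0_iff less_irrefl)
  have "dagger U ** U = mat 1"
  proof (rule matrix_eqI)
    fix i j
    show "(dagger U ** U) $ i $ j = mat 1 $ i $ j"
      using n0 by (cases i; cases j; cases b)
        (simp_all add: matrix_mult_nth UNIV_bool U_def mat_def nn field_simps,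
         simp_all add: nz add_divide_distrib[symmetric])
  qed
  moreover from this have "U ** dagger U = mat 1" by (rule matrix_left_right_inverse[THEN iffD1])
  ultimately have "unitary_op U" by (simp add: unitary_op_def)
  then show thesis using n0 by (intro that[of U n]) (simp_all add: U_def)
qed

lemma rank_le_1_if_multiples:
  fixes \<rho> :: "complex ^ 'n ^ 'm"
  assumes "\<And>i j. \<rho> $ i $ j = a i * b j"
  shows "rank \<rho> \<le> 1"
proof -
  have "rows \<rho> \<subseteq> vec.span {\<chi> j. b j}"
  proof
    fix r assume "r \<in> rows \<rho>"
    then obtain i where "r = row i \<rho>" by (auto simp: rows_def)
    then have "r = a i *s (\<chi> j. b j)" by (simp add: row_def vec_eq_iff assms)
    then show "r \<in> vec.span {\<chi> j. b j}" by (simp add: vec.span_scale vec.span_base)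
  qed
  then have "vec.dim (rows \<rho>) \<le> card {(\<chi> j. b j) :: complex ^ 'n}" by (rule vec.dim_le_card) simp
  then show ?thesis by (simp add: row_rank_def_gen)
qed

definition op_app :: "complex ^ 'n ^ 'm \<Rightarrow> ('n \<Rightarrow> complex) \<Rightarrow> 'm \<Rightarrow> complex" where
  "op_app M v i = (\<Sum>j\<in>UNIV. M $ i $ j * v j)"

lemma op_app_mult: "op_app (A ** B) v = op_app A (op_app B v)"
proof
  fix i
  have "op_app (A ** B) v i = (\<Sum>j\<in>UNIV. \<Sum>k\<in>UNIV. A $ i $ k * B $ k $ j * v j)"
    by (simp add: op_app_def matrix_mult_nth sum_distrib_right)
  also have "\<dots> = (\<Sum>k\<in>UNIV. \<Sum>j\<in>UNIV. A $ i $ k * B $ k $ j * v j)" by (rule sum.swap)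
  finally show "op_app (A ** B) v i = op_app A (op_app B v) i"
    by (simp add: op_app_def sum_distrib_left mult.assoc)
qed

lemma op_app_mat_1: "op_app (mat 1) v = v"
  by (rule ext) (simp add: op_app_def mat_def mult_delta_left)

lemma op_app_combination:
  "op_app M (\<lambda>i. \<Sum>k\<in>S. c k * W k i) = (\<lambda>i. \<Sum>k\<in>S. c k * op_app M (W k) i)"
proof
  fix i
  have "op_app M (\<lambda>i. \<Sum>k\<in>S. c k * W k i) i = (\<Sum>j\<in>UNIV. \<Sum>k\<in>S. M $ i $ j * (c k * W k j))"
    by (simp add: op_app_def sum_distrib_left)
  also have "\<dots> = (\<Sum>k\<in>S. \<Sum>j\<in>UNIV. M $ i $ j * (c k * W k j))" by (rule sum.swap)
  also have "\<dots> = (\<Sum>k\<in>S. c k * op_app M (W k) i)"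
    by (simp add: op_app_def sum_distrib_left mult_ac)
  finally show "op_app M (\<lambda>i. \<Sum>k\<in>S. c k * W k i) i = (\<Sum>k\<in>S. c k * op_app M (W k) i)" .
qed

lemma combos_op_app: "combos (\<lambda>k. op_app M (W k)) = op_app M ` combos W"
  unfolding combos_def op_app_combination[symmetric] by blast

lemma op_app_tensor_product:
  assumes "\<And>s t. p (s, t) = f s * g t"
  shows "op_app (tensor_op U V) p (s, t) = op_app U f s * op_app V g t"
  unfolding op_app_def
  by (simp add: UNIV_Times_UNIV[symmetric] sum.cartesian_product' assms sum_product mult_ac
      del: UNIV_Times_UNIV)

lemma qdet_op_app_tensor: "qdet p = 0 \<Longrightarrow> qdet (op_app (tensor_op U V) p) = 0"
proof -
  assume "qdet p = 0"
  then obtain f g where fg: "\<And>s t. p (s, t) = f s * g t" unfolding qdet_eq_0_iff_product by blast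
  have "op_app (tensor_op U V) p (s, t) = op_app U f s * op_app V g t" for s t
    by (rule op_app_tensor_product) (rule fg)
  then show ?thesis
    unfolding qdet_eq_0_iff_product
    by (intro exI[of _ "op_app U f"] exI[of _ "op_app V g"]) simp
qed

lemma gram_conjugate:
  assumes "\<And>i j. \<rho> $ i $ j = (\<Sum>k\<in>S. W k i * cnj (W k j))"
  shows "(M ** \<rho> ** dagger M) $ i $ j = (\<Sum>k\<in>S. op_app M (W k) i * cnj (op_app M (W k) j))"
proof -
  have "(M ** \<rho> ** dagger M) $ i $ j
    = (\<Sum>b\<in>UNIV. \<Sum>a\<in>UNIV. \<Sum>k\<in>S. M $ i $ a * W k a * cnj (M $ j $ b * W k b))"
    by (simp add: matrix_mult_nth assms sum_distrib_left sum_distrib_right mult_ac)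
  also have "\<dots> = (\<Sum>b\<in>UNIV. \<Sum>k\<in>S. \<Sum>a\<in>UNIV. M $ i $ a * W k a * cnj (M $ j $ b * W k b))"
    by (intro sum.cong refl sum.swap)
  also have "\<dots> = (\<Sum>k\<in>S. \<Sum>b\<in>UNIV. \<Sum>a\<in>UNIV. M $ i $ a * W k a * cnj (M $ j $ b * W k b))"
    by (rule sum.swap)
  also have "\<dots> = (\<Sum>k\<in>S. op_app M (W k) i * cnj (op_app M (W k) j))"
    unfolding op_app_def cnj_sum sum_product by (intro sum.cong refl sum.swap)
  finally show ?thesis .
qed

lemma cnj_delta: "cnj (if b then x else 0) = (if b then cnj x else 0)"
  by simp

text \<open>\<open>\<pi>\<close> may be any map: the identity gives diagonal matrices, a bit flip
  permutations, and a constant map the filter of \<open>edge_filter_discard\<close>.\<close>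

lemma monomial_conjugate:
  assumes "\<And>i j. D $ i $ j = (if j = \<pi> i then f i else 0)"
  shows "(D ** \<sigma> ** dagger D) $ i $ j = f i * \<sigma> $ \<pi> i $ \<pi> j * cnj (f j)"
proof -
  have "(\<Sum>k\<in>UNIV. D $ i $ k * \<sigma> $ k $ j) = f i * \<sigma> $ \<pi> i $ j" for j
    by (simp add: assms mult_delta_left)
  then show ?thesis by (simp add: matrix_mult_nth assms cnj_delta mult_delta_right)
qed

lemma diagonal_conjugate:
  assumes "\<And>i j. D $ i $ j = (if i = j then f i else 0)"
  shows "(D ** \<sigma> ** dagger D) $ i $ j = f i * \<sigma> $ i $ j * cnj (f j)"
  by (rule monomial_conjugate[where \<pi> = "\<lambda>i. i"]) (simp add: assms eq_commute)

lemma unitary_diagonal: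
  assumes "\<And>b. cmod (f b) = 1"
  shows "unitary_op (\<chi> i j. if i = j then f i else 0)" (is "unitary_op ?U")
proof -
  have "f i * cnj (f i) = 1" for i using assms[of i] by (simp add: complex_norm_square[symmetric])
  then have f: "cnj (f i) * f i = 1" for i by (simp add: mult.commute)
  have "dagger ?U ** ?U = mat 1"
  proof (rule matrix_eqI)
    fix i j
    have "(dagger ?U ** ?U) $ i $ j = (\<Sum>k\<in>UNIV. if k = i then cnj (f i) * (if i = j then f i else 0) else 0)"
      unfolding matrix_mult_nth by (intro sum.cong) auto
    then show "(dagger ?U ** ?U) $ i $ j = mat 1 $ i $ j" by (simp add: mat_def f)
  qed
  then show ?thesis
    unfolding unitary_op_def by (intro conjI) (assumption, rule matrix_left_right_inverse[THEN iffD1])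
qed

lemma rho_agl_nth:
  "rho_agl \<alpha> \<gamma> l $ i $ j =
     (let \<psi> = (\<lambda>i. complex_of_real (if i = (False, False) then sqrt \<alpha> else if i = (True, True) then sqrt (1 - \<alpha> - \<gamma>)
          else if i = (False, True) then sqrt \<gamma> else 0))
      in l * (\<psi> i * \<psi> j) + (if i = (False, True) \<and> j = (False, True) then 1 - l else 0))"
proof -
  have k: "ket_ag \<alpha> \<gamma> $ i = complex_of_real (if i = (False, False) then sqrt \<alpha>
      else if i = (True, True) then sqrt (1 - \<alpha> - \<gamma>) else if i = (False, True) then sqrt \<gamma> else 0)" for i
    unfolding ket_ag_def ket_def
    by (cases i) (auto simp: axis_def scaleR_conv_of_real[where 'a = complex])
  show ?thesis
    unfolding rho_agl_def pure_op_def Let_def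
    by (simp add: k ket_def axis_def scaleR_conv_of_real[where 'a = complex])
qed

text \<open>Only the \<open>|01>\<close> components of the Gram vectors can fail to be proportional
  to \<open>c\<close>. Their part proportional to \<open>c\<close> joins \<open>w\<close> in one
  pure vector, the remainder contributes a multiple of \<open>|01><01|\<close>. The phases of the
  pure vector on \<open>|00>\<close>, \<open>|01>\<close>, \<open>|11>\<close> are removed by
  diagonal local unitaries.\<close>

lemma triangular_gram_lu_equivalent:
  fixes \<rho> :: two_qubit_op
  assumes \<rho>: "\<And>i j. \<rho> $ i $ j = (\<Sum>k\<in>S. W k i * cnj (W k j))" and S: "finite S"
    and tr: "trace \<rho> = 1"
    and W: "\<And>k i. k \<in> S \<Longrightarrow> W k i = c k * w i + (if i = (False, True) then d k else 0)"
    and w: "w (True, False) = 0" "w (False, False) \<noteq> 0" "w (True, True) \<noteq> 0"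
    and c: "\<exists>k\<in>S. c k \<noteq> 0"
  shows "\<exists>\<alpha> \<gamma> l. 0 \<le> l \<and> l \<le> 1 \<and> 0 \<le> \<alpha> \<and> 0 \<le> \<gamma> \<and> \<alpha> + \<gamma> \<le> 1 \<and> lu_equivalent \<rho> (rho_agl \<alpha> \<gamma> l)"
proof -
  define x where "x = w (False, False)"
  define y where "y = w (True, True)"
  define z where "z k = W k (False, True)" for k
  define C where "C = (\<Sum>k\<in>S. (cmod (c k))\<^sup>2)"
  define q where "q = (\<Sum>k\<in>S. (cmod (z k))\<^sup>2)"
  define r where "r = (\<Sum>k\<in>S. z k * cnj (c k))"
  have C0: "C > 0" unfolding C_def using S c by (auto intro!: sum_pos2)
  have Cc: "(\<Sum>k\<in>S. c k * cnj (c k)) = of_real C" by (simp only: C_def of_real_sum complex_norm_square)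
  have qc: "(\<Sum>k\<in>S. z k * cnj (z k)) = of_real q" by (simp only: q_def of_real_sum complex_norm_square)
  have rc: "(\<Sum>k\<in>S. c k * cnj (z k)) = cnj r" by (simp add: r_def mult.commute)
  have ent: "W k (False, False) = c k * x" "W k (True, True) = c k * y" "W k (True, False) = 0"
      "W k (False, True) = z k" if "k \<in> S" for k
    using W[OF that] w by (simp_all add: x_def y_def z_def)
  have e: "\<rho> $ (False, False) $ (False, False) = C * (x * cnj x)"
    "\<rho> $ (False, False) $ (True, True) = C * (x * cnj y)"
    "\<rho> $ (True, True) $ (False, False) = C * (y * cnj x)"
    "\<rho> $ (True, True) $ (True, True) = C * (y * cnj y)"
    "\<rho> $ (False, True) $ (False, False) = r * cnj x"
    "\<rho> $ (False, True) $ (True, True) = r * cnj y"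
    "\<rho> $ (False, False) $ (False, True) = x * cnj r"
    "\<rho> $ (True, True) $ (False, True) = y * cnj r"
    "\<rho> $ (False, True) $ (False, True) = q"
    "\<rho> $ (True, False) $ i = 0" "\<rho> $ i $ (True, False) = 0" for i
    unfolding \<rho> Cc[symmetric] qc[symmetric] rc[symmetric] r_def
    by (simp_all add: ent sum_distrib_left sum_distrib_right mult_ac)
  have norms: "x * cnj x = of_real ((cmod x)\<^sup>2)" "y * cnj y = of_real ((cmod y)\<^sup>2)"
    "r * cnj r = of_real ((cmod r)\<^sup>2)" by (simp_all only: complex_norm_square)
  have "complex_of_real (C * (cmod x)\<^sup>2 + q + C * (cmod y)\<^sup>2) = 1"
    using tr by (simp add: trace_def sum_two_qubits e norms)
  then have tr': "C * (cmod x)\<^sup>2 + q + C * (cmod y)\<^sup>2 = 1" using of_real_eq_1_iff by blast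
  \<comment> \<open>\<open>r / C\<close> is the least-squares coefficient of \<open>z\<close> on
    \<open>c\<close>. The squared norm of the residues is \<open>q - R\<close>, hence nonnegative;
    it is the weight of \<open>|01><01|\<close>.\<close>
  define R where "R = (cmod r)\<^sup>2 / C"
  have "complex_of_real (\<Sum>k\<in>S. (cmod (z k - r / C * c k))\<^sup>2) = (\<Sum>k\<in>S. z k * cnj (z k)) - (\<Sum>k\<in>S. z k * cnj (c k)) * (cnj r / C)
      - r / C * (\<Sum>k\<in>S. c k * cnj (z k)) + (r / C) * (cnj r / C) * (\<Sum>k\<in>S. c k * cnj (c k))"
    unfolding of_real_sum complex_norm_square
    by (simp add: algebra_simps sum.distrib sum_subtractf sum_distrib_left sum_divide_distrib)
  also have "\<dots> = of_real q - r * cnj r / C"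
    unfolding Cc qc rc r_def[symmetric] using C0 by (simp add: field_simps)
  also have "\<dots> = of_real (q - R)" unfolding norms R_def by simp
  finally have "(\<Sum>k\<in>S. (cmod (z k - r / C * c k))\<^sup>2) = q - R" by (simp only: of_real_eq_iff)
  moreover have "0 \<le> (\<Sum>k\<in>S. (cmod (z k - r / C * c k))\<^sup>2)" by (intro sum_nonneg) simp
  ultimately have qR: "0 \<le> q - R" by linarith
  define L where "L = C * (cmod x)\<^sup>2 + C * (cmod y)\<^sup>2 + R"
  have R0: "R \<ge> 0" using C0 by (simp add: R_def)
  have L0: "L > 0" using C0 R0 w by (simp add: L_def x_def y_def add_pos_nonneg)
  have L1: "1 - L = q - R" using tr' by (simp add: L_def)
  \<comment> \<open>\<open>a\<close>, \<open>b\<close>, \<open>g\<close> are the moduli on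
    \<open>|00>\<close>, \<open>|11>\<close>, \<open>|01>\<close> of the vector
    \<open>sqrt C * (x, y, r / C)\<close>, normalised; its squared length \<open>L\<close> becomes
    \<open>\<lambda>\<close>.\<close>
  define a where "a = sqrt C * cmod x / sqrt L"
  define b where "b = sqrt C * cmod y / sqrt L"
  define g where "g = cmod r / (sqrt C * sqrt L)"
  have nn: "a \<ge> 0" "b \<ge> 0" "g \<ge> 0" using C0 L0 by (simp_all add: a_def b_def g_def)
  have aL: "L * (a * a) = C * (cmod x)\<^sup>2" "L * (b * b) = C * (cmod y)\<^sup>2" "L * (g * g) = R"
    "L * (a * b) = C * (cmod x * cmod y)" "L * (a * g) = cmod x * cmod r" "L * (b * g) = cmod y * cmod r"
    using C0 L0 by (simp_all add: a_def b_def g_def R_def power2_eq_square field_simps)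
  have "L * (a * a + b * b + g * g) = L" using aL by (simp add: distrib_left L_def)
  then have abg: "a * a + b * b + g * g = 1" using L0 by simp
  have sq: "sqrt (a * a) = a" "sqrt (g * g) = g" "sqrt (1 - a * a - g * g) = b"
    using nn abg by (auto simp: real_sqrt_mult_self intro: real_sqrt_unique simp: power2_eq_square)
  \<comment> \<open>The required phases on \<open>|00>\<close>, \<open>|01>\<close>,
    \<open>|11>\<close> are \<open>v0\<close>, \<open>v1\<close>, \<open>u * v1\<close>, which
    determines \<open>u\<close>. As \<open>sgn 0 = 0\<close> is not unimodular, a vanishing
    \<open>r\<close> gets phase 1.\<close>
  define v0 where "v0 = sgn x"
  define v1 where "v1 = (if r = 0 then 1 else sgn r)"
  define u where "u = sgn y * cnj v1"
  have un: "cmod v0 = 1" "cmod v1 = 1" "cmod u = 1"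
    using w by (auto simp: v0_def v1_def u_def x_def y_def norm_sgn norm_mult)
  have unc: "v0 * cnj v0 = 1" "v1 * cnj v1 = 1" "u * cnj u = 1"
    using un by (simp_all add: complex_norm_square[symmetric])
  have ph: "x = cmod x * v0" "r = cmod r * v1" "y = cmod y * (u * v1)"
  proof -
    have sg: "c = cmod c * sgn c" for c :: complex by (cases "c = 0") (simp_all add: sgn_eq)
    show "x = cmod x * v0" "r = cmod r * v1" using sg[of x] sg[of r] by (auto simp: v0_def v1_def)
    have "u * v1 = sgn y * (v1 * cnj v1)" by (simp add: u_def)
    then show "y = cmod y * (u * v1)" unfolding unc using sg[of y] by simp
  qed
  define U :: qubit_op where "U = (\<chi> i j. if i = j then (if i then u else 1) else 0)"
  define V :: qubit_op where "V = (\<chi> i j. if i = j then (if i then v1 else v0) else 0)"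
  define D where "D i = (if fst i then u else 1) * (if snd i then v1 else v0)" for i
  have D: "tensor_op U V $ i $ j = (if i = j then D i else 0)" for i j
    by (cases i; cases j) (simp add: U_def V_def D_def)
  have "\<rho> $ i $ j = (tensor_op U V ** rho_agl (a * a) (g * g) L ** dagger (tensor_op U V)) $ i $ j" for i j
  proof -
    define \<psi> where "\<psi> i = complex_of_real (if i = (False, False) then a else if i = (True, True) then b
          else if i = (False, True) then g else 0)" for i
    have agl: "rho_agl (a * a) (g * g) L $ i $ j = L * (\<psi> i * \<psi> j)
        + (if i = (False, True) \<and> j = (False, True) then 1 - L else 0)"
      unfolding rho_agl_nth Let_def sq \<psi>_def by simp
    have LL: "complex_of_real L * (of_real a * of_real a) = of_real C * (of_real (cmod x) * of_real (cmod x))" "complex_of_real L * (of_real b * of_real b) = of_real C * (of_real (cmod y) * of_real (cmod y))"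
      "complex_of_real L * (of_real g * of_real g) = R"
      "complex_of_real L * (of_real a * of_real b) = of_real C * (of_real (cmod x) * of_real (cmod y))" "complex_of_real L * (of_real a * of_real g) = of_real (cmod x) * of_real (cmod r)"
      "complex_of_real L * (of_real b * of_real g) = of_real (cmod y) * of_real (cmod r)" 
      unfolding of_real_mult[symmetric] of_real_eq_iff by (rule aL[unfolded power2_eq_square])+
    have LL': "complex_of_real L * (of_real b * of_real a) = of_real C * (of_real (cmod x) * of_real (cmod y))" "complex_of_real L * (of_real g * of_real a) = of_real (cmod x) * of_real (cmod r)"
      "complex_of_real L * (of_real g * of_real b) = of_real (cmod y) * of_real (cmod r)" 
      using LL by (simp_all add: mult.commute)
    have q': "complex_of_real q = R + (1 - L)" 
    proof -
      have "q = R + (1 - L)" using L1 by simp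
      then have "complex_of_real q = of_real (R + (1 - L))" by (rule arg_cong)
      then show ?thesis by simp
    qed
    have agl_e: "rho_agl (a * a) (g * g) L $ i $ j =
       (if i = (True, False) \<or> j = (True, False) then 0
        else if i = (False, True) \<and> j = (False, True) then of_real q
        else if i = (False, True) \<or> j = (False, True)
        then (if i = (False, False) \<or> j = (False, False) then of_real (cmod x) * of_real (cmod r)
          else of_real (cmod y) * of_real (cmod r))
        else of_real C * ((if i = (False, False) then of_real (cmod x) else of_real (cmod y))
          * (if j = (False, False) then of_real (cmod x) else of_real (cmod y))))"
      unfolding agl by (cases i; cases j) (auto simp: \<psi>_def LL LL' q' mult_ac)
    define X Y R' where "X = complex_of_real (cmod x)" "Y = complex_of_real (cmod y)" "R' = complex_of_real (cmod r)"
    note XYR = this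
    have cr: "cnj X = X" "cnj Y = Y" "cnj R' = R'" by (simp_all add: XYR)
    have ph': "x = X * v0" "r = R' * v1" "y = Y * (u * v1)" unfolding XYR by (rule ph)+
    \<comment> \<open>Inserting \<open>v1 * cnj v1 = 1\<close> gives this entry the phase pattern of
      the others.\<close>
    have e9: "complex_of_real q = of_real q * (v1 * cnj v1)" by (simp add: unc)
    obtain i1 i2 j1 j2 where ij: "i = (i1, i2)" "j = (j1, j2)"
      by (cases i, cases j) (rule that)
    show ?thesis
      unfolding diagonal_conjugate[OF D] agl_e XYR[symmetric] unfolding ij
      by (cases i1; cases i2; cases j1; cases j2)
        (simp_all only: e(1-8,10,11) trans[OF e(9) e9] D_def ph' complex_cnj_mult cr prod.inject simp_thms
           if_True if_False fst_conv snd_conv mult_1_left mult_1_right complex_cnj_one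
           mult_zero_left mult_zero_right mult_ac)
  qed
  then have "\<rho> = tensor_op U V ** rho_agl (a * a) (g * g) L ** dagger (tensor_op U V)"
    by (rule matrix_eqI)
  moreover have "unitary_op U" "unitary_op V"
    unfolding U_def V_def by (rule unitary_diagonal; use un in simp)+
  ultimately have "lu_equivalent \<rho> (rho_agl (a * a) (g * g) L)"
    unfolding lu_equivalent_def by blast
  moreover have "L \<le> 1" using qR L1 by simp
  moreover have "a * a + g * g \<le> 1" using abg zero_le_square[of b] by linarith
  ultimately show ?thesis using L0 nn by (intro exI[of _ "a * a"] exI[of _ "g * g"] exI[of _ L]) simp
qed

text \<open>With \<open>f\<close> as column \<open>False\<close> of \<open>U\<close> and
  \<open>g\<close> as column \<open>True\<close> of \<open>V\<close>, the inverse unitaries carry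
  \<open>p\<close> to a multiple of \<open>|01>\<close>. Being spanned by product vectors is
  invariant under local unitaries, so \<open>not_product_spanned_form\<close> applies to the rotated
  range.\<close>

lemma product_spanned_or_rho_agl:
  fixes \<rho> :: two_qubit_op and W :: "bool \<times> bool \<Rightarrow> bool \<times> bool \<Rightarrow> complex"
  assumes \<rho>: "\<And>i j. \<rho> $ i $ j = (\<Sum>k\<in>UNIV. W k i * cnj (W k j))"
    and tr: "trace \<rho> = 1"
    and p: "p \<in> combos W" "p \<noteq> (\<lambda>_. 0)" "qdet p = 0"
    and not: "\<not> product_spanned (combos W)"
  shows "\<exists>\<alpha> \<gamma> l. 0 \<le> l \<and> l \<le> 1 \<and> 0 \<le> \<alpha> \<and> 0 \<le> \<gamma> \<and> \<alpha> + \<gamma> \<le> 1 \<and> lu_equivalent \<rho> (rho_agl \<alpha> \<gamma> l)"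
proof -
  obtain f g where fg: "\<And>s t. p (s, t) = f s * g t" using p(3) unfolding qdet_eq_0_iff_product by blast
  obtain s0 t0 where "p (s0, t0) \<noteq> 0" using p(2) by (metis ext surj_pair)
  then have "f s0 \<noteq> 0" "g t0 \<noteq> 0" using fg by auto
  then have "f False \<noteq> 0 \<or> f (\<not> False) \<noteq> 0" "g True \<noteq> 0 \<or> g (\<not> True) \<noteq> 0" by (metis (full_types))+
  then obtain U n V m where U: "unitary_op U" "n \<noteq> 0" "\<And>s. f s = n * U $ s $ False"
    and V: "unitary_op V" "m \<noteq> 0" "\<And>s. g s = m * V $ s $ True"
    using unitary_with_column[of f False] unitary_with_column[of g True] by metis
  define R where "R = tensor_op U V"
  have R: "dagger R ** R = mat 1" "R ** dagger R = mat 1"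
    using U(1) V(1) by (simp_all add: R_def dagger_tensor_op tensor_op_mult tensor_op_mat_1 unitary_op_def)
  define W' where "W' k = op_app (dagger R) (W k)" for k
  have cW': "combos W' = op_app (dagger R) ` combos W" unfolding W'_def combos_op_app ..
  have RR: "op_app (dagger R) (op_app R v) = v" "op_app R (op_app (dagger R) v) = v" for v
    using R by (simp_all add: op_app_mult[symmetric] op_app_mat_1)
  define e :: "bool \<times> bool \<Rightarrow> complex" where "e = (\<lambda>i. if i = (False, True) then 1 else 0)"
  have "p = op_app R (\<lambda>i. n * m * e i)"
  proof
    fix i :: "bool \<times> bool"
    show "p i = op_app R (\<lambda>i. n * m * e i) i"
      by (cases i) (simp add: fg U V R_def op_app_def e_def mult_delta_right)
  qed
  then have "op_app (dagger R) p = (\<lambda>i. n * m * e i)" by (simp add: RR)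
  then have "(\<lambda>i. n * m * e i) \<in> combos W'" unfolding cW' using p(1) by (metis imageI)
  from vec_spaceD(2)[OF vec_space_combos this, of "1 / (n * m)"]
  have e: "(\<lambda>i. if i = (False, True) then 1 else 0) \<in> combos W'" using U(2) V(2) by (simp add: e_def)
  have not': "\<not> product_spanned (combos W')"
  proof
    assume ps: "product_spanned (combos W')"
    have "product_spanned (combos W)"
      unfolding product_spanned_def
    proof
      fix v assume "v \<in> combos W"
      then have "op_app (dagger R) v \<in> combos W'" unfolding cW' by simp
      then obtain a b c where abc: "a \<in> combos W'" "b \<in> combos W'" "c \<in> combos W'"
          "qdet a = 0" "qdet b = 0" "qdet c = 0" "\<And>i. op_app (dagger R) v i = a i + b i + c i"
        using ps unfolding product_spanned_def by blast
      have in_W: "op_app R u \<in> combos W" if "u \<in> combos W'" for u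
        using that unfolding cW' by (auto simp: RR)
      have "op_app (dagger R) v = (\<lambda>i. a i + b i + c i)" using abc(7) by blast
      then have "v = op_app R (\<lambda>i. a i + b i + c i)" using RR(2)[of v] by simp
      then have "v i = op_app R a i + op_app R b i + op_app R c i" for i
        by (simp add: op_app_def algebra_simps sum.distrib)
      then show "\<exists>p\<in>combos W. \<exists>q\<in>combos W. \<exists>r\<in>combos W. qdet p = 0 \<and> qdet q = 0 \<and> qdet r = 0 \<and>
          (\<forall>i. v i = p i + q i + r i)"
        using in_W[OF abc(1)] in_W[OF abc(2)] in_W[OF abc(3)]
          qdet_op_app_tensor[OF abc(4), of U V] qdet_op_app_tensor[OF abc(5), of U V]
          qdet_op_app_tensor[OF abc(6), of U V] unfolding R_def[symmetric] by blast
    qed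
    with not show False ..
  qed
  obtain w where w: "w \<in> combos W'" "w (True, False) = 0" "w (False, False) \<noteq> 0" "w (True, True) \<noteq> 0"
    "\<And>u. u \<in> combos W' \<Longrightarrow> \<exists>c d. \<forall>i. u i = c * w i + (if i = (False, True) then d else 0)"
    using not_product_spanned_form[OF vec_space_combos e not'] by metis
  define \<rho>' where "\<rho>' = dagger R ** \<rho> ** dagger (dagger R)"
  have "\<exists>c d. \<forall>i. W' k i = c * w i + (if i = (False, True) then d else 0)" for k
    using w(5)[OF generator_in_combos] .
  then obtain c d where cd: "\<And>k i. W' k i = c k * w i + (if i = (False, True) then d k else 0)" by metis
  have g': "\<rho>' $ i $ j = (\<Sum>k\<in>UNIV. W' k i * cnj (W' k j))" for i j
    unfolding \<rho>'_def W'_def by (rule gram_conjugate) (rule \<rho>)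
  have "trace \<rho>' = trace (dagger R ** (\<rho> ** R))" by (simp add: \<rho>'_def matrix_mul_assoc)
  also have "\<dots> = trace (\<rho> ** R ** dagger R)" by (rule trace_mul_sym)
  also have "\<dots> = 1" using R(2) tr by (simp add: matrix_mul_assoc[symmetric])
  finally have tr': "trace \<rho>' = 1" .
  \<comment> \<open>Otherwise the whole span, and with it \<open>w\<close>, would vanish at
    \<open>|00>\<close>.\<close>
  have "\<exists>k\<in>UNIV. c k \<noteq> 0"
  proof (rule ccontr)
    assume "\<not> ?thesis"
    then have "c k = 0" for k by blast
    then have W'0: "W' k (False, False) = 0" for k by (simp add: cd)
    obtain c where "w = (\<lambda>i. \<Sum>k\<in>UNIV. c k * W' k i)" using w(1) unfolding combos_def by blast
    then have "w (False, False) = 0" by (simp only: W'0 mult_zero_right sum.neutral_const)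
    then show False using w(3) by simp
  qed
  from triangular_gram_lu_equivalent[OF g' finite tr' cd w(2-4) this]
  obtain \<alpha> \<gamma> l where *: "0 \<le> l \<and> l \<le> 1 \<and> 0 \<le> \<alpha> \<and> 0 \<le> \<gamma> \<and> \<alpha> + \<gamma> \<le> 1" "lu_equivalent \<rho>' (rho_agl \<alpha> \<gamma> l)"
    by blast
  have "R ** \<rho>' ** dagger R = (R ** dagger R) ** \<rho> ** (R ** dagger R)"
    by (simp add: \<rho>'_def matrix_mul_assoc)
  then have "\<rho> = tensor_op U V ** \<rho>' ** dagger (tensor_op U V)" by (simp add: R R_def[symmetric])
  then have lu: "lu_equivalent \<rho> \<rho>'" using U(1) V(1) by (auto simp: lu_equivalent_def)
  from *(1) lu_equivalent_trans[OF lu *(2)] show ?thesis by blast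
qed

text \<open>Rank at least 2 makes the range at least two-dimensional, whence \<open>p\<close>. It is
  supplied in both alternatives: necessity needs it for the crossing edge of the special
  form.\<close>

lemma mixed_state_range:
  fixes \<rho> :: two_qubit_op
  assumes "density_op \<rho>" "mixed \<rho>"
  obtains W :: "bool \<times> bool \<Rightarrow> bool \<times> bool \<Rightarrow> complex" and p where
    "\<And>i j. \<rho> $ i $ j = (\<Sum>k\<in>UNIV. W k i * cnj (W k j))"
    "p \<in> combos W" "p \<noteq> (\<lambda>_. 0)" "qdet p = 0"
    "product_spanned (combos W) \<or>
      (\<exists>\<alpha> \<gamma> l. 0 \<le> l \<and> l \<le> 1 \<and> 0 \<le> \<alpha> \<and> 0 \<le> \<gamma> \<and> \<alpha> + \<gamma> \<le> 1 \<and> lu_equivalent \<rho> (rho_agl \<alpha> \<gamma> l))"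
proof -
  have "\<exists>W :: bool \<times> bool \<Rightarrow> _. \<forall>i\<in>UNIV. \<forall>j\<in>UNIV. \<rho> $ i $ j = (\<Sum>k\<in>UNIV. W k i * cnj (W k j))"
  proof (rule psd_kernel_decomposition[of UNIV "\<lambda>i j. \<rho> $ i $ j"])
    have d: "dagger \<rho> = \<rho>"
      and psd: "\<And>v. 0 \<le> Re (\<Sum>i\<in>UNIV. \<Sum>j\<in>UNIV. cnj (v $ i) * \<rho> $ i $ j * v $ j)"
      using assms(1) unfolding density_op_def by blast+
    show "\<rho> $ j $ i = cnj (\<rho> $ i $ j)" for i j
      by (subst d[symmetric]) (rule dagger_nth)
    show "0 \<le> Re (\<Sum>i\<in>UNIV. \<Sum>j\<in>UNIV. cnj (v i) * \<rho> $ i $ j * v j)" for v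
      using psd[of "\<chi> i. v i"] by (simp only: vec_lambda_beta)
  qed simp
  then obtain W :: "bool \<times> bool \<Rightarrow> bool \<times> bool \<Rightarrow> complex"
    where W: "\<And>i j. \<rho> $ i $ j = (\<Sum>k\<in>UNIV. W k i * cnj (W k j))" by blast
  have "\<nexists>v. \<forall>u\<in>combos W. \<exists>c. u = (\<lambda>i. c * v i)"
  proof
    assume "\<exists>v. \<forall>u\<in>combos W. \<exists>c. u = (\<lambda>i. c * v i)"
    then obtain v where "\<And>k. \<exists>c. W k = (\<lambda>i. c * v i)" using generator_in_combos by blast
    then obtain c where c: "\<And>k. W k = (\<lambda>i. c k * v i)" by metis
    have "\<rho> $ i $ j = v i * ((\<Sum>k\<in>UNIV. c k * cnj (c k)) * cnj (v j))" for i j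
      unfolding W by (simp add: c sum_distrib_left sum_distrib_right mult_ac)
    from rank_le_1_if_multiples[OF this] show False using assms(2) by (simp add: mixed_def)
  qed
  from product_vector_exists[OF vec_space_combos this]
  obtain p where p: "p \<in> combos W" "p \<noteq> (\<lambda>_. 0)" "qdet p = 0" by blast
  have "trace \<rho> = 1" using assms(1) by (simp add: density_op_def)
  then show thesis using product_spanned_or_rho_agl[OF W _ p] by (intro that[OF W p]) blast
qed

section \<open>Operators that factor over a cut\<close>

definition merge_reg :: "'q set \<Rightarrow> ('q \<Rightarrow> bool) \<Rightarrow> ('q \<Rightarrow> bool) \<Rightarrow> 'q \<Rightarrow> bool" where
  "merge_reg S x y q = (if q \<in> S then x q else y q)"

lemma finite_basis_states: "finite Q \<Longrightarrow> finite (basis_states Q)"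
  by (intro finite_PiE) simp_all

lemma merge_reg_props:
  assumes "S \<inter> T = {}" "x \<in> basis_states S" "y \<in> basis_states T"
  shows "merge_reg S x y \<in> basis_states (S \<union> T)" "restrict (merge_reg S x y) S = x"
    "restrict (merge_reg S x y) T = y"
  using assms by (fastforce simp: merge_reg_def PiE_def extensional_def restrict_def fun_eq_iff)+

lemma sum_basis_split:
  assumes "S \<inter> T = {}"
  shows "(\<Sum>z\<in>basis_states (S \<union> T). F z) = (\<Sum>x\<in>basis_states S. \<Sum>y\<in>basis_states T. F (merge_reg S x y))"
  unfolding sum.cartesian_product
proof (rule sum.reindex_bij_witness[where j = "\<lambda>z. (restrict z S, restrict z T)"
      and i = "\<lambda>(x, y). merge_reg S x y"])
  show "(case (restrict z S, restrict z T) of (x, y) \<Rightarrow> merge_reg S x y) = z"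
    if "z \<in> basis_states (S \<union> T)" for z
    using that by (auto simp: merge_reg_def PiE_def extensional_def restrict_def fun_eq_iff)
  then show "(case (restrict z S, restrict z T) of (x, y) \<Rightarrow> F (merge_reg S x y)) = F z"
    if "z \<in> basis_states (S \<union> T)" for z
    using that by auto
qed (use merge_reg_props[OF assms] in auto)

lemma sum_basis_factor:
  fixes G H :: "('q \<Rightarrow> bool) \<Rightarrow> complex"
  assumes "S \<inter> T = {}"
  shows "(\<Sum>z\<in>basis_states (S \<union> T). G (restrict z S) * H (restrict z T))
    = (\<Sum>x\<in>basis_states S. G x) * (\<Sum>y\<in>basis_states T. H y)"
  unfolding sum_basis_split[OF assms] sum_product
  by (intro sum.cong refl) (simp add: merge_reg_props[OF assms])

text \<open>The tensor product operators of the bipartition; entries outside the register basis are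
  left free.\<close>

definition cut_kernel :: "'q set \<Rightarrow> 'q set \<Rightarrow> 'q reg_op \<Rightarrow> bool" where
  "cut_kernel S T L \<longleftrightarrow> (\<exists>G H. \<forall>x\<in>basis_states (S \<union> T). \<forall>y\<in>basis_states (S \<union> T).
     L x y = G (restrict x S) (restrict y S) * H (restrict x T) (restrict y T))"

definition cut_fun :: "'q set \<Rightarrow> 'q set \<Rightarrow> (('q \<Rightarrow> bool) \<Rightarrow> complex) \<Rightarrow> bool" where
  "cut_fun S T f \<longleftrightarrow> (\<exists>g h. \<forall>y\<in>basis_states (S \<union> T). f y = g (restrict y S) * h (restrict y T))"

definition op_comp :: "'q set \<Rightarrow> 'q reg_op \<Rightarrow> 'q reg_op \<Rightarrow> 'q reg_op" where
  "op_comp Q L E x y = (\<Sum>z\<in>basis_states Q. L x z * E z y)"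

lemma cut_kernel_sym: "cut_kernel S T L \<Longrightarrow> cut_kernel T S L"
proof -
  assume "cut_kernel S T L"
  then obtain G H where "\<forall>x\<in>basis_states (S \<union> T). \<forall>y\<in>basis_states (S \<union> T).
     L x y = G (restrict x S) (restrict y S) * H (restrict x T) (restrict y T)"
    unfolding cut_kernel_def by blast
  then show ?thesis unfolding cut_kernel_def by (intro exI[of _ H] exI[of _ G]) (simp add: Un_commute mult.commute)
qed

lemma cut_kernel_identity: "S \<inter> T = {} \<Longrightarrow> cut_kernel S T (\<lambda>x y. of_bool (x = y))"
  unfolding cut_kernel_def
proof (intro exI ballI)
  fix x y assume xy: "x \<in> basis_states (S \<union> T)" "y \<in> basis_states (S \<union> T)"
  have "x = y \<longleftrightarrow> restrict x S = restrict y S \<and> restrict x T = restrict y T"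
    using xy by (auto simp: fun_eq_iff restrict_def PiE_def extensional_def)
  then show "of_bool (x = y) = of_bool (restrict x S = restrict y S) * (of_bool (restrict x T = restrict y T) :: complex)"
    by simp
qed

lemma cut_kernel_extend_op_left:
  assumes "S \<inter> T = {}" "R \<subseteq> S"
  shows "cut_kernel S T (extend_op (S \<union> T) R K)"
  unfolding cut_kernel_def
proof (intro exI ballI)
  fix x y :: "'a \<Rightarrow> bool"
  have "restrict (restrict z S) R = restrict z R" for z :: "'a \<Rightarrow> bool"
    using assms(2) by (auto simp: restrict_def fun_eq_iff)
  moreover have "(\<forall>q\<in>S \<union> T - R. x q = y q) \<longleftrightarrow>
      (\<forall>q\<in>S - R. restrict x S q = restrict y S q) \<and> (\<forall>q\<in>T. restrict x T q = restrict y T q)"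
    using assms by auto
  ultimately show "extend_op (S \<union> T) R K x y = extend_op S R K (restrict x S) (restrict y S) *
      of_bool (\<forall>q\<in>T. restrict x T q = restrict y T q)"
    by (simp add: extend_op_def)
qed

lemma cut_kernel_extend_op:
  assumes "S \<inter> T = {}" "R \<subseteq> S \<or> R \<subseteq> T"
  shows "cut_kernel S T (extend_op (S \<union> T) R K)"
  using assms cut_kernel_extend_op_left[of S T R K] cut_kernel_extend_op_left[of T S R K] cut_kernel_sym
  by (auto simp: Int_commute Un_commute)

lemma cut_kernel_comp:
  assumes "S \<inter> T = {}" "cut_kernel S T L" "cut_kernel S T E"
  shows "cut_kernel S T (op_comp (S \<union> T) L E)"
proof -
  obtain G H where GH: "\<And>x y. x \<in> basis_states (S \<union> T) \<Longrightarrow> y \<in> basis_states (S \<union> T) \<Longrightarrow>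
     L x y = G (restrict x S) (restrict y S) * H (restrict x T) (restrict y T)"
    using assms(2) unfolding cut_kernel_def by blast
  obtain G' H' where GH': "\<And>x y. x \<in> basis_states (S \<union> T) \<Longrightarrow> y \<in> basis_states (S \<union> T) \<Longrightarrow>
     E x y = G' (restrict x S) (restrict y S) * H' (restrict x T) (restrict y T)"
    using assms(3) unfolding cut_kernel_def by blast
  show ?thesis
    unfolding cut_kernel_def
  proof (intro exI ballI)
    fix x y assume xy: "x \<in> basis_states (S \<union> T)" "y \<in> basis_states (S \<union> T)"
    have "op_comp (S \<union> T) L E x y = (\<Sum>z\<in>basis_states (S \<union> T).
       (G (restrict x S) (restrict z S) * G' (restrict z S) (restrict y S)) *
       (H (restrict x T) (restrict z T) * H' (restrict z T) (restrict y T)))"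
      unfolding op_comp_def by (intro sum.cong refl) (simp add: GH GH' xy mult_ac)
    also have "\<dots> = (\<Sum>z\<in>basis_states S. G (restrict x S) z * G' z (restrict y S)) *
        (\<Sum>z\<in>basis_states T. H (restrict x T) z * H' z (restrict y T))"
      by (rule sum_basis_factor[OF assms(1)])
    finally show "op_comp (S \<union> T) L E x y
      = (\<lambda>x y. \<Sum>z\<in>basis_states S. G x z * G' z y) (restrict x S) (restrict y S) *
        (\<lambda>x y. \<Sum>z\<in>basis_states T. H x z * H' z y) (restrict x T) (restrict y T)" by simp
  qed
qed

lemma cut_fun_mult: "cut_fun S T f \<Longrightarrow> cut_fun S T g \<Longrightarrow> cut_fun S T (\<lambda>y. f y * g y)"
proof -
  assume "cut_fun S T f" "cut_fun S T g"
  then obtain a b c d where "\<forall>y\<in>basis_states (S \<union> T). f y = a (restrict y S) * b (restrict y T)"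
    "\<forall>y\<in>basis_states (S \<union> T). g y = c (restrict y S) * d (restrict y T)"
    unfolding cut_fun_def by blast
  then show ?thesis
    unfolding cut_fun_def by (intro exI[of _ "\<lambda>z. a z * c z"] exI[of _ "\<lambda>z. b z * d z"]) simp
qed

lemma cut_fun_const: "cut_fun S T (\<lambda>_. c)"
  unfolding cut_fun_def by (intro exI[of _ "\<lambda>_. c"] exI[of _ "\<lambda>_. 1"]) simp

lemma cut_fun_prod: "(\<And>i. i \<in> I \<Longrightarrow> cut_fun S T (f i)) \<Longrightarrow> cut_fun S T (\<lambda>y. \<Prod>i\<in>I. f i y)"
  by (induction I rule: infinite_finite_induct) (auto intro: cut_fun_const cut_fun_mult)

lemma cut_fun_sym: "cut_fun S T f \<Longrightarrow> cut_fun T S f"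
proof -
  assume "cut_fun S T f"
  then obtain g h where gh: "\<forall>y\<in>basis_states (S \<union> T). f y = g (restrict y S) * h (restrict y T)"
    unfolding cut_fun_def by blast
  show ?thesis
    unfolding cut_fun_def by (rule exI[of _ h], rule exI[of _ g]) (use gh in \<open>simp add: Un_commute mult.commute\<close>)
qed

lemma cut_fun_local:
  assumes "{q, q'} \<subseteq> S \<or> {q, q'} \<subseteq> T"
  shows "cut_fun S T (\<lambda>y. f (y q) (y q'))"
proof -
  have *: "cut_fun S T (\<lambda>y. f (y q) (y q'))" if "{q, q'} \<subseteq> S" for S T
    unfolding cut_fun_def using that
    by (intro exI[of _ "\<lambda>z. f (z q) (z q')"] exI[of _ "\<lambda>_. 1"]) simp
  then show ?thesis using assms cut_fun_sym by blast
qed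

lemma cut_fun_product:
  assumes "q \<in> S \<union> T" "q' \<in> S \<union> T"
  shows "cut_fun S T (\<lambda>y. f (y q) * g (y q'))"
  by (rule cut_fun_mult) (use assms cut_fun_local[of q q S T "\<lambda>s _. f s"]
      cut_fun_local[of q' q' S T "\<lambda>s _. g s"] in auto)

text \<open>The amplitude of a network state \<open>\<Psi>\<close> in which the only correlation between the two sides
  of the cut is \<open>v\<close>, held by \<open>q1\<close> and \<open>q2\<close>.\<close>

lemma amplitude_one_crossing_edge:
  assumes dis: "S \<inter> T = {}" and L: "cut_kernel S T L" and \<Psi>: "cut_fun S T \<Psi>"
    and ab: "a \<in> S" "b \<in> T" and q: "q1 \<in> S" "q2 \<in> T"
    and x: "x \<in> basis_states (S \<union> T - {a, b})"
  shows "\<exists>\<gamma> \<eta>. \<forall>v i1 i2. (\<Sum>y\<in>basis_states (S \<union> T). L (x(a := i1, b := i2)) y * (v (y q1) (y q2) * \<Psi> y))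
    = (\<Sum>s\<in>UNIV. \<Sum>t\<in>UNIV. v s t * \<gamma> s i1 * (\<eta> t i2 :: complex))"
proof -
  obtain G H where GH: "\<And>x y. x \<in> basis_states (S \<union> T) \<Longrightarrow> y \<in> basis_states (S \<union> T) \<Longrightarrow>
     L x y = G (restrict x S) (restrict y S) * H (restrict x T) (restrict y T)"
    using L unfolding cut_kernel_def by blast
  obtain g h where gh: "\<And>y. y \<in> basis_states (S \<union> T) \<Longrightarrow> \<Psi> y = g (restrict y S) * h (restrict y T)"
    using \<Psi> unfolding cut_fun_def by blast
  \<comment> \<open>\<open>\<gamma>\<close> and \<open>\<eta>\<close> are the amplitudes contributed
    by the two sides once the crossing qubits are fixed to \<open>s\<close> and
    \<open>t\<close>.\<close>
  define \<gamma> where "\<gamma> s i1 = (\<Sum>y\<in>basis_states S. G (restrict (x(a := i1)) S) y * of_bool (y q1 = s) * g y)" for s i1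
  define \<eta> where "\<eta> t i2 = (\<Sum>y\<in>basis_states T. H (restrict (x(b := i2)) T) y * of_bool (y q2 = t) * h y)" for t i2
  show ?thesis
  proof (rule exI[of _ \<gamma>], rule exI[of _ \<eta>], intro allI)
    fix v :: "bool \<Rightarrow> bool \<Rightarrow> complex" and i1 i2
    have xi: "x(a := i1, b := i2) \<in> basis_states (S \<union> T)"
      using x ab by (auto simp: PiE_def extensional_def)
    have rS: "restrict (x(a := i1, b := i2)) S = restrict (x(a := i1)) S"
      using ab dis by (auto simp: restrict_def fun_eq_iff)
    have rT: "restrict (x(a := i1, b := i2)) T = restrict (x(b := i2)) T"
      using ab dis by (auto simp: restrict_def fun_eq_iff)
    \<comment> \<open>Expanding \<open>v\<close> in delta functions decouples the two sides, so that
      the sum over \<open>y\<close> factors.\<close>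
    have vv: "v s' t' = (\<Sum>s\<in>UNIV. \<Sum>t\<in>UNIV. v s t * of_bool (s' = s) * of_bool (t' = t))" for s' t'
      by (simp add: UNIV_bool)
    have "(\<Sum>y\<in>basis_states (S \<union> T). L (x(a := i1, b := i2)) y * (v (y q1) (y q2) * \<Psi> y))
      = (\<Sum>y\<in>basis_states (S \<union> T). \<Sum>s\<in>UNIV. \<Sum>t\<in>UNIV. v s t *
          ((G (restrict (x(a := i1)) S) (restrict y S) * of_bool (restrict y S q1 = s) * g (restrict y S)) *
          (H (restrict (x(b := i2)) T) (restrict y T) * of_bool (restrict y T q2 = t) * h (restrict y T))))"
    proof (intro sum.cong refl)
      fix y assume y: "y \<in> basis_states (S \<union> T)"
      show "L (x(a := i1, b := i2)) y * (v (y q1) (y q2) * \<Psi> y)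
        = (\<Sum>s\<in>UNIV. \<Sum>t\<in>UNIV. v s t *
          ((G (restrict (x(a := i1)) S) (restrict y S) * of_bool (restrict y S q1 = s) * g (restrict y S)) *
          (H (restrict (x(b := i2)) T) (restrict y T) * of_bool (restrict y T q2 = t) * h (restrict y T))))"
        unfolding GH[OF xi y] gh[OF y] rS rT
        by (subst vv) (simp add: q sum_distrib_left sum_distrib_right mult_ac)
    qed
    also have "\<dots> = (\<Sum>s\<in>UNIV. \<Sum>t\<in>UNIV. \<Sum>y\<in>basis_states (S \<union> T). v s t *
          ((G (restrict (x(a := i1)) S) (restrict y S) * of_bool (restrict y S q1 = s) * g (restrict y S)) *
          (H (restrict (x(b := i2)) T) (restrict y T) * of_bool (restrict y T q2 = t) * h (restrict y T))))"
      by (subst sum.swap, intro sum.cong refl, rule sum.swap)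
    also have "\<dots> = (\<Sum>s\<in>UNIV. \<Sum>t\<in>UNIV. v s t * \<gamma> s i1 * \<eta> t i2)"
    proof (intro sum.cong refl)
      fix s t
      show "(\<Sum>y\<in>basis_states (S \<union> T). v s t *
          ((G (restrict (x(a := i1)) S) (restrict y S) * of_bool (restrict y S q1 = s) * g (restrict y S)) *
          (H (restrict (x(b := i2)) T) (restrict y T) * of_bool (restrict y T q2 = t) * h (restrict y T))))
        = v s t * \<gamma> s i1 * \<eta> t i2"
        unfolding sum_distrib_left[symmetric]
        by (subst sum_basis_factor[OF dis,
            of "\<lambda>y. G (restrict (x(a := i1)) S) y * of_bool (y q1 = s) * g y"
               "\<lambda>y. H (restrict (x(b := i2)) T) y * of_bool (y q2 = t) * h y"])
          (simp add: \<gamma>_def \<eta>_def)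
    qed
    finally show "(\<Sum>y\<in>basis_states (S \<union> T). L (x(a := i1, b := i2)) y * (v (y q1) (y q2) * \<Psi> y))
      = (\<Sum>s\<in>UNIV. \<Sum>t\<in>UNIV. v s t * \<gamma> s i1 * \<eta> t i2)" .
  qed
qed

text \<open>The case \<open>v = 1\<close> of the previous lemma, with \<open>a\<close> and
  \<open>b\<close> as formal crossing qubits: the double sum becomes a function of \<open>i1\<close>
  times a function of \<open>i2\<close>.\<close>

lemma amplitude_no_crossing_edge:
  assumes dis: "S \<inter> T = {}" and L: "cut_kernel S T L" and \<Psi>: "cut_fun S T \<Psi>"
    and ab: "a \<in> S" "b \<in> T" and x: "x \<in> basis_states (S \<union> T - {a, b})"
  shows "qdet (\<lambda>i. \<Sum>y\<in>basis_states (S \<union> T). L (x(a := fst i, b := snd i)) y * \<Psi> y) = 0"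
proof -
  obtain \<gamma> \<eta> where "\<And>v i1 i2. (\<Sum>y\<in>basis_states (S \<union> T). L (x(a := i1, b := i2)) y * (v (y a) (y b) * \<Psi> y))
    = (\<Sum>s\<in>UNIV. \<Sum>t\<in>UNIV. v s t * \<gamma> s i1 * (\<eta> t i2 :: complex))"
    using amplitude_one_crossing_edge[OF dis L \<Psi> ab ab x] by blast
  from this[of _ _ "\<lambda>_ _. 1"] show ?thesis
    unfolding qdet_def by (simp add: UNIV_bool algebra_simps)
qed

text \<open>As matrices, \<open>w\<close> is the transpose of \<open>\<gamma>\<close> times
  \<open>v\<close> times \<open>\<eta>\<close>, and determinants multiply.\<close>

lemma qdet_bilinear:
  assumes "\<And>i1 i2. w (i1, i2) = (\<Sum>s\<in>UNIV. \<Sum>t\<in>UNIV. v (s, t) * \<gamma> s i1 * \<eta> t i2)"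
  shows "qdet w = qdet v * qdet (\<lambda>(s, i). \<gamma> s i) * qdet (\<lambda>(t, i). \<eta> t i)"
  unfolding qdet_def assms by (simp add: UNIV_bool algebra_simps)

text \<open>For a product \<open>p\<close> the vanishing sum is a product of a function of
  \<open>i1\<close> and one of \<open>i2\<close>, so one factor is identically 0. Then
  \<open>\<gamma>\<close> or \<open>\<eta>\<close> has a nontrivial kernel, hence determinant 0,
  whatever \<open>v\<close> is.\<close>

lemma qdet_bilinear_eq_0:
  assumes p: "qdet p = 0" "p \<noteq> (\<lambda>_. 0)"
    and 0: "\<And>i1 i2. (\<Sum>s\<in>UNIV. \<Sum>t\<in>UNIV. p (s, t) * \<gamma> s i1 * \<eta> t i2) = 0"
    and w: "\<And>i1 i2. w (i1, i2) = (\<Sum>s\<in>UNIV. \<Sum>t\<in>UNIV. v (s, t) * \<gamma> s i1 * \<eta> t i2)"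
  shows "qdet w = 0"
proof -
  obtain f g where fg: "\<And>s t. p (s, t) = f s * g t" using p(1) unfolding qdet_eq_0_iff_product by blast
  obtain s0 t0 where "p (s0, t0) \<noteq> 0" using p(2) by (metis ext surj_pair)
  then have nz: "f True \<noteq> 0 \<or> f False \<noteq> 0" "g True \<noteq> 0 \<or> g False \<noteq> 0"
    using fg by (metis (full_types) mult_eq_0_iff)+
  have lin: "qdet (\<lambda>(s, i). \<delta> s i) = 0" if "k True \<noteq> 0 \<or> k False \<noteq> 0" and "\<And>i. (\<Sum>s\<in>UNIV. k s * \<delta> s i) = 0"
    for k :: "bool \<Rightarrow> complex" and \<delta> :: "bool \<Rightarrow> bool \<Rightarrow> complex"
  proof -
    have e: "k True * \<delta> True i = - (k False * \<delta> False i)" for i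
      using that(2)[of i] by (simp add: UNIV_bool add_eq_0_iff)
    have "k True * (\<delta> False False * \<delta> True True - \<delta> False True * \<delta> True False)
       = \<delta> False False * (k True * \<delta> True True) - \<delta> False True * (k True * \<delta> True False)"
      by (simp add: algebra_simps)
    also have "\<dots> = 0" unfolding e by simp
    finally have 1: "k True = 0 \<or> \<delta> False False * \<delta> True True - \<delta> False True * \<delta> True False = 0" by simp
    have e': "k False * \<delta> False i = - (k True * \<delta> True i)" for i using e[of i] by simp
    have "k False * (\<delta> False False * \<delta> True True - \<delta> False True * \<delta> True False)
       = (k False * \<delta> False False) * \<delta> True True - (k False * \<delta> False True) * \<delta> True False"
      by (simp add: algebra_simps)
    also have "\<dots> = 0" unfolding e' by simp
    finally have 2: "k False = 0 \<or> \<delta> False False * \<delta> True True - \<delta> False True * \<delta> True False = 0" by simp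
    show ?thesis using 1 2 that(1) by (auto simp: qdet_def)
  qed
  have "(\<Sum>s\<in>UNIV. f s * \<gamma> s i1) * (\<Sum>t\<in>UNIV. g t * \<eta> t i2) = 0" for i1 i2
    using 0[of i1 i2] by (simp add: fg sum_product mult_ac)
  then have "(\<forall>i. (\<Sum>s\<in>UNIV. f s * \<gamma> s i) = 0) \<or> (\<forall>i. (\<Sum>t\<in>UNIV. g t * \<eta> t i) = 0)"
    using mult_eq_0_iff by blast
  then have "qdet (\<lambda>(s, i). \<gamma> s i) = 0 \<or> qdet (\<lambda>(t, i). \<eta> t i) = 0"
    using lin[of f \<gamma>] lin[of g \<eta>] nz by blast
  then show ?thesis using qdet_bilinear[of w v \<gamma> \<eta>, OF w] by auto
qed

section \<open>Protocol branches as sums of conjugations\<close>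

definition conj_term :: "'q set \<Rightarrow> 'q reg_op \<Rightarrow> 'q reg_op \<Rightarrow> 'q reg_op" where
  "conj_term Q L \<rho> x y = (\<Sum>x'\<in>basis_states Q. \<Sum>y'\<in>basis_states Q. L x x' * \<rho> x' y' * cnj (L y y'))"

lemma apply_kraus_conj_term:
  "apply_kraus Q S Ks \<sigma> x y = (\<Sum>K\<leftarrow>Ks. conj_term Q (extend_op Q S K) \<sigma> x y)"
  by (simp add: apply_kraus_def conj_term_def)

lemma conj_term_comp: "conj_term Q L (conj_term Q E \<rho>) x y = conj_term Q (op_comp Q L E) \<rho> x y"
proof -
  let ?B = "basis_states Q"
  have "conj_term Q L (conj_term Q E \<rho>) x y = (\<Sum>p\<in>?B \<times> ?B. \<Sum>r\<in>?B \<times> ?B.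
      L x (fst p) * (E (fst p) (fst r) * \<rho> (fst r) (snd r) * cnj (E (snd p) (snd r))) * cnj (L y (snd p)))"
    by (simp add: conj_term_def sum.cartesian_product' sum_distrib_left sum_distrib_right)
  also have "\<dots> = (\<Sum>r\<in>?B \<times> ?B. \<Sum>p\<in>?B \<times> ?B.
      L x (fst p) * (E (fst p) (fst r) * \<rho> (fst r) (snd r) * cnj (E (snd p) (snd r))) * cnj (L y (snd p)))"
    by (rule sum.swap)
  also have "\<dots> = (\<Sum>r\<in>?B \<times> ?B. op_comp Q L E x (fst r) * \<rho> (fst r) (snd r) * cnj (op_comp Q L E y (snd r)))"
  proof (intro sum.cong refl)
    fix r
    have "op_comp Q L E x (fst r) * \<rho> (fst r) (snd r) * cnj (op_comp Q L E y (snd r))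
       = \<rho> (fst r) (snd r) * ((\<Sum>a\<in>?B. L x a * E a (fst r)) * (\<Sum>b\<in>?B. cnj (L y b) * cnj (E b (snd r))))"
      by (simp add: op_comp_def mult_ac)
    also have "\<dots> = (\<Sum>a\<in>?B. \<Sum>b\<in>?B. \<rho> (fst r) (snd r) * ((L x a * E a (fst r)) * (cnj (L y b) * cnj (E b (snd r)))))"
      unfolding sum_product by (simp add: sum_distrib_left)
    finally show "(\<Sum>p\<in>?B \<times> ?B. L x (fst p) * (E (fst p) (fst r) * \<rho> (fst r) (snd r) * cnj (E (snd p) (snd r))) * cnj (L y (snd p)))
       = op_comp Q L E x (fst r) * \<rho> (fst r) (snd r) * cnj (op_comp Q L E y (snd r))"
      by (simp add: sum.cartesian_product' mult_ac)
  qed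
  finally show ?thesis by (simp add: conj_term_def sum.cartesian_product')
qed

lemma conj_term_sum_list:
  "conj_term Q L (\<lambda>x y. \<Sum>E\<leftarrow>Es. f E x y) x y = (\<Sum>E\<leftarrow>Es. conj_term Q L (f E) x y)"
proof (induction Es)
  case Nil
  then show ?case by (simp add: conj_term_def)
next
  case (Cons E Es)
  have "conj_term Q L (\<lambda>x y. f E x y + g x y) x y = conj_term Q L (f E) x y + conj_term Q L g x y" for g
    by (simp add: conj_term_def algebra_simps sum.distrib)
  from this[of "\<lambda>x y. \<Sum>E\<leftarrow>Es. f E x y"] show ?case using Cons.IH by simp
qed

lemma conj_term_identity:
  assumes "finite Q" "x \<in> basis_states Q" "y \<in> basis_states Q"
  shows "conj_term Q (\<lambda>x y. of_bool (x = y)) \<rho> x y = \<rho> x y"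
proof -
  have "conj_term Q (\<lambda>x y. of_bool (x = y)) \<rho> x y
     = (\<Sum>x'\<in>basis_states Q. if x = x' then (\<Sum>y'\<in>basis_states Q. if y = y' then \<rho> x' y' else 0) else 0)"
    unfolding conj_term_def by (intro sum.cong refl) (auto intro!: sum.cong)
  also have "\<dots> = \<rho> x y"
    using assms by (simp add: finite_basis_states)
  finally show ?thesis .
qed

lemma finite_qubits:
  fixes N :: "('v, 'e) network"
  assumes N: "quantum_network N"
  shows "finite (qubits N k)"
proof -
  have "finite (SIGMA v:nodes N. {..<k v})" using N by (simp add: quantum_network_def)
  then have "finite ((\<lambda>(v, i). Ancilla v i :: ('v, 'e) qubit) ` (SIGMA v:nodes N. {..<k v}))"
    by (rule finite_imageI)
  moreover have "{Ancilla v i :: ('v, 'e) qubit | v i. v \<in> nodes N \<and> i < k v}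
    \<subseteq> (\<lambda>(v, i). Ancilla v i) ` (SIGMA v:nodes N. {..<k v})" by auto
  ultimately have "finite {Ancilla v i :: ('v, 'e) qubit | v i. v \<in> nodes N \<and> i < k v}"
    by (rule finite_subset[rotated])
  then show ?thesis using N by (simp add: qubits_def quantum_network_def)
qed

text \<open>A Kraus operator acts on the qubits of one node, hence on one side of the cut. Products
  along the branch keep this form; a list arises because one announced result may stand for several
  Kraus operators.\<close>

lemma outcome_cut_form:
  assumes "outcome N k \<rho> P \<sigma>" and "quantum_network N"
    and "S = {q \<in> qubits N k. holder N q \<in> X}" and "T = {q \<in> qubits N k. holder N q \<notin> X}"
  shows "\<exists>Ls. (\<forall>L\<in>set Ls. cut_kernel S T L) \<and>
    (\<forall>x\<in>basis_states (S \<union> T). \<forall>y\<in>basis_states (S \<union> T). \<sigma> x y = (\<Sum>L\<leftarrow>Ls. conj_term (S \<union> T) L \<rho> x y))"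
  using assms(1)
proof induction
  case (Done \<rho>)
  have "finite (S \<union> T)" using finite_qubits[OF assms(2)] assms(3,4) by simp
  moreover have "S \<inter> T = {}" using assms(3,4) by auto
  ultimately show ?case
    by (intro exI[of _ "[\<lambda>x y. of_bool (x = y)]"]) (simp add: cut_kernel_identity conj_term_identity)
next
  case (Local Ks P bs v \<rho> \<sigma>)
  have Q: "qubits N k = S \<union> T" using assms(3,4) by auto
  have dis: "S \<inter> T = {}" using assms(3,4) by auto
  obtain Ls where Ls: "\<And>L. L \<in> set Ls \<Longrightarrow> cut_kernel S T L"
    "\<And>x y. x \<in> basis_states (S \<union> T) \<Longrightarrow> y \<in> basis_states (S \<union> T) \<Longrightarrow>
      \<sigma> x y = (\<Sum>L\<leftarrow>Ls. conj_term (S \<union> T) L (apply_kraus (S \<union> T) (held N k v) Ks \<rho>) x y)"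
    using Local.IH unfolding Q by blast
  define Es where "Es = map (extend_op (S \<union> T) (held N k v)) Ks"
  have ak: "apply_kraus (S \<union> T) (held N k v) Ks \<rho> = (\<lambda>x y. \<Sum>E\<leftarrow>Es. conj_term (S \<union> T) E \<rho> x y)"
    by (simp add: fun_eq_iff apply_kraus_conj_term Es_def comp_def)
  have "held N k v \<subseteq> S \<or> held N k v \<subseteq> T" using assms(3,4) by (auto simp: held_def)
  then have Es: "cut_kernel S T E" if "E \<in> set Es" for E
    using that cut_kernel_extend_op[OF dis] by (auto simp: Es_def)
  show ?case
  proof (intro exI[of _ "concat (map (\<lambda>L. map (op_comp (S \<union> T) L) Es) Ls)"] conjI ballI)
    fix L assume "L \<in> set (concat (map (\<lambda>L. map (op_comp (S \<union> T) L) Es) Ls))"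
    then show "cut_kernel S T L" using Ls(1) Es cut_kernel_comp[OF dis] by auto
  next
    fix x y assume xy: "x \<in> basis_states (S \<union> T)" "y \<in> basis_states (S \<union> T)"
    have "(\<Sum>L\<leftarrow>concat (map (\<lambda>L. map (op_comp (S \<union> T) L) Es) Ls). conj_term (S \<union> T) L \<rho> x y)
      = (\<Sum>L\<leftarrow>Ls. \<Sum>E\<leftarrow>Es. conj_term (S \<union> T) (op_comp (S \<union> T) L E) \<rho> x y)"
      by (induction Ls) (simp_all add: comp_def)
    also have "\<dots> = \<sigma> x y"
      unfolding Ls(2)[OF xy] ak conj_term_sum_list conj_term_comp ..
    finally show "\<sigma> x y = (\<Sum>L\<leftarrow>concat (map (\<lambda>L. map (op_comp (S \<union> T) L) Es) Ls). conj_term (S \<union> T) L \<rho> x y)" ..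
  qed
qed

section \<open>Network amplitudes as multilinear functions of the edge vectors\<close>

definition ancilla_zero :: "('v, 'e) network \<Rightarrow> ('v \<Rightarrow> nat) \<Rightarrow> (('v, 'e) qubit \<Rightarrow> bool) \<Rightarrow> complex" where
  "ancilla_zero N k y = (\<Prod>(v, i)\<in>(SIGMA v:nodes N. {..<k v}). of_bool (\<not> y (Ancilla v i)))"

text \<open>The vectors \<open>w e\<close> are arbitrary and not tied to \<open>edge_state\<close>,
  so that they can be exchanged one edge at a time.\<close>

definition edge_product ::
    "('v, 'e) network \<Rightarrow> ('v \<Rightarrow> nat) \<Rightarrow> ('e \<Rightarrow> bool \<times> bool \<Rightarrow> complex) \<Rightarrow> (('v, 'e) qubit \<Rightarrow> bool) \<Rightarrow> complex" where
  "edge_product N k w y = (\<Prod>e\<in>edges N. w e (y (End1 e), y (End2 e))) * ancilla_zero N k y"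

lemma edge_product_multilinear:
  assumes "finite (edges N)" and "\<And>e. e \<in> edges N \<Longrightarrow> w e = (\<lambda>i. \<Sum>j\<in>(UNIV::'j::finite set). C e j * W e j i)"
  shows "edge_product N k w y = (\<Sum>c\<in>edges N \<rightarrow>\<^sub>E UNIV. (\<Prod>e\<in>edges N. C e (c e)) * edge_product N k (\<lambda>e. W e (c e)) y)"
proof -
  have "(\<Prod>e\<in>edges N. w e (y (End1 e), y (End2 e)))
     = (\<Prod>e\<in>edges N. \<Sum>j\<in>UNIV. C e j * W e j (y (End1 e), y (End2 e)))"
    by (intro prod.cong refl) (simp add: assms(2))
  also have "\<dots> = (\<Sum>c\<in>edges N \<rightarrow>\<^sub>E UNIV. \<Prod>e\<in>edges N. C e (c e) * W e (c e) (y (End1 e), y (End2 e)))"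
    using assms(1) by (intro prod_sum_PiE) auto
  finally show ?thesis
    unfolding edge_product_def by (simp add: prod.distrib sum_distrib_right sum_distrib_left mult_ac)
qed

lemma edge_product_update:
  assumes "finite (edges N)" "e \<in> edges N"
  shows "edge_product N k (w(e := v)) y = v (y (End1 e), y (End2 e)) *
    ((\<Prod>e'\<in>edges N - {e}. w e' (y (End1 e'), y (End2 e'))) * ancilla_zero N k y)"
proof -
  have "(\<Prod>e'\<in>edges N. (w(e := v)) e' (y (End1 e'), y (End2 e')))
     = v (y (End1 e), y (End2 e)) * (\<Prod>e'\<in>edges N - {e}. (w(e := v)) e' (y (End1 e'), y (End2 e')))"
    using assms by (subst prod.remove[of _ e]) auto
  also have "(\<Prod>e'\<in>edges N - {e}. (w(e := v)) e' (y (End1 e'), y (End2 e')))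
     = (\<Prod>e'\<in>edges N - {e}. w e' (y (End1 e'), y (End2 e')))"
    by (intro prod.cong refl) auto
  finally show ?thesis unfolding edge_product_def by (simp add: mult.assoc)
qed

text \<open>Gram decompositions multiply: \<open>c\<close> picks one Gram vector for each edge, and
  the ancillas are pure.\<close>

lemma initial_state_gram:
  assumes "finite (edges N)"
    and "\<And>e i j. e \<in> edges N \<Longrightarrow> edge_state N e $ i $ j = (\<Sum>k\<in>(UNIV::'j::finite set). W e k i * cnj (W e k j))"
  shows "initial_state N k x y = (\<Sum>c\<in>edges N \<rightarrow>\<^sub>E UNIV.
    edge_product N k (\<lambda>e. W e (c e)) x * cnj (edge_product N k (\<lambda>e. W e (c e)) y))"
proof -
  have anc: "(\<Prod>(v, i)\<in>(SIGMA v:nodes N. {..<k v}). if \<not> x (Ancilla v i) \<and> \<not> y (Ancilla v i) then 1 else 0)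
     = ancilla_zero N k x * cnj (ancilla_zero N k y)"
    unfolding ancilla_zero_def cnj_prod prod.distrib[symmetric] by (intro prod.cong refl) auto
  have "(\<Prod>e\<in>edges N. edge_state N e $ (x (End1 e), x (End2 e)) $ (y (End1 e), y (End2 e)))
    = (\<Prod>e\<in>edges N. \<Sum>k\<in>UNIV. W e k (x (End1 e), x (End2 e)) * cnj (W e k (y (End1 e), y (End2 e))))"
    by (intro prod.cong refl) (simp add: assms(2))
  also have "\<dots> = (\<Sum>c\<in>edges N \<rightarrow>\<^sub>E UNIV. \<Prod>e\<in>edges N. W e (c e) (x (End1 e), x (End2 e)) * cnj (W e (c e) (y (End1 e), y (End2 e))))"
    using assms(1) by (intro prod_sum_PiE) auto
  finally show ?thesis
    unfolding initial_state_def anc edge_product_def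
    by (simp add: prod.distrib sum_distrib_right sum_distrib_left mult_ac)
qed

text \<open>The squared moduli of the minors \<open>a t i * \<phi> j - a t j * \<phi> i\<close>,
  summed over \<open>t\<close>, involve only Gram entries, and these cancel; so every minor is
  0.\<close>

lemma rank_one_gram:
  fixes a :: "'t \<Rightarrow> 'i \<Rightarrow> complex" and r :: real
  assumes T: "finite T" and g: "\<And>i j. (\<Sum>t\<in>T. a t i * cnj (a t j)) = r * (\<phi> i * cnj (\<phi> j))"
    and r: "r > 0" and \<phi>: "\<phi> j0 \<noteq> 0"
  shows "\<forall>t\<in>T. \<exists>c. a t = (\<lambda>i. c * \<phi> i)" "\<exists>t\<in>T. a t \<noteq> (\<lambda>_. 0)"
proof -
  have par: "a t i * \<phi> j = a t j * \<phi> i" if t: "t \<in> T" for t i j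
  proof -
    have "(\<Sum>t\<in>T. (cmod (a t i * \<phi> j - a t j * \<phi> i))\<^sup>2) = 0"
    proof -
      have "complex_of_real (\<Sum>t\<in>T. (cmod (a t i * \<phi> j - a t j * \<phi> i))\<^sup>2)
        = (\<Sum>t\<in>T. a t i * cnj (a t i)) * (\<phi> j * cnj (\<phi> j)) - (\<Sum>t\<in>T. a t i * cnj (a t j)) * (\<phi> j * cnj (\<phi> i))
          - (\<Sum>t\<in>T. a t j * cnj (a t i)) * (\<phi> i * cnj (\<phi> j)) + (\<Sum>t\<in>T. a t j * cnj (a t j)) * (\<phi> i * cnj (\<phi> i))"
        unfolding of_real_sum complex_norm_square
        by (simp add: algebra_simps sum.distrib sum_subtractf sum_distrib_left)
      also have "\<dots> = 0" unfolding g by (simp add: algebra_simps)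
      finally show ?thesis by (simp only: of_real_eq_0_iff)
    qed
    then have "(cmod (a t i * \<phi> j - a t j * \<phi> i))\<^sup>2 = 0"
      using T t by (subst (asm) sum_nonneg_eq_0_iff) auto
    then show ?thesis by simp
  qed
  show "\<forall>t\<in>T. \<exists>c. a t = (\<lambda>i. c * \<phi> i)"
  proof
    fix t assume t: "t \<in> T"
    have "a t i = a t j0 / \<phi> j0 * \<phi> i" for i
      using par[OF t, of i j0] \<phi> by (simp add: field_simps)
    then show "\<exists>c. a t = (\<lambda>i. c * \<phi> i)" by blast
  qed
  show "\<exists>t\<in>T. a t \<noteq> (\<lambda>_. 0)"
  proof (rule ccontr)
    assume "\<not> ?thesis"
    then have "(\<Sum>t\<in>T. a t j0 * cnj (a t j0)) = 0" by (intro sum.neutral) auto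
    then show False unfolding g using r \<phi> by simp
  qed
qed

section \<open>Necessity\<close>

lemma conj_term_gram:
  assumes "\<And>x y. \<rho> x y = (\<Sum>c\<in>I. V c x * cnj (V c y))"
  shows "conj_term Q L \<rho> x y
    = (\<Sum>c\<in>I. (\<Sum>z\<in>basis_states Q. L x z * V c z) * cnj (\<Sum>z\<in>basis_states Q. L y z * V c z))"
proof -
  have "conj_term Q L \<rho> x y
    = (\<Sum>x'\<in>basis_states Q. \<Sum>y'\<in>basis_states Q. \<Sum>c\<in>I. (L x x' * V c x') * cnj (L y y' * V c y'))"
    by (simp add: conj_term_def assms sum_distrib_left sum_distrib_right mult_ac)
  also have "\<dots> = (\<Sum>x'\<in>basis_states Q. \<Sum>c\<in>I. \<Sum>y'\<in>basis_states Q. (L x x' * V c x') * cnj (L y y' * V c y'))"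
    by (intro sum.cong refl sum.swap)
  also have "\<dots> = (\<Sum>c\<in>I. \<Sum>x'\<in>basis_states Q. \<Sum>y'\<in>basis_states Q. (L x x' * V c x') * cnj (L y y' * V c y'))"
    by (rule sum.swap)
  finally show ?thesis unfolding cnj_sum sum_product .
qed

text \<open>Local operators preserve product vectors; were \<open>\<phi>\<close> one, the inverse
  unitaries would make the Bell vector one.\<close>

lemma perfect_singlet_vector:
  assumes "perfect_singlet \<tau>"
  obtains \<phi> where "qdet \<phi> \<noteq> 0" "\<And>i j. \<tau> $ i $ j = \<phi> i * cnj (\<phi> j)"
proof -
  define \<Phi> :: two_qubit_vec where "\<Phi> = (1 / sqrt 2) *\<^sub>R (ket False False + ket True True)"
  define \<Phi>' where "\<Phi>' i = \<Phi> $ i" for i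
  obtain U V where UV: "unitary_op U" "unitary_op V"
    "\<tau> = tensor_op U V ** pure_op \<Phi> ** dagger (tensor_op U V)"
    using assms unfolding perfect_singlet_def lu_equivalent_def \<Phi>_def by blast
  define \<phi> where "\<phi> = op_app (tensor_op U V) \<Phi>'"
  have "pure_op \<Phi> $ i $ j = (\<Sum>k\<in>{()}. \<Phi>' i * cnj (\<Phi>' j))" for i j
    by (simp add: pure_op_def \<Phi>'_def)
  from gram_conjugate[where \<rho> = "pure_op \<Phi>" and S = "{()}" and W = "\<lambda>_. \<Phi>'", OF this]
  have 1: "\<tau> $ i $ j = \<phi> i * cnj (\<phi> j)" for i j unfolding UV(3) \<phi>_def by simp
  have "tensor_op (dagger U) (dagger V) ** tensor_op U V = mat 1"
    using UV(1,2) by (simp add: tensor_op_mult tensor_op_mat_1 unitary_op_def)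
  then have "op_app (tensor_op (dagger U) (dagger V)) \<phi> = \<Phi>'"
    unfolding \<phi>_def op_app_mult[symmetric] by (simp add: op_app_mat_1)
  moreover have "qdet \<Phi>' \<noteq> 0"
    by (simp add: qdet_def \<Phi>'_def \<Phi>_def ket_def axis_def)
  ultimately have "qdet \<phi> \<noteq> 0" using qdet_op_app_tensor by metis
  then show thesis using 1 that by blast
qed

text \<open>Stated for a set \<open>F\<close> of edges so that one crossing edge can be left out and
  treated separately.\<close>

lemma edge_product_cut_fun:
  assumes "\<And>e. e \<in> F \<Longrightarrow> {End1 e, End2 e} \<subseteq> S \<union> T"
    and "\<And>e. e \<in> F \<Longrightarrow> {End1 e, End2 e} \<subseteq> S \<or> {End1 e, End2 e} \<subseteq> T \<or> qdet (w e) = 0"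
    and "\<And>v i. v \<in> nodes N \<Longrightarrow> i < k v \<Longrightarrow> Ancilla v i \<in> S \<union> T"
  shows "cut_fun S T (\<lambda>y. (\<Prod>e\<in>F. w e (y (End1 e), y (End2 e))) * ancilla_zero N k y)"
proof (rule cut_fun_mult; (unfold ancilla_zero_def)?; rule cut_fun_prod)
  fix e assume e: "e \<in> F"
  show "cut_fun S T (\<lambda>y. w e (y (End1 e), y (End2 e)))"
  proof (cases "qdet (w e) = 0")
    case True
    then obtain f g where fg: "\<And>s t. w e (s, t) = f s * g t" unfolding qdet_eq_0_iff_product by blast
    show ?thesis unfolding fg by (rule cut_fun_product) (use assms(1)[OF e] in auto)
  next
    case False
    then have "{End1 e, End2 e} \<subseteq> S \<or> {End1 e, End2 e} \<subseteq> T" using assms(2)[OF e] by blast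
    then show ?thesis by (rule cut_fun_local[of _ _ S T "\<lambda>s t. w e (s, t)"])
  qed
next
  fix p assume "p \<in> (SIGMA v:nodes N. {..<k v})"
  then obtain v i where p: "p = (v, i)" "v \<in> nodes N" "i < k v" by auto
  then have "{Ancilla v i, Ancilla v i} \<subseteq> S \<or> {Ancilla v i, Ancilla v i} \<subseteq> T" using assms(3) by auto
  from cut_fun_local[OF this, of "\<lambda>s _. of_bool (\<not> s)"]
  show "cut_fun S T (\<lambda>y. case p of (v, i) \<Rightarrow> of_bool (\<not> y (Ancilla v i)))" unfolding p by simp
qed

text \<open>An operator \<open>L\<close> of the branch and a basis state \<open>x\<close> of the
  traced-out qubits are fixed, with nonzero amplitude for some Gram vectors. While edge vectors vary
  inside the ranges, the amplitude stays a multiple of \<open>\<phi>\<close>. The contradiction is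
  an amplitude that is nonzero but has determinant 0.\<close>

lemma no_singlet_across_cut:
  assumes N: "quantum_network N" and mixed: "\<forall>e\<in>edges N. mixed (edge_state N e)"
    and gen: "singlet_generable N A B" and X: "A \<in> X" "B \<notin> X"
    and G: "\<And>e. e \<in> edges N \<Longrightarrow> e \<notin> G \<Longrightarrow> \<not> (\<exists>\<alpha> \<gamma> l. 0 \<le> l \<and> l \<le> 1 \<and> 0 \<le> \<alpha> \<and> 0 \<le> \<gamma> \<and> \<alpha> + \<gamma> \<le> 1 \<and>
        lu_equivalent (edge_state N e) (rho_agl \<alpha> \<gamma> l))"
    and crossing: "\<And>e e'. e \<in> G \<Longrightarrow> e' \<in> G \<Longrightarrow> (end1 N e \<in> X) \<noteq> (end2 N e \<in> X) \<Longrightarrow>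
        (end1 N e' \<in> X) \<noteq> (end2 N e' \<in> X) \<Longrightarrow> e = e'"
  shows False
proof -
  have finE: "finite (edges N)" using N by (simp add: quantum_network_def)
  obtain k P \<sigma> a b where out: "outcome N k (initial_state N k) P \<sigma>"
    and ab: "a \<in> held N k A" "b \<in> held N k B" and tr: "trace_reg (qubits N k) \<sigma> > 0"
    and ps: "perfect_singlet ((1 / trace_reg (qubits N k) \<sigma>) *\<^sub>R reduce_pair (qubits N k) a b \<sigma>)"
    using gen unfolding singlet_generable_def by blast
  define r where "r = trace_reg (qubits N k) \<sigma>"
  define S where "S = {q \<in> qubits N k. holder N q \<in> X}"
  define T where "T = {q \<in> qubits N k. holder N q \<notin> X}"
  have Q: "qubits N k = S \<union> T" and dis: "S \<inter> T = {}" by (auto simp: S_def T_def)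
  have abST: "a \<in> S" "b \<in> T" using ab X by (auto simp: S_def T_def held_def)
  have finQ: "finite (S \<union> T)" using finite_qubits[OF N, of k] Q by simp
  \<comment> \<open>\<open>W\<close> and \<open>p\<close> are bundled so that one use of choice
    selects both for every edge.\<close>
  define R where "R e W p \<longleftrightarrow> (\<forall>i j. edge_state N e $ i $ j = (\<Sum>k\<in>UNIV. W k i * cnj (W k j))) \<and>
      p \<in> combos W \<and> p \<noteq> (\<lambda>_. 0) \<and> qdet p = 0 \<and> (e \<in> G \<or> product_spanned (combos W))"
    for e p and W :: "bool \<times> bool \<Rightarrow> bool \<times> bool \<Rightarrow> complex"
  have "\<exists>Wp. R e (fst Wp) (snd Wp)" if e: "e \<in> edges N" for e
  proof -
    have dm: "density_op (edge_state N e)" "mixed (edge_state N e)"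
      using N mixed e by (simp_all add: quantum_network_def)
    show ?thesis
    proof (rule mixed_state_range[OF dm])
      fix W :: "bool \<times> bool \<Rightarrow> bool \<times> bool \<Rightarrow> complex" and p
      assume Wp: "\<And>i j. edge_state N e $ i $ j = (\<Sum>k\<in>UNIV. W k i * cnj (W k j))"
        "p \<in> combos W" "p \<noteq> (\<lambda>_. 0)" "qdet p = 0"
        and form: "product_spanned (combos W) \<or> (\<exists>\<alpha> \<gamma> l. 0 \<le> l \<and> l \<le> 1 \<and> 0 \<le> \<alpha> \<and> 0 \<le> \<gamma> \<and>
          \<alpha> + \<gamma> \<le> 1 \<and> lu_equivalent (edge_state N e) (rho_agl \<alpha> \<gamma> l))"
      have "e \<in> G \<or> product_spanned (combos W)" using form G[OF e] by argo
      then have "R e (fst (W, p)) (snd (W, p))" using Wp by (simp only: R_def fst_conv snd_conv simp_thms)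
      then show ?thesis ..
    qed
  qed
  then have "\<forall>e. \<exists>Wp. e \<in> edges N \<longrightarrow> R e (fst Wp) (snd Wp)" by blast
  then obtain Wp where Wp: "\<And>e. e \<in> edges N \<Longrightarrow> R e (fst (Wp e)) (snd (Wp e))"
    using choice[of "\<lambda>e Wp. e \<in> edges N \<longrightarrow> R e (fst Wp) (snd Wp)"] by blast
  define W where "W e = fst (Wp e)" for e
  define p where "p e = snd (Wp e)" for e
  have W: "\<And>e i j. e \<in> edges N \<Longrightarrow> edge_state N e $ i $ j = (\<Sum>k\<in>UNIV. W e k i * cnj (W e k j))"
    and p: "\<And>e. e \<in> edges N \<Longrightarrow> p e \<in> combos (W e)" "\<And>e. e \<in> edges N \<Longrightarrow> p e \<noteq> (\<lambda>_. 0)"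
      "\<And>e. e \<in> edges N \<Longrightarrow> qdet (p e) = 0"
    and bad: "\<And>e. e \<in> edges N \<Longrightarrow> e \<notin> G \<Longrightarrow> product_spanned (combos (W e))"
    using Wp unfolding R_def W_def p_def by blast+
  obtain \<phi> where \<phi>: "qdet \<phi> \<noteq> 0"
    "\<And>i j. ((1 / r) *\<^sub>R reduce_pair (S \<union> T) a b \<sigma>) $ i $ j = \<phi> i * cnj (\<phi> j)"
    using perfect_singlet_vector[OF ps] unfolding r_def Q by blast
  have r0: "r > 0" using tr by (simp add: r_def)
  have red: "reduce_pair (S \<union> T) a b \<sigma> $ i $ j = r * (\<phi> i * cnj (\<phi> j))" for i j
    unfolding \<phi>(2)[symmetric] using r0 by (simp add: scaleR_conv_of_real[where 'a = complex])
  have "\<exists>j. \<phi> j \<noteq> 0" 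
  proof (rule ccontr)
    assume "\<not> ?thesis"
    then have "\<phi> j = 0" for j by blast
    then show False using \<phi>(1) by (simp only: qdet_def mult_zero_left diff_zero)
  qed
  then obtain j0 where j0: "\<phi> j0 \<noteq> 0" ..
  obtain Ls where Ls: "\<And>L. L \<in> set Ls \<Longrightarrow> cut_kernel S T L"
    "\<And>x y. x \<in> basis_states (S \<union> T) \<Longrightarrow> y \<in> basis_states (S \<union> T) \<Longrightarrow>
      \<sigma> x y = (\<Sum>L\<leftarrow>Ls. conj_term (S \<union> T) L (initial_state N k) x y)"
    using outcome_cut_form[OF out N S_def T_def] by blast
  \<comment> \<open>The unnormalised vector of the pair \<open>a\<close>, \<open>b\<close> that
    \<open>L\<close> produces from the edge vectors \<open>w\<close> when the other qubits are found
    in \<open>x\<close>.\<close>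
  define amp where "amp x L w i = (\<Sum>y\<in>basis_states (S \<union> T). L (x(a := fst i, b := snd i)) y * edge_product N k w y)"
    for x w i and L :: "('a, 'b) qubit reg_op"
  define CH where "CH = (edges N \<rightarrow>\<^sub>E (UNIV :: (bool \<times> bool) set))"
  define I where "I = basis_states (S \<union> T - {a, b}) \<times> {..<length Ls} \<times> CH"
  define f where "f t i = amp (fst t) (Ls ! fst (snd t)) (\<lambda>e. W e (snd (snd t) e)) i" for t i
  have finI: "finite I" unfolding I_def CH_def
    using finQ finE by (intro finite_cartesian_product finite_PiE finite_lessThan) auto
  have cg: "conj_term (S \<union> T) L (initial_state N k) x y
      = (\<Sum>c\<in>CH. (\<Sum>z\<in>basis_states (S \<union> T). L x z * edge_product N k (\<lambda>e. W e (c e)) z) *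
         cnj (\<Sum>z\<in>basis_states (S \<union> T). L y z * edge_product N k (\<lambda>e. W e (c e)) z))" for L x y
    unfolding CH_def by (rule conj_term_gram) (rule initial_state_gram[OF finE W])
  have gram: "(\<Sum>t\<in>I. f t i * cnj (f t j)) = r * (\<phi> i * cnj (\<phi> j))" for i j
  proof -
    have "reduce_pair (S \<union> T) a b \<sigma> $ i $ j
       = (\<Sum>x\<in>basis_states (S \<union> T - {a, b}). \<sigma> (x(a := fst i, b := snd i)) (x(a := fst j, b := snd j)))"
      by (simp add: reduce_pair_def)
    also have "\<dots> = (\<Sum>x\<in>basis_states (S \<union> T - {a, b}). \<Sum>n<length Ls. \<Sum>c\<in>CH.
        amp x (Ls ! n) (\<lambda>e. W e (c e)) i * cnj (amp x (Ls ! n) (\<lambda>e. W e (c e)) j))"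
    proof (intro sum.cong refl)
      fix x assume "x \<in> basis_states (S \<union> T - {a, b})"
      then have xi: "x(a := fst i, b := snd i) \<in> basis_states (S \<union> T)" for i
        using abST by (auto simp: PiE_def extensional_def)
      show "\<sigma> (x(a := fst i, b := snd i)) (x(a := fst j, b := snd j)) = (\<Sum>n<length Ls. \<Sum>c\<in>CH.
        amp x (Ls ! n) (\<lambda>e. W e (c e)) i * cnj (amp x (Ls ! n) (\<lambda>e. W e (c e)) j))"
        unfolding Ls(2)[OF xi xi] cg amp_def by (simp add: sum_list_sum_nth atLeast0LessThan)
    qed
    also have "\<dots> = (\<Sum>t\<in>I. f t i * cnj (f t j))"
      by (simp add: I_def f_def sum.cartesian_product')
    finally show ?thesis unfolding red ..
  qed
  note rank1 = rank_one_gram[where \<phi> = \<phi>, OF finI gram r0 j0]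
  obtain t where t: "t \<in> I" "f t \<noteq> (\<lambda>_. 0)" using rank1(2) by blast
  define x where "x = fst t"
  define n where "n = fst (snd t)"
  define L where "L = Ls ! n"
  have xn: "x \<in> basis_states (S \<union> T - {a, b})" "n \<in> {..<length Ls}"
    using t(1) unfolding I_def x_def n_def mem_Times_iff by blast+
  have x: "x \<in> basis_states (S \<union> T - {a, b})" by (rule xn)
  have L: "cut_kernel S T L" unfolding L_def by (rule Ls(1)) (use xn(2) in simp)
  define ok where "ok w \<longleftrightarrow> (\<forall>e\<in>edges N. w e \<in> combos (W e))" for w
  \<comment> \<open>By multilinearity this amplitude is a combination of those of Gram vectors, with
    the same \<open>x\<close> and \<open>L\<close>, and each of these is a multiple of
    \<open>\<phi>\<close> by \<open>rank1\<close>.\<close>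
  have amp_\<phi>: "\<exists>c. amp x L w = (\<lambda>i. c * \<phi> i)" if w: "ok w" for w
  proof -
    have "\<forall>e. \<exists>C. e \<in> edges N \<longrightarrow> w e = (\<lambda>i. \<Sum>j\<in>UNIV. C j * W e j i)"
      using w unfolding ok_def combos_def by blast
    from choice[OF this] obtain C where
      C': "\<forall>e. e \<in> edges N \<longrightarrow> w e = (\<lambda>i. \<Sum>j\<in>UNIV. C e j * W e j i)" ..
    note C = C'[rule_format]
    have "\<exists>d. amp x L (\<lambda>e. W e (c e)) = (\<lambda>i. d * \<phi> i)" if "c \<in> CH" for c
    proof -
      have "(x, n, c) \<in> I" unfolding I_def by (intro SigmaI xn that)
      from rank1(1)[rule_format, OF this] obtain d where
        d: "f (x, n, c) = (\<lambda>i. d * \<phi> i)" ..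
      have "amp x L (\<lambda>e. W e (c e)) = f (x, n, c)"
        by (simp add: fun_eq_iff f_def L_def)
      then have "amp x L (\<lambda>e. W e (c e)) = (\<lambda>i. d * \<phi> i)" by (rule trans) (rule d)
      then show ?thesis ..
    qed
    then have "\<forall>c. \<exists>d. c \<in> CH \<longrightarrow> amp x L (\<lambda>e. W e (c e)) = (\<lambda>i. d * \<phi> i)" by simp
    from choice[OF this] obtain d where
      d': "\<forall>c. c \<in> CH \<longrightarrow> amp x L (\<lambda>e. W e (c e)) = (\<lambda>i. d c * \<phi> i)" ..
    have d: "amp x L (\<lambda>e. W e (c e)) i = d c * \<phi> i" if "c \<in> CH" for c i
      using d'[rule_format, OF that] by simp
    have "amp x L w i = (\<Sum>c\<in>CH. (\<Prod>e\<in>edges N. C e (c e)) * d c) * \<phi> i" for i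
    proof -
      have "amp x L w i = (\<Sum>y\<in>basis_states (S \<union> T). \<Sum>c\<in>CH. (\<Prod>e\<in>edges N. C e (c e)) *
          (L (x(a := fst i, b := snd i)) y * edge_product N k (\<lambda>e. W e (c e)) y))"
        unfolding amp_def CH_def by (subst edge_product_multilinear[OF finE C]) (simp_all add: sum_distrib_left mult_ac)
      also have "\<dots> = (\<Sum>c\<in>CH. (\<Prod>e\<in>edges N. C e (c e)) * amp x L (\<lambda>e. W e (c e)) i)"
        unfolding amp_def by (subst sum.swap) (simp add: sum_distrib_left)
      also have "\<dots> = (\<Sum>c\<in>CH. ((\<Prod>e\<in>edges N. C e (c e)) * d c) * \<phi> i)"
        by (intro sum.cong refl) (simp add: d)
      finally show ?thesis by (simp only: sum_distrib_right)
    qed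
    then show ?thesis by blast
  qed
  have amp_0: "amp x L w = (\<lambda>_. 0)" if w: "ok w" "qdet (amp x L w) = 0" for w
  proof -
    obtain c where c: "amp x L w = (\<lambda>i. c * \<phi> i)" using amp_\<phi>[OF w(1)] by blast
    then have "c\<^sup>2 * qdet \<phi> = 0" using w(2) by (simp add: qdet_scale)
    then have "c = 0" using \<phi>(1) by simp
    then show ?thesis unfolding c by simp
  qed
  have upd_ok: "ok (w(e := v))" if "ok w" "e \<in> edges N \<Longrightarrow> v \<in> combos (W e)" for w e v
    using that by (auto simp: ok_def)
  \<comment> \<open>Edges are replaced one at a time: the vector is a sum of three product vectors
    of the range, and the three resulting amplitudes cannot all vanish.\<close>
  have products: "\<exists>w. ok w \<and> (\<forall>e\<in>F. qdet (w e) = 0) \<and> amp x L w \<noteq> (\<lambda>_. 0)"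
    if "finite F" "F \<subseteq> edges N - G" for F
    using that
  proof (induction F rule: finite_induct)
    case empty
    have "ok (\<lambda>e. W e (snd (snd t) e))" by (simp add: ok_def generator_in_combos)
    moreover have "amp x L (\<lambda>e. W e (snd (snd t) e)) \<noteq> (\<lambda>_. 0)"
      using t(2) by (simp add: f_def x_def n_def L_def fun_eq_iff)
    ultimately show ?case by blast
  next
    case (insert e F)
    then obtain w where w: "ok w" "\<forall>e\<in>F. qdet (w e) = 0" "amp x L w \<noteq> (\<lambda>_. 0)" by blast
    have e: "e \<in> edges N" "e \<notin> G" using insert.prems by auto
    then have "w e \<in> combos (W e)" using w(1) by (simp add: ok_def)
    then obtain u1 u2 u3 where u: "u1 \<in> combos (W e)" "u2 \<in> combos (W e)" "u3 \<in> combos (W e)"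
      "qdet u1 = 0" "qdet u2 = 0" "qdet u3 = 0" "\<And>i. w e i = u1 i + u2 i + u3 i"
      using bad[OF e] unfolding product_spanned_def by metis
    have "amp x L w i = amp x L (w(e := u1)) i + amp x L (w(e := u2)) i + amp x L (w(e := u3)) i" for i
    proof -
      have "edge_product N k w y = edge_product N k (w(e := u1)) y + edge_product N k (w(e := u2)) y
          + edge_product N k (w(e := u3)) y" for y
        using edge_product_update[OF finE e(1), of k w "w e" y]
        by (simp add: edge_product_update[OF finE e(1)] u(7) algebra_simps)
      then show ?thesis unfolding amp_def by (simp add: algebra_simps sum.distrib)
    qed
    note split = this
    have "\<exists>v\<in>{u1, u2, u3}. amp x L (w(e := v)) \<noteq> (\<lambda>_. 0)"
    proof (rule ccontr)
      assume "\<not> ?thesis"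
      then have 0: "amp x L (w(e := u1)) = (\<lambda>_. 0)" "amp x L (w(e := u2)) = (\<lambda>_. 0)"
          "amp x L (w(e := u3)) = (\<lambda>_. 0)" by blast+
      have "amp x L w i = 0" for i unfolding split 0 by simp
      then show False using w(3) by blast
    qed
    then obtain v where v: "v \<in> {u1, u2, u3}" "amp x L (w(e := v)) \<noteq> (\<lambda>_. 0)" by blast
    have "ok (w(e := v))" by (rule upd_ok[OF w(1)]) (use v(1) u in auto)
    moreover have "\<forall>e'\<in>insert e F. qdet ((w(e := v)) e') = 0" using w(2) v(1) u by auto
    ultimately show ?case using v(2) by blast
  qed
  define Cr where "Cr = {e \<in> edges N. (end1 N e \<in> X) \<noteq> (end2 N e \<in> X)}"
  have inQ: "End1 e \<in> S \<union> T" "End2 e \<in> S \<union> T" if "e \<in> edges N" for e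
    using that unfolding Q[symmetric] by (auto simp: qubits_def)
  have side: "{End1 e, End2 e} \<subseteq> S \<or> {End1 e, End2 e} \<subseteq> T" if "e \<in> edges N" "e \<notin> Cr" for e
    using that inQ[OF that(1)] by (auto simp: S_def T_def Cr_def)
  have anc: "Ancilla v i \<in> S \<union> T" if "v \<in> nodes N" "i < k v" for v i
    using that unfolding Q[symmetric] by (auto simp: qubits_def)
  have "finite (Cr - G)" "Cr - G \<subseteq> edges N - G" using finE by (auto simp: Cr_def)
  from products[OF this] obtain w where w: "ok w" "\<forall>e\<in>Cr - G. qdet (w e) = 0" "amp x L w \<noteq> (\<lambda>_. 0)" by blast
  show False
  proof (cases "Cr \<inter> G = {}")
    case True
    have "cut_fun S T (edge_product N k w)"
      unfolding edge_product_def[abs_def]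
    proof (rule edge_product_cut_fun)
      fix e assume e: "e \<in> edges N"
      show "{End1 e, End2 e} \<subseteq> S \<union> T" using inQ[OF e] by simp
      show "{End1 e, End2 e} \<subseteq> S \<or> {End1 e, End2 e} \<subseteq> T \<or> qdet (w e) = 0"
        using side[OF e] w(2) True by blast
    qed (rule anc)
    from amplitude_no_crossing_edge[OF dis L this abST x]
    have "qdet (amp x L w) = 0" unfolding amp_def[abs_def] .
    from amp_0[OF w(1) this] w(3) show False by simp
  next
    case False
    then obtain e where e: "e \<in> Cr" "e \<in> G" by blast
    then have eN: "e \<in> edges N" by (simp add: Cr_def)
    have others: "e' \<in> Cr - G" if "e' \<in> Cr" "e' \<noteq> e" for e'
      using crossing[of e e'] that e by (auto simp: Cr_def)
    define \<Psi> where "\<Psi> y = (\<Prod>e'\<in>edges N - {e}. w e' (y (End1 e'), y (End2 e'))) * ancilla_zero N k y" for y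
    have upd: "edge_product N k (w(e := v)) y = v (y (End1 e), y (End2 e)) * \<Psi> y" for v y
      unfolding \<Psi>_def by (rule edge_product_update[OF finE eN])
    have \<Psi>: "cut_fun S T \<Psi>"
      unfolding \<Psi>_def[abs_def]
    proof (rule edge_product_cut_fun)
      fix e' assume e': "e' \<in> edges N - {e}"
      show "{End1 e', End2 e'} \<subseteq> S \<union> T" using inQ[of e'] e' by simp
      show "{End1 e', End2 e'} \<subseteq> S \<or> {End1 e', End2 e'} \<subseteq> T \<or> qdet (w e') = 0"
        using side[of e'] others[of e'] w(2) e' by blast
    qed (rule anc)
    have p_ok: "ok (w(e := p e))" by (rule upd_ok[OF w(1)]) (rule p(1)[OF eN])
    obtain g h where gh: "\<And>s t. p e (s, t) = g s * h t"
      using p(3)[OF eN] unfolding qdet_eq_0_iff_product by blast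
    have "cut_fun S T (edge_product N k (w(e := p e)))"
      unfolding upd[abs_def] gh by (intro cut_fun_mult \<Psi> cut_fun_product inQ eN)
    from amplitude_no_crossing_edge[OF dis L this abST x]
    have "qdet (amp x L (w(e := p e))) = 0" unfolding amp_def[abs_def] .
    then have z: "amp x L (w(e := p e)) = (\<lambda>_. 0)" by (rule amp_0[OF p_ok])
    \<comment> \<open>Inserting \<open>w e\<close> itself changes nothing, so this concerns
      \<open>w\<close>. Since \<open>p e\<close> gives amplitude 0, one side is singular and no
      vector on \<open>e\<close> yields a nonzero determinant.\<close>
    have "qdet (amp x L (w(e := w e))) = 0"
    proof (cases "End1 e \<in> S")
      case True
      then have "End2 e \<in> T" using e(1) inQ[OF eN] by (auto simp: S_def T_def Cr_def)
      obtain \<gamma> \<eta> where *: "\<And>v i1 i2. (\<Sum>y\<in>basis_states (S \<union> T). L (x(a := i1, b := i2)) y * (v (y (End1 e)) (y (End2 e)) * \<Psi> y))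
        = (\<Sum>s\<in>UNIV. \<Sum>t\<in>UNIV. v s t * \<gamma> s i1 * \<eta> t i2)"
        using amplitude_one_crossing_edge[OF dis L \<Psi> abST True \<open>End2 e \<in> T\<close> x] by blast
      have bil: "amp x L (w(e := v)) (i1, i2) = (\<Sum>s\<in>UNIV. \<Sum>t\<in>UNIV. v (s, t) * \<gamma> s i1 * \<eta> t i2)" for v i1 i2
        unfolding amp_def upd using *[of i1 i2 "\<lambda>s t. v (s, t)"] by simp
      show ?thesis
      proof (rule qdet_bilinear_eq_0[where \<gamma> = \<gamma> and \<eta> = \<eta>, OF p(3)[OF eN] p(2)[OF eN]])
        show "(\<Sum>s\<in>UNIV. \<Sum>t\<in>UNIV. p e (s, t) * \<gamma> s i1 * \<eta> t i2) = 0" for i1 i2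
          unfolding bil[symmetric] z ..
      qed (rule bil)
    next
      case False
      \<comment> \<open>The first qubit of the edge lies on the side of \<open>B\<close>, so the
        edge vector is used with its factors exchanged.\<close>
      then have ST: "End2 e \<in> S" "End1 e \<in> T" using e(1) inQ[OF eN] by (auto simp: S_def T_def Cr_def)
      obtain \<gamma> \<eta> where *: "\<And>v i1 i2. (\<Sum>y\<in>basis_states (S \<union> T). L (x(a := i1, b := i2)) y * (v (y (End2 e)) (y (End1 e)) * \<Psi> y))
        = (\<Sum>s\<in>UNIV. \<Sum>t\<in>UNIV. v s t * \<gamma> s i1 * \<eta> t i2)"
        using amplitude_one_crossing_edge[OF dis L \<Psi> abST ST x] by blast
      have bil: "amp x L (w(e := v)) (i1, i2)
          = (\<Sum>s\<in>UNIV. \<Sum>t\<in>UNIV. (v \<circ> prod.swap) (s, t) * \<gamma> s i1 * \<eta> t i2)" for v i1 i2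
        unfolding amp_def upd using *[of i1 i2 "\<lambda>s t. v (t, s)"] by simp
      have "qdet (p e \<circ> prod.swap) = 0" using p(3)[OF eN] by (simp add: qdet_def mult.commute)
      moreover have "p e \<circ> prod.swap \<noteq> (\<lambda>_. 0)"
      proof
        assume "p e \<circ> prod.swap = (\<lambda>_. 0)"
        then have "(p e \<circ> prod.swap) (prod.swap i) = 0" for i by (rule fun_cong)
        then have "p e i = 0" for i by simp
        then show False using p(2)[OF eN] by blast
      qed
      ultimately show ?thesis
      proof (rule qdet_bilinear_eq_0[where \<gamma> = \<gamma> and \<eta> = \<eta>])
        show "(\<Sum>s\<in>UNIV. \<Sum>t\<in>UNIV. (p e \<circ> prod.swap) (s, t) * \<gamma> s i1 * \<eta> t i2) = 0" for i1 i2
          unfolding bil[symmetric] z ..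
      qed (rule bil)
    qed
    then have "qdet (amp x L w) = 0" by simp
    from amp_0[OF w(1) this] w(3) show False by simp
  qed
qed

section \<open>Filtering protocols\<close>

text \<open>Scaling makes \<open>K\<close> a contraction, so its defect from trace preservation is
  positive semidefinite; the Gram vectors of the defect give the Kraus operators of a second,
  failing outcome.\<close>

lemma instrument_completion:
  fixes K :: "'q reg_op"
  assumes "finite S"
  obtains c Ks where "c > 0" "instrument S [[\<lambda>x y. complex_of_real c * K x y], Ks]"
proof -
  let ?B = "basis_states S"
  have fin: "finite ?B" using assms by (rule finite_basis_states)
  \<comment> \<open>One plus the squared Hilbert-Schmidt norm, which bounds the squared operator
    norm; the 1 keeps \<open>C\<close> positive for \<open>K = 0\<close>.\<close>
  define C where "C = 1 + (\<Sum>z\<in>?B. \<Sum>x\<in>?B. (cmod (K z x))\<^sup>2)"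
  have C: "C > 0" unfolding C_def by (intro add_pos_nonneg sum_nonneg) auto
  define c where "c = 1 / sqrt C"
  have c: "c > 0" "c * c = 1 / C" using C by (simp_all add: c_def)
  define M where "M x y = (if x = y then 1 else 0) - complex_of_real (c * c) * (\<Sum>z\<in>?B. cnj (K z x) * K z y)" for x y
  have "\<exists>W :: ('q \<Rightarrow> bool) \<Rightarrow> _. \<forall>x\<in>?B. \<forall>y\<in>?B. M x y = (\<Sum>k\<in>?B. W k x * cnj (W k y))"
  proof (rule psd_kernel_decomposition[OF fin])
    show "M y x = cnj (M x y)" for x y
      by (simp add: M_def mult.commute)
    fix v :: "('q \<Rightarrow> bool) \<Rightarrow> complex"
    define n where "n = (\<Sum>x\<in>?B. (cmod (v x))\<^sup>2)"
    have n0: "n \<ge> 0" unfolding n_def by (intro sum_nonneg) simp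
    have "(\<Sum>x\<in>?B. \<Sum>y\<in>?B. cnj (v x) * M x y * v y)
      = (\<Sum>x\<in>?B. \<Sum>y\<in>?B. (if x = y then cnj (v x) * v x else 0))
        - complex_of_real (c * c) * (\<Sum>x\<in>?B. \<Sum>y\<in>?B. \<Sum>z\<in>?B. cnj (K z x * v x) * (K z y * v y))"
      unfolding sum_distrib_left sum_subtractf[symmetric]
      by (intro sum.cong refl) (simp add: M_def algebra_simps sum_distrib_left)
    also have "(\<Sum>x\<in>?B. \<Sum>y\<in>?B. (if x = y then cnj (v x) * v x else 0)) = of_real n"
      using fin by (simp add: n_def of_real_sum complex_norm_square mult.commute del: of_real_power)
    also have "(\<Sum>x\<in>?B. \<Sum>y\<in>?B. \<Sum>z\<in>?B. cnj (K z x * v x) * (K z y * v y))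
      = (\<Sum>x\<in>?B. \<Sum>z\<in>?B. \<Sum>y\<in>?B. cnj (K z x * v x) * (K z y * v y))"
      by (intro sum.cong refl sum.swap)
    also have "\<dots> = (\<Sum>z\<in>?B. \<Sum>x\<in>?B. \<Sum>y\<in>?B. cnj (K z x * v x) * (K z y * v y))"
      by (rule sum.swap)
    also have "\<dots> = (\<Sum>z\<in>?B. cnj (\<Sum>x\<in>?B. K z x * v x) * (\<Sum>y\<in>?B. K z y * v y))"
      unfolding cnj_sum sum_product ..
    also have "\<dots> = of_real (\<Sum>z\<in>?B. (cmod (\<Sum>x\<in>?B. K z x * v x))\<^sup>2)"
      unfolding of_real_sum complex_norm_square by (simp add: mult.commute)
    finally have e1: "Re (\<Sum>x\<in>?B. \<Sum>y\<in>?B. cnj (v x) * M x y * v y)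
      = n - c * c * (\<Sum>z\<in>?B. (cmod (\<Sum>x\<in>?B. K z x * v x))\<^sup>2)"
      by (simp only: of_real_mult[symmetric] of_real_diff[symmetric] Re_complex_of_real)
    have e2: "(\<Sum>z\<in>?B. (cmod (\<Sum>x\<in>?B. K z x * v x))\<^sup>2) \<le> C * n"
    proof -
      have "(cmod (\<Sum>x\<in>?B. K z x * v x))\<^sup>2 \<le> (\<Sum>x\<in>?B. (cmod (K z x))\<^sup>2) * n" for z
      proof -
        have "cmod (\<Sum>x\<in>?B. K z x * v x) \<le> (\<Sum>x\<in>?B. cmod (K z x) * cmod (v x))"
          using norm_sum[of "\<lambda>x. K z x * v x" ?B] by (simp add: norm_mult)
        then have "(cmod (\<Sum>x\<in>?B. K z x * v x))\<^sup>2 \<le> (\<Sum>x\<in>?B. cmod (K z x) * cmod (v x))\<^sup>2"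
          by (rule power_mono) simp
        also have "\<dots> \<le> (\<Sum>x\<in>?B. (cmod (K z x))\<^sup>2) * n"
          unfolding n_def by (rule Cauchy_Schwarz_ineq_sum)
        finally show ?thesis .
      qed
      then have "(\<Sum>z\<in>?B. (cmod (\<Sum>x\<in>?B. K z x * v x))\<^sup>2) \<le> (\<Sum>z\<in>?B. (\<Sum>x\<in>?B. (cmod (K z x))\<^sup>2) * n)"
        by (rule sum_mono)
      also have "\<dots> = (C - 1) * n" by (simp add: C_def sum_distrib_right)
      also have "\<dots> \<le> C * n" using n0 by (intro mult_right_mono) auto
      finally show ?thesis .
    qed
    have "c * c * (\<Sum>z\<in>?B. (cmod (\<Sum>x\<in>?B. K z x * v x))\<^sup>2) \<le> n"
      unfolding c(2) using e2 C by (simp add: field_simps)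
    then show "0 \<le> Re (\<Sum>x\<in>?B. \<Sum>y\<in>?B. cnj (v x) * M x y * v y)"
      unfolding e1 by simp
  qed
  then obtain W :: "('q \<Rightarrow> bool) \<Rightarrow> ('q \<Rightarrow> bool) \<Rightarrow> complex" where
    W: "\<forall>x\<in>?B. \<forall>y\<in>?B. M x y = (\<Sum>k\<in>?B. W k x * cnj (W k y))" ..
  define z0 where "z0 = restrict (\<lambda>_. False) S"
  have z0: "z0 \<in> ?B" by (simp add: z0_def)
  \<comment> \<open>The operator \<open>|z0><W k|\<close>: its target \<open>z0\<close> is
    arbitrary, and its term in the completeness sum is the Gram term of \<open>W k\<close>.\<close>
  define R where "R k z x = (if z = z0 then cnj (W k x) else 0)" for k z x
  obtain ks where ks: "set ks = ?B" "distinct ks" using finite_distinct_list[OF fin] by blast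
  have "instrument S [[\<lambda>x y. complex_of_real c * K x y], map R ks]"
    unfolding instrument_def
  proof (intro ballI)
    fix x y assume xy: "x \<in> ?B" "y \<in> ?B"
    have "(\<Sum>z\<in>?B. cnj (R k z x) * R k z y) = W k x * cnj (W k y)" for k
    proof -
      have "(\<Sum>z\<in>?B. cnj (R k z x) * R k z y) = (\<Sum>z\<in>?B. if z = z0 then W k x * cnj (W k y) else 0)"
        by (intro sum.cong refl) (simp add: R_def)
      then show ?thesis using fin z0 by simp
    qed
    then have "(\<Sum>k\<leftarrow>ks. \<Sum>z\<in>?B. cnj (R k z x) * R k z y) = (\<Sum>k\<in>?B. W k x * cnj (W k y))"
      using ks by (simp add: sum_list_distinct_conv_sum_set)
    also have "\<dots> = M x y" using W xy by simp
    finally have R: "(\<Sum>k\<leftarrow>ks. \<Sum>z\<in>?B. cnj (R k z x) * R k z y) = M x y" .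
    have "(\<Sum>z\<in>?B. cnj (complex_of_real c * K z x) * (complex_of_real c * K z y))
      = complex_of_real (c * c) * (\<Sum>z\<in>?B. cnj (K z x) * K z y)"
      by (simp add: sum_distrib_left mult_ac)
    then show "(\<Sum>K\<leftarrow>concat [[\<lambda>x y. complex_of_real c * K x y], map R ks]. \<Sum>z\<in>?B. cnj (K z x) * K z y)
      = (if x = y then 1 else 0)"
      using R by (simp add: M_def comp_def)
  qed
  with c(1) show thesis using that by blast
qed

text \<open>Post-selected evolution, not normalised; the operators need not be contractions.\<close>

fun run_filters ::
    "('v, 'e) network \<Rightarrow> ('v \<Rightarrow> nat) \<Rightarrow> ('v \<times> ('v, 'e) qubit reg_op) list \<Rightarrow>
     ('v, 'e) qubit reg_op \<Rightarrow> ('v, 'e) qubit reg_op" where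
  "run_filters N k [] \<rho> = \<rho>"
| "run_filters N k ((v, K) # l) \<rho> = run_filters N k l (apply_kraus (qubits N k) (held N k v) [K] \<rho>)"

lemma conj_term_scale: "conj_term Q L (\<lambda>x y. c * \<rho> x y) x y = c * conj_term Q L \<rho> x y"
  by (simp add: conj_term_def sum_distrib_left mult_ac)

lemma run_filters_scale: "run_filters N k l (\<lambda>x y. c * \<rho> x y) = (\<lambda>x y. c * run_filters N k l \<rho> x y)"
proof (induction l arbitrary: \<rho>)
  case (Cons a l)
  obtain v K where a: "a = (v, K)" by force
  have "apply_kraus (qubits N k) (held N k v) [K] (\<lambda>x y. c * \<rho> x y)
      = (\<lambda>x y. c * apply_kraus (qubits N k) (held N k v) [K] \<rho> x y)"
    by (simp add: fun_eq_iff apply_kraus_conj_term conj_term_scale)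
  then show ?case using Cons.IH by (simp add: a)
qed simp

lemma run_filters_append: "run_filters N k (l @ l') \<rho> = run_filters N k l' (run_filters N k l \<rho>)"
  by (induction N k l \<rho> rule: run_filters.induct) simp_all

text \<open>Each filter becomes the first outcome of a completed instrument, and the other outcome
  ends the protocol. The scaling enters from both sides of the state, whence the factor
  \<open>c0 * c0\<close> in each step.\<close>

lemma filters_realizable:
  assumes N: "quantum_network N" and "\<forall>(v, K)\<in>set l. v \<in> nodes N"
  shows "\<exists>P c. c > 0 \<and> locc_protocol N k P \<and>
    outcome N k \<rho> P (\<lambda>x y. complex_of_real c * run_filters N k l \<rho> x y)"
  using assms(2)
proof (induction l arbitrary: \<rho>)
  case Nil
  show ?case
    by (rule exI[of _ Done], rule exI[of _ 1]) (simp add: locc_protocol.Done outcome.Done)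
next
  case (Cons a l)
  obtain v K where a: "a = (v, K)" by force
  have "finite (held N k v)" using finite_qubits[OF N, of k] by (simp add: held_def)
  then obtain c0 Ks where c0: "c0 > 0"
    "instrument (held N k v) [[\<lambda>x y. complex_of_real c0 * K x y], Ks]"
    by (rule instrument_completion)
  define K0 where "K0 = (\<lambda>x y. complex_of_real c0 * K x y)"
  define \<rho>' where "\<rho>' = apply_kraus (qubits N k) (held N k v) [K0] \<rho>"
  have "extend_op Q S K0 = (\<lambda>x y. complex_of_real c0 * extend_op Q S K x y)" for Q S
    by (simp add: fun_eq_iff extend_op_def K0_def)
  then have "\<rho>' = (\<lambda>x y. complex_of_real (c0 * c0) * apply_kraus (qubits N k) (held N k v) [K] \<rho> x y)"
    by (simp add: \<rho>'_def fun_eq_iff apply_kraus_def sum_distrib_left mult_ac)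
  then have run: "run_filters N k l \<rho>' = (\<lambda>x y. complex_of_real (c0 * c0) * run_filters N k (a # l) \<rho> x y)"
    by (simp add: a run_filters_scale del: of_real_mult)
  obtain P c where P: "c > 0" "locc_protocol N k P"
    "outcome N k \<rho>' P (\<lambda>x y. complex_of_real c * run_filters N k l \<rho>' x y)"
    using Cons.IH[of \<rho>'] Cons.prems by auto
  define P' where "P' = Local v [([K0], P), (Ks, Done)]"
  have "locc_protocol N k P'" unfolding P'_def
    by (rule locc_protocol.Local)
      (use Cons.prems c0(2) P(2) in \<open>auto simp: a K0_def intro: locc_protocol.Done\<close>)
  moreover have "outcome N k \<rho> P' (\<lambda>x y. complex_of_real c * run_filters N k l \<rho>' x y)"
    unfolding P'_def by (rule outcome.Local[of "[K0]" P]) (use P(3) in \<open>auto simp: \<rho>'_def\<close>)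
  moreover have "(\<lambda>x y. complex_of_real c * run_filters N k l \<rho>' x y)
    = (\<lambda>x y. complex_of_real (c * (c0 * c0)) * run_filters N k (a # l) \<rho> x y)"
    unfolding run by (simp add: fun_eq_iff)
  moreover have "c * (c0 * c0) > 0" using P(1) c0(1) by simp
  ultimately show ?case by metis
qed

lemma restrict_restrict_subset: "A \<subseteq> B \<Longrightarrow> restrict (restrict f B) A = restrict f A"
  by (auto simp: restrict_def fun_eq_iff)

lemma extend_op_comp:
  assumes R: "R \<inter> R' = {}" "R \<subseteq> Q" "R' \<subseteq> Q" and fin: "finite Q"
    and xy: "x \<in> basis_states Q" "y \<in> basis_states Q"
  shows "op_comp Q (extend_op Q R K) (extend_op Q R' K') x y
    = extend_op Q (R \<union> R') (\<lambda>x y. K (restrict x R) (restrict y R) * K' (restrict x R') (restrict y R')) x y"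
proof -
  \<comment> \<open>The only possible intermediate state: it must agree with \<open>x\<close> off
    \<open>R\<close> and with \<open>y\<close> off \<open>R'\<close>.\<close>
  define z0 where "z0 q = (if q \<in> R then y q else x q)" for q
  have z0: "z0 \<in> basis_states Q" using xy R by (auto simp: z0_def PiE_def extensional_def)
  have zero: "extend_op Q R K x z * extend_op Q R' K' z y = 0" if "z \<in> basis_states Q" "z \<noteq> z0" for z
  proof (rule ccontr)
    assume "\<not> ?thesis"
    then have 1: "\<forall>q\<in>Q - R. x q = z q" "\<forall>q\<in>Q - R'. z q = y q"
      by (auto simp: extend_op_def split: if_splits)
    have "z q = z0 q" for q
    proof (cases "q \<in> Q")
      case True
      then show ?thesis using 1 R(1) by (auto simp: z0_def)
    next
      case False
      then show ?thesis using that(1) z0 by (auto simp: PiE_def extensional_def)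
    qed
    with that(2) show False by blast
  qed
  have r: "restrict z0 R = restrict y R" "restrict z0 R' = restrict x R'"
    using R(1) by (auto simp: z0_def restrict_def fun_eq_iff)
  have "op_comp Q (extend_op Q R K) (extend_op Q R' K') x y = (\<Sum>z\<in>{z0}. extend_op Q R K x z * extend_op Q R' K' z y)"
    unfolding op_comp_def
    by (rule sum.mono_neutral_right) (use fin z0 zero in \<open>auto intro: finite_basis_states\<close>)
  also have "\<dots> = extend_op Q R K x z0 * extend_op Q R' K' z0 y" by simp
  also have "\<dots> = (if \<forall>q\<in>Q - (R \<union> R'). x q = y q
      then K (restrict x R) (restrict y R) * K' (restrict x R') (restrict y R') else 0)"
  proof -
    have "\<forall>q\<in>Q - R. x q = z0 q" by (simp add: z0_def)
    moreover have "(\<forall>q\<in>Q - R'. z0 q = y q) \<longleftrightarrow> (\<forall>q\<in>Q - (R \<union> R'). x q = y q)"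
      by (auto simp: z0_def)
    ultimately show ?thesis by (simp add: extend_op_def r)
  qed
  also have "\<dots> = extend_op Q (R \<union> R') (\<lambda>x y. K (restrict x R) (restrict y R) * K' (restrict x R') (restrict y R')) x y"
    by (simp add: extend_op_def restrict_restrict_subset)
  finally show ?thesis .
qed

lemma conj_term_cong:
  assumes "\<And>z. z \<in> basis_states Q \<Longrightarrow> L x z = L' x z" "\<And>z. z \<in> basis_states Q \<Longrightarrow> L y z = L' y z"
    and "\<And>z z'. z \<in> basis_states Q \<Longrightarrow> z' \<in> basis_states Q \<Longrightarrow> \<rho> z z' = \<rho>' z z'"
  shows "conj_term Q L \<rho> x y = conj_term Q L' \<rho>' x y"
  unfolding conj_term_def using assms by (intro sum.cong refl) simp

text \<open>Nodes hold disjoint sets of qubits, so their kernels simply multiply.\<close>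

lemma run_filters_nodes:
  assumes N: "quantum_network N" and "distinct vs" "set vs \<subseteq> nodes N"
    and xy: "x \<in> basis_states (qubits N k)" "y \<in> basis_states (qubits N k)"
  shows "run_filters N k (map (\<lambda>v. (v, K v)) vs) \<rho> x y
    = conj_term (qubits N k) (extend_op (qubits N k) (\<Union>v\<in>set vs. held N k v)
        (\<lambda>x y. \<Prod>v\<in>set vs. K v (restrict x (held N k v)) (restrict y (held N k v)))) \<rho> x y"
  using assms(2,3)
proof (induction vs arbitrary: \<rho>)
  case Nil
  let ?Q = "qubits N k"
  have *: "extend_op ?Q {} (\<lambda>x y. 1) x y = of_bool (x = y)"
    if "x \<in> basis_states ?Q" "y \<in> basis_states ?Q" for x y
    using PiE_ext[OF that] by (auto simp: extend_op_def)
  have "conj_term ?Q (extend_op ?Q {} (\<lambda>x y. 1)) \<rho> x y = conj_term ?Q (\<lambda>x y. of_bool (x = y)) \<rho> x y"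
    by (rule conj_term_cong) (use xy * in auto)
  then show ?case using conj_term_identity[OF finite_qubits[OF N] xy] by simp
next
  case (Cons v vs)
  let ?Q = "qubits N k"
  let ?H = "\<Union>v\<in>set vs. held N k v"
  let ?K = "\<lambda>vs x y. \<Prod>v\<in>vs. K v (restrict x (held N k v)) (restrict y (held N k v))"
  have sub: "held N k v \<subseteq> ?Q" for v by (auto simp: held_def)
  have "?H \<inter> held N k v = {}" using Cons.prems(1) by (auto simp: held_def)
  note comp = extend_op_comp[OF this _ sub finite_qubits[OF N]]
  have "run_filters N k (map (\<lambda>v. (v, K v)) (v # vs)) \<rho> x y
     = conj_term ?Q (extend_op ?Q ?H (?K (set vs))) (apply_kraus ?Q (held N k v) [K v] \<rho>) x y"
    unfolding list.map run_filters.simps by (rule Cons.IH) (use Cons.prems in auto)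
  also have "\<dots> = conj_term ?Q (op_comp ?Q (extend_op ?Q ?H (?K (set vs))) (extend_op ?Q (held N k v) (K v))) \<rho> x y"
    unfolding conj_term_comp[symmetric] by (rule conj_term_cong) (simp_all add: apply_kraus_conj_term)
  also have "\<dots> = conj_term ?Q (extend_op ?Q (?H \<union> held N k v) (?K (set (v # vs)))) \<rho> x y"
  proof (rule conj_term_cong)
    have e: "op_comp ?Q (extend_op ?Q ?H (?K (set vs))) (extend_op ?Q (held N k v) (K v)) x z
       = extend_op ?Q (?H \<union> held N k v) (?K (set (v # vs))) x z"
      if "x \<in> basis_states ?Q" "z \<in> basis_states ?Q" for x z
    proof -
      have r: "restrict (restrict x ?H) (held N k w) = restrict x (held N k w)" if "w \<in> set vs" for w x
        using that by (intro restrict_restrict_subset) auto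
      have "?K (set vs) (restrict x ?H) (restrict y ?H) * K v (restrict x (held N k v)) (restrict y (held N k v))
         = ?K (set (v # vs)) x y" for x y
      proof -
        have "?K (set vs) (restrict x ?H) (restrict y ?H) = ?K (set vs) x y"
          by (intro prod.cong refl) (simp only: r)
        moreover have "v \<notin> set vs" using Cons.prems(1) by simp
        ultimately show ?thesis
          by (simp only: list.set(2) prod.insert[OF finite_set] mult.commute simp_thms)
      qed
      then show ?thesis using comp[OF _ that, of "?K (set vs)" "K v"] sub by auto
    qed
    show "op_comp ?Q (extend_op ?Q ?H (?K (set vs))) (extend_op ?Q (held N k v) (K v)) x z
       = extend_op ?Q (?H \<union> held N k v) (?K (set (v # vs))) x z" if "z \<in> basis_states ?Q" for z
      by (rule e[OF xy(1) that])
    show "op_comp ?Q (extend_op ?Q ?H (?K (set vs))) (extend_op ?Q (held N k v) (K v)) y z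
       = extend_op ?Q (?H \<union> held N k v) (?K (set (v # vs))) y z" if "z \<in> basis_states ?Q" for z
      by (rule e[OF xy(2) that])
  qed simp
  also have "?H \<union> held N k v = (\<Union>v\<in>set (v # vs). held N k v)" by auto
  finally show ?case .
qed

lemma run_filters_all_nodes:
  assumes N: "quantum_network N" and vs: "distinct vs" "set vs = nodes N"
    and xy: "x \<in> basis_states (qubits N k)" "y \<in> basis_states (qubits N k)"
  shows "run_filters N k (map (\<lambda>v. (v, K v)) vs) \<rho> x y
    = conj_term (qubits N k) (\<lambda>x y. \<Prod>v\<in>nodes N. K v (restrict x (held N k v)) (restrict y (held N k v))) \<rho> x y"
proof -
  let ?Q = "qubits N k"
  have "holder N q \<in> nodes N" if "q \<in> ?Q" for q
    using that N by (auto simp: qubits_def quantum_network_def)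
  then have H: "(\<Union>v\<in>set vs. held N k v) = ?Q" unfolding vs(2) by (auto simp: held_def)
  have e: "extend_op ?Q ?Q L x z = L x z" if "x \<in> basis_states ?Q" "z \<in> basis_states ?Q" for L x z
    using that by (simp add: extend_op_def PiE_restrict)
  show ?thesis
    unfolding run_filters_nodes[OF N vs(1) equalityD1[OF vs(2)] xy] H
    unfolding vs(2) by (rule conj_term_cong) (use e xy in auto)
qed

section \<open>Filtering a single edge\<close>

lemma density_pure_op:
  assumes "trace (pure_op w) = 1"
  shows "density_op (pure_op w)"
  unfolding density_op_def
proof (intro conjI allI assms)
  show "dagger (pure_op w) = pure_op w"
    by (rule matrix_eqI) (simp add: pure_op_def mult.commute)
  fix v
  have "(\<Sum>i\<in>UNIV. \<Sum>j\<in>UNIV. cnj (v $ i) * pure_op w $ i $ j * v $ j)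
     = (\<Sum>i\<in>UNIV. cnj (v $ i) * w $ i) * cnj (\<Sum>j\<in>UNIV. cnj (v $ j) * w $ j)"
    unfolding cnj_sum sum_product by (simp add: pure_op_def mult_ac)
  also have "\<dots> = of_real ((cmod (\<Sum>i\<in>UNIV. cnj (v $ i) * w $ i))\<^sup>2)"
    by (rule complex_norm_square[symmetric])
  finally show "0 \<le> Re (\<Sum>i\<in>UNIV. \<Sum>j\<in>UNIV. cnj (v $ i) * pure_op w $ i $ j * v $ j)"
    by (simp only: Re_complex_of_real zero_le_power2)
qed

lemma conjugate_pure_op: "U ** pure_op f ** dagger U = pure_op (U *v f)"
proof (rule matrix_eqI)
  fix i j
  have "(U ** pure_op f ** dagger U) $ i $ j = (\<Sum>k\<in>{()}. op_app U (($) f) i * cnj (op_app U (($) f) j))"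
    by (rule gram_conjugate) (simp add: pure_op_def)
  then show "(U ** pure_op f ** dagger U) $ i $ j = pure_op (U *v f) $ i $ j"
    by (simp add: pure_op_def op_app_def matrix_vector_mult_def)
qed

lemma density_conjugate_pure_op:
  assumes "unitary_op U" "trace (pure_op f) = 1"
  shows "density_op (U ** pure_op f ** dagger U)"
proof -
  have "trace (U ** (pure_op f ** dagger U)) = trace (pure_op f ** dagger U ** U)"
    by (rule trace_mul_sym)
  also have "\<dots> = 1" using assms by (simp add: matrix_mul_assoc[symmetric] unitary_op_def)
  finally have "trace (U ** pure_op f ** dagger U) = 1" by (simp add: matrix_mul_assoc)
  then show ?thesis unfolding conjugate_pure_op by (rule density_pure_op)
qed

definition tensor_vec :: "complex ^ bool \<Rightarrow> complex ^ bool \<Rightarrow> two_qubit_vec" where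
  "tensor_vec f g = (\<chi> i. f $ fst i * g $ snd i)"

lemma product_state_conjugate:
  assumes "unitary_op U" "unitary_op V" "trace (pure_op f) = 1" "trace (pure_op g) = 1"
  shows "tensor_op U V ** pure_op (tensor_vec f g) ** dagger (tensor_op U V)
    \<in> {tensor_op S T | (S :: qubit_op) (T :: qubit_op). density_op S \<and> density_op T}"
proof -
  have "pure_op (tensor_vec f g) = tensor_op (pure_op f) (pure_op g)"
    by (rule matrix_eqI) (simp add: pure_op_def tensor_vec_def)
  then have "tensor_op U V ** pure_op (tensor_vec f g) ** dagger (tensor_op U V)
     = tensor_op (U ** pure_op f ** dagger U) (V ** pure_op g ** dagger V)"
    by (simp add: dagger_tensor_op tensor_op_mult)
  then show ?thesis using density_conjugate_pure_op assms by blast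
qed

lemma matrix_scaleR_conj: "A ** (c *\<^sub>R B) ** C = c *\<^sub>R (A ** B ** (C :: complex ^ 'n ^ 'm))"
  by (rule matrix_eqI) (simp add: matrix_mult_nth sum_distrib_left sum_distrib_right
      scaleR_conv_of_real[where 'a = complex] mult_ac)

lemma matrix_mult_add_left: "(A + B) ** C = A ** C + B ** (C :: complex ^ 'n ^ 'm)"
  by (rule matrix_eqI) (simp add: matrix_mult_nth algebra_simps sum.distrib)

text \<open>For \<open>\<alpha> = 0\<close> the second qubit of the pure vector is in state 1, for
  \<open>1 - \<alpha> - \<gamma> = 0\<close> the first is in state 0, and for \<open>l = 0\<close>
  only \<open>|01><01|\<close> is left. By contraposition, entanglement allows the divisions in
  \<open>edge_filter_along_path\<close>.\<close>

lemma separable_rho_agl: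
  assumes lu: "lu_equivalent \<rho> (rho_agl \<alpha> \<gamma> l)" and par: "0 \<le> l" "l \<le> 1" "0 \<le> \<alpha>" "0 \<le> \<gamma>" "\<alpha> + \<gamma> \<le> 1"
    and z: "l = 0 \<or> \<alpha> = 0 \<or> 1 - \<alpha> - \<gamma> = 0"
  shows "separable \<rho>"
proof -
  obtain U V where U: "unitary_op U" and V: "unitary_op V"
    and \<rho>: "\<rho> = tensor_op U V ** rho_agl \<alpha> \<gamma> l ** dagger (tensor_op U V)"
    using lu unfolding lu_equivalent_def by blast
  define P where "P = {tensor_op S T | (S :: qubit_op) (T :: qubit_op). density_op S \<and> density_op T}"
  define cj where "cj v = tensor_op U V ** pure_op v ** dagger (tensor_op U V)" for v
  have tr1: "trace (pure_op (axis b 1 :: complex ^ bool)) = 1" for b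
    by (cases b) (simp_all add: trace_def UNIV_bool pure_op_def axis_def)
  have k01: "ket False True = tensor_vec (axis False 1) (axis True 1)"
    by (simp add: ket_def tensor_vec_def vec_eq_iff axis_def)
  have c01: "cj (ket False True) \<in> P"
    unfolding cj_def P_def k01 by (rule product_state_conjugate[OF U V tr1 tr1])
  have sum: "\<rho> = l *\<^sub>R cj (ket_ag \<alpha> \<gamma>) + (1 - l) *\<^sub>R cj (ket False True)"
    unfolding \<rho> rho_agl_def cj_def
    by (simp add: matrix_add_ldistrib matrix_mult_add_left matrix_scaleR_conj)
  have two: "trace (pure_op (\<chi> b. complex_of_real (if b then x else y))) = 1" if "x * x + y * y = 1" for x y
    using that by (simp add: trace_def UNIV_bool pure_op_def of_real_mult[symmetric] of_real_add[symmetric]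
        del: of_real_mult of_real_add)
  have "\<rho> \<in> convex hull P"
  proof (cases "l = 0")
    case True
    then show ?thesis using c01 by (simp add: sum hull_inc)
  next
    case False
    have "cj (ket_ag \<alpha> \<gamma>) \<in> P"
    proof (cases "\<alpha> = 0")
      case True
      have k: "ket_ag \<alpha> \<gamma> = tensor_vec (\<chi> b. complex_of_real (if b then sqrt (1 - \<gamma>) else sqrt \<gamma>)) (axis True 1)"
        by (auto simp: True ket_ag_def ket_def tensor_vec_def vec_eq_iff axis_def scaleR_conv_of_real[where 'a = complex])
      show ?thesis unfolding cj_def P_def k
        by (rule product_state_conjugate[OF U V two tr1]) (use par True in simp)
    next
      case False
      then have b: "1 - \<alpha> - \<gamma> = 0" using z \<open>l \<noteq> 0\<close> by simp
      have k: "ket_ag \<alpha> \<gamma> = tensor_vec (axis False 1) (\<chi> b. complex_of_real (if b then sqrt \<gamma> else sqrt \<alpha>))"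
        by (auto simp: b ket_ag_def ket_def tensor_vec_def vec_eq_iff axis_def scaleR_conv_of_real[where 'a = complex])
      show ?thesis unfolding cj_def P_def k
        by (rule product_state_conjugate[OF U V tr1 two]) (use par b in simp)
    qed
    then show ?thesis unfolding sum
      using c01 par by (intro convexD[OF convex_convex_hull]) (auto intro: hull_inc)
  qed
  then show ?thesis unfolding separable_def P_def .
qed

text \<open>\<open>d\<close> is the direction in which a path runs through the edge (\<open>True\<close>: from \<open>end1\<close> to \<open>end2\<close>).\<close>

definition monotone_dir :: "bool \<Rightarrow> bool \<times> bool \<Rightarrow> bool" where
  "monotone_dir d i \<longleftrightarrow> (if d then fst i \<longrightarrow> snd i else snd i \<longrightarrow> fst i)"

text \<open>Undo the local unitaries, rescale one qubit to turn the block on \<open>|00>\<close>,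
  \<open>|11>\<close> into ones, and, if the path runs from \<open>end2\<close> to
  \<open>end1\<close>, flip both qubits; then the missing component is the one that decreases along
  the path. Other entries stay unknown.\<close>

lemma edge_filter_along_path:
  assumes lu: "lu_equivalent \<rho> (rho_agl \<alpha> \<gamma> l)" and par: "0 \<le> l" "l \<le> 1" "0 \<le> \<alpha>" "0 \<le> \<gamma>" "\<alpha> + \<gamma> \<le> 1"
    and ent: "entangled \<rho>"
  obtains U1 U2 :: qubit_op where
    "\<And>i j. \<not> monotone_dir d i \<or> \<not> monotone_dir d j \<Longrightarrow>
       (tensor_op U1 U2 ** \<rho> ** dagger (tensor_op U1 U2)) $ i $ j = 0"
    "\<And>s t. (tensor_op U1 U2 ** \<rho> ** dagger (tensor_op U1 U2)) $ (s, s) $ (t, t) = 1"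
proof -
  have nz: "l \<noteq> 0" "\<alpha> \<noteq> 0" "1 - \<alpha> - \<gamma> \<noteq> 0"
    using separable_rho_agl[OF lu par] ent unfolding entangled_def by blast+
  obtain U V where U: "unitary_op U" and V: "unitary_op V"
    and \<rho>: "\<rho> = tensor_op U V ** rho_agl \<alpha> \<gamma> l ** dagger (tensor_op U V)"
    using lu unfolding lu_equivalent_def by blast
  define \<beta> where "\<beta> = 1 - \<alpha> - \<gamma>"
  have pos: "l > 0" "\<alpha> > 0" "\<beta> > 0" using nz par by (simp_all add: \<beta>_def)
  \<comment> \<open>Cancels the amplitudes \<open>sqrt (l * \<alpha>)\<close> on \<open>|00>\<close>
    and \<open>sqrt (l * \<beta>)\<close> on \<open>|11>\<close>; a scale on the first qubit alone
    suffices.\<close>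
  define r where "r b = 1 / (sqrt l * (if b then sqrt \<beta> else sqrt \<alpha>))" for b
  define D1 :: qubit_op where "D1 = (\<chi> i j. if j = (i \<longleftrightarrow> d) then complex_of_real (r j) else 0)"
  define D2 :: qubit_op where "D2 = (\<chi> i j. if j = (i \<longleftrightarrow> d) then 1 else 0)"
  define \<pi> where "\<pi> i = (fst i \<longleftrightarrow> d, snd i \<longleftrightarrow> d)" for i
  have D: "tensor_op D1 D2 $ i $ j = (if j = \<pi> i then complex_of_real (r (fst (\<pi> i))) else 0)" for i j
    by (cases j) (auto simp: D1_def D2_def \<pi>_def)
  define U1 where "U1 = D1 ** dagger U"
  define U2 where "U2 = D2 ** dagger V"
  have R: "dagger (tensor_op U V) ** tensor_op U V = mat 1"
    using U V by (simp add: dagger_tensor_op tensor_op_mult tensor_op_mat_1 unitary_op_def)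
  have T: "tensor_op U1 U2 = tensor_op D1 D2 ** dagger (tensor_op U V)"
    by (simp add: U1_def U2_def dagger_tensor_op tensor_op_mult)
  have "tensor_op U1 U2 ** \<rho> ** dagger (tensor_op U1 U2)
    = tensor_op D1 D2 ** (dagger (tensor_op U V) ** tensor_op U V) ** rho_agl \<alpha> \<gamma> l
        ** (dagger (tensor_op U V) ** tensor_op U V) ** dagger (tensor_op D1 D2)"
    unfolding T \<rho> by (simp add: dagger_mult matrix_mul_assoc)
  then have main: "(tensor_op U1 U2 ** \<rho> ** dagger (tensor_op U1 U2)) $ i $ j
      = complex_of_real (r (fst (\<pi> i))) * rho_agl \<alpha> \<gamma> l $ \<pi> i $ \<pi> j * complex_of_real (r (fst (\<pi> j)))" for i j
    using monomial_conjugate[OF D, of "rho_agl \<alpha> \<gamma> l" i j] by (simp add: R)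
  show thesis
  proof (rule that[of U1 U2])
    fix i j assume "\<not> monotone_dir d i \<or> \<not> monotone_dir d j"
    then have "\<pi> i = (True, False) \<or> \<pi> j = (True, False)"
      by (cases d; cases i; cases j) (auto simp: monotone_dir_def \<pi>_def)
    then have "rho_agl \<alpha> \<gamma> l $ \<pi> i $ \<pi> j = 0" by (auto simp: rho_agl_nth Let_def)
    then show "(tensor_op U1 U2 ** \<rho> ** dagger (tensor_op U1 U2)) $ i $ j = 0" unfolding main by simp
  next
    fix s t
    have "rho_agl \<alpha> \<gamma> l $ (a, a) $ (b, b)
        = complex_of_real (l * ((if a then sqrt \<beta> else sqrt \<alpha>) * (if b then sqrt \<beta> else sqrt \<alpha>)))" for a b
      by (auto simp: rho_agl_nth Let_def \<beta>_def)
    then have "(tensor_op U1 U2 ** \<rho> ** dagger (tensor_op U1 U2)) $ (s, s) $ (t, t)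
      = complex_of_real (r (s \<longleftrightarrow> d) * (l * ((if s \<longleftrightarrow> d then sqrt \<beta> else sqrt \<alpha>) * (if t \<longleftrightarrow> d then sqrt \<beta> else sqrt \<alpha>))) * r (t \<longleftrightarrow> d))"
      unfolding main by (simp add: \<pi>_def)
    also have "r a * (l * ((if a then sqrt \<beta> else sqrt \<alpha>) * (if b then sqrt \<beta> else sqrt \<alpha>))) * r b = 1" for a b
    proof -
      have gen: "1 / (x * y) * ((x * x) * (y * z)) * (1 / (x * z)) = 1"
        if "x \<noteq> 0" "y \<noteq> 0" "z \<noteq> 0" for x y z :: real using that by (simp add: field_simps)
      have l: "sqrt l * sqrt l = l" using pos by simp
      show ?thesis
        unfolding r_def by (rule gen[of "sqrt l", unfolded l]) (use pos in auto)
    qed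
    finally show "(tensor_op U1 U2 ** \<rho> ** dagger (tensor_op U1 U2)) $ (s, s) $ (t, t) = 1" by simp
  qed
qed

text \<open>For edges off the paths: a basis state of positive weight is selected and replaced by
  the unnormalised sum of all basis states, so that the edge contributes the factor 1 whatever its
  bits.\<close>

lemma edge_filter_discard:
  assumes "density_op \<rho>"
  obtains U1 U2 :: qubit_op where
    "\<And>i j. (tensor_op U1 U2 ** \<rho> ** dagger (tensor_op U1 U2)) $ i $ j = 1"
proof -
  have tr: "trace \<rho> = 1" and herm: "dagger \<rho> = \<rho>"
    and psd: "\<And>v. 0 \<le> Re (\<Sum>i\<in>UNIV. \<Sum>j\<in>UNIV. cnj (v $ i) * \<rho> $ i $ j * v $ j)"
    using assms unfolding density_op_def by blast+
  obtain i0 where nz: "\<rho> $ i0 $ i0 \<noteq> 0"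
  proof (rule ccontr)
    assume "\<not> thesis"
    then have "\<rho> $ i $ i = 0" for i using that by blast
    then show False using tr by (simp add: trace_def)
  qed
  have "dagger \<rho> $ i0 $ i0 = \<rho> $ i0 $ i0" by (simp only: herm)
  then have real: "\<rho> $ i0 $ i0 = of_real (Re (\<rho> $ i0 $ i0))" by (simp add: complex_eq_iff)
  have "(\<Sum>i\<in>UNIV. \<Sum>j\<in>UNIV. cnj (axis i0 1 $ i) * \<rho> $ i $ j * axis i0 1 $ j)
     = \<rho> $ i0 $ i0"
    by (simp add: axis_def cnj_delta mult_delta_left mult_delta_right)
  then have "0 \<le> Re (\<rho> $ i0 $ i0)" using psd[of "axis i0 1"] by simp
  then have r0: "Re (\<rho> $ i0 $ i0) > 0" using nz real by (metis less_eq_real_def of_real_0)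
  define r where "r = 1 / sqrt (Re (\<rho> $ i0 $ i0))"
  define U1 :: qubit_op where "U1 = (\<chi> i j. if j = fst i0 then complex_of_real r else 0)"
  define U2 :: qubit_op where "U2 = (\<chi> i j. if j = snd i0 then 1 else 0)"
  have D: "tensor_op U1 U2 $ i $ j = (if j = i0 then complex_of_real r else 0)" for i j
    by (cases j; cases i0) (auto simp: U1_def U2_def)
  have "(tensor_op U1 U2 ** \<rho> ** dagger (tensor_op U1 U2)) $ i $ j = 1" for i j
  proof -
    have "(tensor_op U1 U2 ** \<rho> ** dagger (tensor_op U1 U2)) $ i $ j = of_real r * of_real (Re (\<rho> $ i0 $ i0)) * of_real r"
      using monomial_conjugate[of "tensor_op U1 U2" "\<lambda>_. i0" "\<lambda>_. of_real r", OF D, of \<rho> i j] real by simp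
    also have "\<dots> = of_real (r * Re (\<rho> $ i0 $ i0) * r)" by simp
    also have "r * Re (\<rho> $ i0 $ i0) * r = 1" using r0 by (simp add: r_def)
    finally show ?thesis by simp
  qed
  then show thesis by (rule that)
qed

section \<open>Sufficiency\<close>

text \<open>This and \<open>arc_walk_backward\<close> will transport the bit chosen at one end of a
  path to all nodes on it.\<close>

lemma arc_walk_forward:
  assumes "arc_walk s t u es w" "P u"
    and "\<And>e d. (e, d) \<in> set es \<Longrightarrow> P (if d then s e else t e) \<Longrightarrow> P (if d then t e else s e)"
  shows "P w \<and> (\<forall>e\<in>fst ` set es. P (s e) \<and> P (t e))"
  using assms
proof (induction es arbitrary: u)
  case (Cons a es)
  obtain e d where a: "a = (e, d)" by force
  have tail: "P (if d then s e else t e)" using Cons.prems by (auto simp: a)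
  have head: "P (if d then t e else s e)" using Cons.prems(3)[of e d] tail by (simp add: a)
  have "arc_walk s t (if d then t e else s e) es w" using Cons.prems(1) by (simp add: a)
  from Cons.IH[OF this head] Cons.prems(3)
  have "P w \<and> (\<forall>e\<in>fst ` set es. P (s e) \<and> P (t e))" by simp
  then show ?case using tail head by (auto simp: a split: if_splits)
qed simp

lemma arc_walk_backward:
  assumes "arc_walk s t u es w" "P w"
    and "\<And>e d. (e, d) \<in> set es \<Longrightarrow> P (if d then t e else s e) \<Longrightarrow> P (if d then s e else t e)"
  shows "P u \<and> (\<forall>e\<in>fst ` set es. P (s e) \<and> P (t e))"
  using assms
proof (induction es arbitrary: u)
  case (Cons a es)
  obtain e d where a: "a = (e, d)" by force
  have "arc_walk s t (if d then t e else s e) es w" using Cons.prems(1) by (simp add: a)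
  from Cons.IH[OF this Cons.prems(2)] Cons.prems(3)
  have *: "P (if d then t e else s e)" "\<forall>e\<in>fst ` set es. P (s e) \<and> P (t e)" by simp_all
  have tail: "P (if d then s e else t e)" using Cons.prems(3)[of e d] *(1) by (simp add: a)
  moreover have "(if d then s e else t e) = u" using Cons.prems(1) by (simp add: a)
  ultimately show ?case using * by (auto simp: a split: if_splits)
qed simp

lemma arc_walk_ends:
  assumes "arc_walk s t u es w" "u \<noteq> w"
  shows "\<exists>e\<in>fst ` set es. s e = u \<or> t e = u" "\<exists>e\<in>fst ` set es. s e = w \<or> t e = w"
proof -
  show "\<exists>e\<in>fst ` set es. s e = u \<or> t e = u"
    using assms by (cases es) (auto split: if_splits)
  show "\<exists>e\<in>fst ` set es. s e = w \<or> t e = w"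
    using assms
  proof (induction es arbitrary: u)
    case (Cons a es)
    obtain e d where a: "a = (e, d)" by force
    have w: "arc_walk s t (if d then t e else s e) es w" using Cons.prems(1) by (simp add: a)
    show ?case
    proof (cases "(if d then t e else s e) = w")
      case True
      then show ?thesis by (auto simp: a split: if_splits)
    next
      case False
      from Cons.IH[OF w False] show ?thesis by auto
    qed
  qed simp
qed

text \<open>Without ancillas a basis state amounts to a pair of bits per edge, which turns register
  sums into products over edges.\<close>

lemma sum_edge_basis:
  fixes N :: "('v, 'e) network"
  shows "(\<Sum>y\<in>basis_states (qubits N (\<lambda>_. 0)). F (\<lambda>e\<in>edges N. (y (End1 e), y (End2 e))))
    = (\<Sum>c\<in>edges N \<rightarrow>\<^sub>E UNIV. F c)"
proof -
  have Q: "qubits N (\<lambda>_. 0) = End1 ` edges N \<union> End2 ` edges N" by (simp add: qubits_def)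
  define j where "j y = (\<lambda>e\<in>edges N. (y (End1 e), y (End2 e)))" for y :: "('v, 'e) qubit \<Rightarrow> bool"
  define i where "i c = (\<lambda>q\<in>qubits N (\<lambda>_. 0). case q of End1 e \<Rightarrow> fst (c e) | End2 e \<Rightarrow> snd (c e) | Ancilla v n \<Rightarrow> False)"
    for c :: "'e \<Rightarrow> bool \<times> bool"
  have "(\<Sum>y\<in>basis_states (qubits N (\<lambda>_. 0)). F (j y)) = (\<Sum>c\<in>edges N \<rightarrow>\<^sub>E UNIV. F c)"
  proof (rule sum.reindex_bij_witness[of _ i j])
    fix y assume y: "y \<in> basis_states (qubits N (\<lambda>_. 0))"
    show "i (j y) = y"
    proof
      fix q
      show "i (j y) q = y q"
        using y by (cases "q \<in> qubits N (\<lambda>_. 0)")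
          (auto simp: i_def j_def Q PiE_def extensional_def)
    qed
    show "j y \<in> edges N \<rightarrow>\<^sub>E UNIV" by (simp add: j_def)
  next
    fix c :: "'e \<Rightarrow> bool \<times> bool" assume c: "c \<in> edges N \<rightarrow>\<^sub>E UNIV"
    show "j (i c) = c"
    proof
      fix e
      show "j (i c) e = c e"
        using c by (cases "e \<in> edges N") (auto simp: i_def j_def Q PiE_def extensional_def)
    qed
    show "i c \<in> basis_states (qubits N (\<lambda>_. 0))" by (simp add: i_def)
  qed simp
  then show ?thesis unfolding j_def .
qed

lemma prod_double_sum_PiE:
  fixes G :: "'e \<Rightarrow> 'a::finite \<Rightarrow> 'b::finite \<Rightarrow> complex"
  assumes "finite E"
  shows "(\<Sum>c\<in>E \<rightarrow>\<^sub>E UNIV. \<Sum>c'\<in>E \<rightarrow>\<^sub>E UNIV. \<Prod>e\<in>E. G e (c e) (c' e))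
    = (\<Prod>e\<in>E. \<Sum>i\<in>UNIV. \<Sum>j\<in>UNIV. G e i j)"
proof -
  have "(\<Prod>e\<in>E. \<Sum>i\<in>UNIV. \<Sum>j\<in>UNIV. G e i j)
     = (\<Sum>c\<in>E \<rightarrow>\<^sub>E UNIV. \<Prod>e\<in>E. \<Sum>j\<in>UNIV. G e (c e) j)"
    using assms by (intro prod_sum_PiE) auto
  also have "\<dots> = (\<Sum>c\<in>E \<rightarrow>\<^sub>E UNIV. \<Sum>c'\<in>E \<rightarrow>\<^sub>E UNIV. \<Prod>e\<in>E. G e (c e) (c' e))"
    using assms by (intro sum.cong refl prod_sum_PiE) auto
  finally show ?thesis ..
qed

lemma prod_nodes_qubits:
  assumes N: "quantum_network N"
  shows "(\<Prod>v\<in>nodes N. \<Prod>q\<in>held N k v. f q) = (\<Prod>q\<in>qubits N k. f q :: complex)"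
proof -
  have "holder N q \<in> nodes N" if "q \<in> qubits N k" for q
    using that N by (auto simp: qubits_def quantum_network_def)
  then have H: "(\<Union>v\<in>nodes N. held N k v) = qubits N k" by (auto simp: held_def)
  have "(\<Prod>q\<in>(\<Union>v\<in>nodes N. held N k v). f q) = (\<Prod>v\<in>nodes N. \<Prod>q\<in>held N k v. f q)"
    by (rule prod.UNION_disjoint)
      (use N finite_qubits[OF N, of k] in \<open>auto simp: quantum_network_def held_def\<close>)
  then show ?thesis unfolding H ..
qed

lemma prod_qubits_edges:
  assumes "finite (edges N)"
  shows "(\<Prod>q\<in>qubits N (\<lambda>_. 0). f q) = (\<Prod>e\<in>edges N. f (End1 e) * f (End2 e) :: complex)"
proof -
  have Q: "qubits N (\<lambda>_. 0) = End1 ` edges N \<union> End2 ` edges N" by (simp add: qubits_def)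
  have "(\<Prod>q\<in>End1 ` edges N \<union> End2 ` edges N. f q) = (\<Prod>q\<in>End1 ` edges N. f q) * (\<Prod>q\<in>End2 ` edges N. f q)"
    using assms by (intro prod.union_disjoint) auto
  also have "(\<Prod>q\<in>End1 ` edges N. f q) = (\<Prod>e\<in>edges N. f (End1 e))"
    by (subst prod.reindex) (auto simp: inj_on_def)
  also have "(\<Prod>q\<in>End2 ` edges N. f q) = (\<Prod>e\<in>edges N. f (End2 e))"
    by (subst prod.reindex) (auto simp: inj_on_def)
  finally show ?thesis unfolding Q by (simp add: prod.distrib)
qed

text \<open>Filters on single qubits pair up edge by edge, so the network state remains a product
  over edges.\<close>

lemma qubit_filters_on_initial_state:
  fixes N :: "('v, 'e) network" and U1 U2 :: "'e \<Rightarrow> qubit_op"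
  assumes fin: "finite (edges N)"
  defines "u \<equiv> case_qubit U1 U2 (\<lambda>_ _. mat 1)"
  shows "conj_term (qubits N (\<lambda>_. 0)) (\<lambda>x y. \<Prod>q\<in>qubits N (\<lambda>_. 0). u q $ x q $ y q)
      (initial_state N (\<lambda>_. 0)) x x'
    = (\<Prod>e\<in>edges N. (tensor_op (U1 e) (U2 e) ** edge_state N e ** dagger (tensor_op (U1 e) (U2 e)))
        $ (x (End1 e), x (End2 e)) $ (x' (End1 e), x' (End2 e)))"
proof -
  define T where "T e = tensor_op (U1 e) (U2 e)" for e
  define G where "G e i j = T e $ (x (End1 e), x (End2 e)) $ i * edge_state N e $ i $ j
      * cnj (T e $ (x' (End1 e), x' (End2 e)) $ j)" for e i j
  let ?B = "basis_states (qubits N (\<lambda>_. 0))"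
  let ?c = "\<lambda>y. (\<lambda>e\<in>edges N. (y (End1 e), y (End2 e)))"
  have "conj_term (qubits N (\<lambda>_. 0)) (\<lambda>x y. \<Prod>q\<in>qubits N (\<lambda>_. 0). u q $ x q $ y q)
      (initial_state N (\<lambda>_. 0)) x x'
    = (\<Sum>y\<in>?B. \<Sum>y'\<in>?B. \<Prod>e\<in>edges N. G e (?c y e) (?c y' e))"
    unfolding conj_term_def
  proof (intro sum.cong refl)
    fix y y'
    show "(\<Prod>q\<in>qubits N (\<lambda>_. 0). u q $ x q $ y q) * initial_state N (\<lambda>_. 0) y y' *
        cnj (\<Prod>q\<in>qubits N (\<lambda>_. 0). u q $ x' q $ y' q) = (\<Prod>e\<in>edges N. G e (?c y e) (?c y' e))"
      unfolding prod_qubits_edges[OF fin] initial_state_def cnj_prod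
      by (simp add: prod.distrib[symmetric] u_def G_def T_def) 
  qed
  also have "\<dots> = (\<Sum>c\<in>edges N \<rightarrow>\<^sub>E UNIV. \<Sum>c'\<in>edges N \<rightarrow>\<^sub>E UNIV. \<Prod>e\<in>edges N. G e (c e) (c' e))"
    unfolding sum_edge_basis[where F = "\<lambda>c'. \<Prod>e\<in>edges N. G e (c e) (c' e)" for c]
    by (rule sum_edge_basis[where F = "\<lambda>c. \<Sum>c'\<in>edges N \<rightarrow>\<^sub>E UNIV. \<Prod>e\<in>edges N. G e (c e) (c' e)"])
  also have "\<dots> = (\<Prod>e\<in>edges N. \<Sum>i\<in>UNIV. \<Sum>j\<in>UNIV. G e i j)"
    by (rule prod_double_sum_PiE[OF fin])
  also have "\<dots> = (\<Prod>e\<in>edges N. (T e ** edge_state N e ** dagger (T e)) $ (x (End1 e), x (End2 e)) $ (x' (End1 e), x' (End2 e)))"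
  proof (intro prod.cong refl)
    fix e
    have "(\<Sum>i\<in>UNIV. \<Sum>j\<in>UNIV. G e i j) = (\<Sum>j\<in>UNIV. \<Sum>i\<in>UNIV. G e i j)" by (rule sum.swap)
    then show "(\<Sum>i\<in>UNIV. \<Sum>j\<in>UNIV. G e i j)
      = (T e ** edge_state N e ** dagger (T e)) $ (x (End1 e), x (End2 e)) $ (x' (End1 e), x' (End2 e))"
      by (simp add: matrix_mult_nth G_def sum_distrib_right)
  qed
  finally show ?thesis unfolding T_def .
qed

lemma prod_of_bool: "finite I \<Longrightarrow> (\<Prod>i\<in>I. of_bool (P i)) = (of_bool (\<forall>i\<in>I. P i) :: complex)"
  by (induction I rule: finite_induct) auto

lemma edge_path_subset: "edge_path N u p w \<Longrightarrow> set p \<subseteq> edges N"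
  by (induction p arbitrary: u) auto

lemma edge_path_distinct_walk:
  assumes "edge_path N u p w"
  obtains es where "arc_walk (end1 N) (end2 N) u es w" "fst ` set es \<subseteq> set p" "distinct (map fst es)"
proof -
  obtain es where es: "arc_walk (end1 N) (end2 N) u es w" "map fst es = p"
    using edge_path_to_arc_walk[OF assms] by blast
  obtain es' where es': "arc_walk (end1 N) (end2 N) u es' w" "set es' \<subseteq> set es" "distinct (map fst es')"
    using arc_walk_distinct[OF es(1)] by blast
  have "fst ` set es' \<subseteq> set p" unfolding es(2)[symmetric] set_map by (rule image_mono[OF es'(2)])
  with es' show thesis using that by blast
qed

lemma dagger_mat_1: "dagger (mat 1) = mat 1"
  by (rule matrix_eqI) (simp add: mat_def)

lemma perfect_singletI:
  assumes "\<And>i j. \<tau> $ i $ j = of_bool (fst i = snd i \<and> fst j = snd j) / 2"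
  shows "perfect_singlet \<tau>"
proof -
  let ?\<Phi> = "(1 / sqrt 2) *\<^sub>R (ket False False + ket True True)"
  have v: "?\<Phi> $ i = of_bool (fst i = snd i) / complex_of_real (sqrt 2)" for i
    by (cases i) (auto simp: ket_def axis_def scaleR_conv_of_real[where 'a = complex])
  have s2: "complex_of_real (sqrt 2) * complex_of_real (sqrt 2) = 2"
    by (simp add: of_real_mult[symmetric] del: of_real_mult)
  have "\<tau> = pure_op ?\<Phi>"
  proof (rule matrix_eqI)
    fix i j
    show "\<tau> $ i $ j = pure_op ?\<Phi> $ i $ j"
      unfolding assms pure_op_def vec_lambda_beta v by (simp add: s2)
  qed
  moreover have "unitary_op (mat 1 :: qubit_op)" by (simp add: unitary_op_def dagger_mat_1)
  ultimately show ?thesis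
    unfolding perfect_singlet_def lu_equivalent_def
    by (intro exI[of _ "mat 1"]) (simp add: tensor_op_mat_1 dagger_mat_1)
qed

text \<open>Two rounds without ancillas: \<open>l1\<close> filters each qubit, and \<open>l2\<close>
  applies at each node the map from \<open>Y s\<close> to \<open>X s\<close>, coherently in
  \<open>s\<close>. This erases the bit everywhere except at \<open>a\<close> and \<open>b\<close>;
  what survives is the sum of \<open>X False\<close> and \<open>X True\<close>, a singlet beside
  zeros.\<close>

lemma two_paths_suffice:
  fixes N :: "('v, 'e) network" and A B :: 'v
  assumes N: "quantum_network N" and ent: "\<forall>e\<in>edges N. entangled (edge_state N e)"
    and AB: "A \<noteq> B"
    and path: "edge_path N A p B" "edge_path N A q B" "set p \<inter> set q = {}"
    and form: "\<forall>e\<in>set p \<union> set q. \<exists>\<alpha> \<gamma> l. 0 \<le> l \<and> l \<le> 1 \<and> 0 \<le> \<alpha> \<and> 0 \<le> \<gamma> \<and> \<alpha> + \<gamma> \<le> 1 \<and>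
        lu_equivalent (edge_state N e) (rho_agl \<alpha> \<gamma> l)"
  shows "singlet_generable N A B"
proof -
  have finE: "finite (edges N)" and finN: "finite (nodes N)" using N by (simp_all add: quantum_network_def)
  let ?k = "\<lambda>_. 0 :: nat"
  define Q where "Q = qubits N ?k"
  have finQ: "finite Q" unfolding Q_def by (rule finite_qubits[OF N])
  obtain pe where pe: "arc_walk (end1 N) (end2 N) A pe B" "fst ` set pe \<subseteq> set p" "distinct (map fst pe)"
    using edge_path_distinct_walk[OF path(1)] by blast
  obtain qe where qe: "arc_walk (end1 N) (end2 N) A qe B" "fst ` set qe \<subseteq> set q" "distinct (map fst qe)"
    using edge_path_distinct_walk[OF path(2)] by blast
  define Ep where "Ep = fst ` set pe"
  define Eq where "Eq = fst ` set qe"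
  have EpN: "Ep \<subseteq> edges N" and EqN: "Eq \<subseteq> edges N"
    using pe(2) qe(2) edge_path_subset[OF path(1)] edge_path_subset[OF path(2)] unfolding Ep_def Eq_def by auto
  have disj: "Ep \<inter> Eq = {}" using pe(2) qe(2) path(3) unfolding Ep_def Eq_def by auto
  \<comment> \<open>The direction of a path edge is unique: each walk uses an edge at most once, and
    the walks share none.\<close>
  define dir where "dir e \<longleftrightarrow> (e, True) \<in> set pe \<union> set qe" for e
  have dir_p: "dir e = d" if ed: "(e, d) \<in> set pe" for e d
  proof -
    have "(e, True) \<notin> set qe" using disj ed unfolding Ep_def Eq_def by force
    then show ?thesis using ed eq_key_imp_eq_value[OF pe(3), of e] by (cases d) (auto simp: dir_def)
  qed
  have dir_q: "dir e = d" if ed: "(e, d) \<in> set qe" for e d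
  proof -
    have "(e, True) \<notin> set pe" using disj ed unfolding Ep_def Eq_def by force
    then show ?thesis using ed eq_key_imp_eq_value[OF qe(3), of e] by (cases d) (auto simp: dir_def)
  qed
  define fl where "fl e U = tensor_op (fst U) (snd U) ** edge_state N e ** dagger (tensor_op (fst U) (snd U))"
    for e and U :: "qubit_op \<times> qubit_op"
  define good where "good e U \<longleftrightarrow>
      (if e \<in> Ep \<union> Eq then (\<forall>i j. \<not> monotone_dir (dir e) i \<or> \<not> monotone_dir (dir e) j \<longrightarrow> fl e U $ i $ j = 0)
          \<and> (\<forall>s t. fl e U $ (s, s) $ (t, t) = 1)
       else (\<forall>i j. fl e U $ i $ j = 1))" for e U
  have "\<exists>U. e \<in> edges N \<longrightarrow> good e U" for e
  proof (cases "e \<in> edges N")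
    case True
    show ?thesis
    proof (cases "e \<in> Ep \<union> Eq")
      case T: True
      then have "e \<in> set p \<union> set q" using pe(2) qe(2) unfolding Ep_def Eq_def by blast
      then obtain \<alpha> \<gamma> l where f: "0 \<le> l" "l \<le> 1" "0 \<le> \<alpha>" "0 \<le> \<gamma>" "\<alpha> + \<gamma> \<le> 1"
        "lu_equivalent (edge_state N e) (rho_agl \<alpha> \<gamma> l)" using form by blast
      have "entangled (edge_state N e)" using ent True by blast
      from edge_filter_along_path[OF f(6) f(1-5) this, of "dir e"] obtain U1 U2 where
        U: "\<And>i j. \<not> monotone_dir (dir e) i \<or> \<not> monotone_dir (dir e) j \<Longrightarrow> fl e (U1, U2) $ i $ j = 0"
        "\<And>s t. fl e (U1, U2) $ (s, s) $ (t, t) = 1" unfolding fl_def fst_conv snd_conv by blast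
      have "good e (U1, U2)" unfolding good_def using U T by simp
      then show ?thesis by blast
    next
      case F: False
      have "density_op (edge_state N e)" using N True by (simp add: quantum_network_def)
      from edge_filter_discard[OF this] obtain U1 U2 where
        U: "\<And>i j. fl e (U1, U2) $ i $ j = 1" unfolding fl_def fst_conv snd_conv by blast
      have "good e (U1, U2)" unfolding good_def using U F by simp
      then show ?thesis by blast
    qed
  qed blast
  then obtain U where U: "\<And>e. e \<in> edges N \<Longrightarrow> good e (U e)" by metis
  define \<tau> where "\<tau> e = fl e (U e)" for e
  have \<tau>0: "\<tau> e $ i $ j = 0" if "e \<in> Ep \<union> Eq" "\<not> monotone_dir (dir e) i \<or> \<not> monotone_dir (dir e) j" for e i j
  proof -
    have "e \<in> edges N" using that(1) EpN EqN by blast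
    from U[OF this] show ?thesis using that(2) unfolding good_def if_P[OF that(1)] \<tau>_def by blast
  qed
  have \<tau>1: "\<tau> e $ (s, s) $ (t, t) = 1" if "e \<in> edges N" for e s t
    using U[OF that] unfolding good_def \<tau>_def by (cases "e \<in> Ep \<union> Eq") simp_all
  obtain vs where vs: "distinct vs" "set vs = nodes N" using finite_distinct_list[OF finN] by blast
  define u :: "('v, 'e) qubit \<Rightarrow> qubit_op" where "u = case_qubit (\<lambda>e. fst (U e)) (\<lambda>e. snd (U e)) (\<lambda>_ _. mat 1)"
  define K1 where "K1 v x y = (\<Prod>r\<in>held N ?k v. u r $ x r $ y r)" for v and x y :: "('v, 'e) qubit \<Rightarrow> bool"
  define l1 where "l1 = map (\<lambda>v. (v, K1 v)) vs"
  define \<rho>1 where "\<rho>1 = run_filters N ?k l1 (initial_state N ?k)"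
  have \<rho>1: "\<rho>1 x x' = (\<Prod>e\<in>edges N. \<tau> e $ (x (End1 e), x (End2 e)) $ (x' (End1 e), x' (End2 e)))"
    if xx: "x \<in> basis_states Q" "x' \<in> basis_states Q" for x x'
  proof -
    have "(\<lambda>x y. \<Prod>v\<in>nodes N. K1 v (restrict x (held N ?k v)) (restrict y (held N ?k v)))
       = (\<lambda>x y. \<Prod>r\<in>Q. u r $ x r $ y r)"
    proof (intro ext)
      fix x y
      have "(\<Prod>v\<in>nodes N. K1 v (restrict x (held N ?k v)) (restrict y (held N ?k v)))
         = (\<Prod>v\<in>nodes N. \<Prod>r\<in>held N ?k v. u r $ x r $ y r)"
        unfolding K1_def by (intro prod.cong refl) simp
      then show "(\<Prod>v\<in>nodes N. K1 v (restrict x (held N ?k v)) (restrict y (held N ?k v))) = (\<Prod>r\<in>Q. u r $ x r $ y r)"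
        unfolding Q_def prod_nodes_qubits[OF N] .
    qed
    then have "\<rho>1 x x' = conj_term Q (\<lambda>x y. \<Prod>r\<in>Q. u r $ x r $ y r) (initial_state N ?k) x x'"
      using run_filters_all_nodes[OF N vs, of x ?k x' K1] xx unfolding \<rho>1_def l1_def Q_def by simp
    then show ?thesis
      unfolding Q_def u_def qubit_filters_on_initial_state[OF finE] \<tau>_def fl_def .
  qed
  obtain a where a: "a \<in> held N ?k A" "a \<in> End1 ` Ep \<union> End2 ` Ep"
  proof -
    obtain e where "e \<in> Ep" "end1 N e = A \<or> end2 N e = A" using arc_walk_ends(1)[OF pe(1) AB] Ep_def by blast
    then have "End1 e \<in> held N ?k A \<or> End2 e \<in> held N ?k A" using EpN by (auto simp: held_def qubits_def)
    then show thesis using that \<open>e \<in> Ep\<close> by blast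
  qed
  obtain b where b: "b \<in> held N ?k B" "b \<in> End1 ` Ep \<union> End2 ` Ep"
  proof -
    obtain e where "e \<in> Ep" "end1 N e = B \<or> end2 N e = B" using arc_walk_ends(2)[OF pe(1) AB] Ep_def by blast
    then have "End1 e \<in> held N ?k B \<or> End2 e \<in> held N ?k B" using EpN by (auto simp: held_def qubits_def)
    then show thesis using that \<open>e \<in> Ep\<close> by blast
  qed
  have abQ: "a \<in> Q" "b \<in> Q" and ab: "a \<noteq> b" using a(1) b(1) AB by (auto simp: held_def Q_def)
  define Pq where "Pq = End1 ` Ep \<union> (End2 ` Ep :: ('v, 'e) qubit set)"
  define Qq where "Qq = End1 ` Eq \<union> (End2 ` Eq :: ('v, 'e) qubit set)"
  have PQ: "Pq \<inter> Qq = {}" using disj by (auto simp: Pq_def Qq_def)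
  \<comment> \<open>\<open>Y s\<close>: the bit \<open>s\<close> on the first path, its negation on the second; \<open>X s\<close>: the output, with \<open>s\<close> kept on the two qubits of the singlet only.\<close>
  define X where "X s r \<longleftrightarrow> (r = a \<or> r = b) \<and> s" for s r
  define Y where "Y s r \<longleftrightarrow> (if r \<in> Pq then s else r \<in> Qq \<and> \<not> s)" for s r
  define Xb where "Xb s = restrict (X s) Q" for s
  define Yb where "Yb s = restrict (Y s) Q" for s
  have XbB: "Xb s \<in> basis_states Q" and YbB: "Yb s \<in> basis_states Q" for s
    by (simp_all add: Xb_def Yb_def)
  \<comment> \<open>An existential rather than a sum over \<open>s\<close>: where all qubits of a
    node lie off the paths, both values of \<open>s\<close> give the same vector, which must count
    once.\<close>
  define D where "D v x y = (of_bool (\<exists>s. \<forall>r\<in>held N ?k v. x r = X s r \<and> y r = Y s r) :: complex)"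
    for v and x y :: "('v, 'e) qubit \<Rightarrow> bool"
  define Dok where "Dok x y \<longleftrightarrow> (\<forall>v\<in>nodes N. \<exists>s. \<forall>r\<in>held N ?k v. x r = X s r \<and> y r = Y s r)" for x y
  define l2 where "l2 = map (\<lambda>v. (v, D v)) vs"
  define \<rho>2 where "\<rho>2 = run_filters N ?k l2 \<rho>1"
  have \<rho>2: "\<rho>2 x x' = conj_term Q (\<lambda>x y. of_bool (Dok x y)) \<rho>1 x x'"
    if xx: "x \<in> basis_states Q" "x' \<in> basis_states Q" for x x'
  proof -
    have "(\<lambda>x y. \<Prod>v\<in>nodes N. D v (restrict x (held N ?k v)) (restrict y (held N ?k v)))
       = (\<lambda>x y. of_bool (Dok x y))"
      unfolding D_def Dok_def prod_of_bool[OF finN] by (simp add: fun_eq_iff)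
    then show ?thesis
      using run_filters_all_nodes[OF N vs, of x ?k x' D] xx unfolding \<rho>2_def l2_def Q_def by simp
  qed
  have inQ: "End1 e \<in> held N ?k (end1 N e)" "End2 e \<in> held N ?k (end2 N e)"
    "end1 N e \<in> nodes N" "end2 N e \<in> nodes N" if "e \<in> edges N" for e
    using that N by (auto simp: held_def qubits_def quantum_network_def)
  \<comment> \<open>\<open>sv v\<close> will be the bit chosen at node \<open>v\<close>; it
    increases along the first path and, by negation, decreases along the second.\<close>
  have rigid: "\<exists>s. x = Xb s \<and> y = Yb s"
    if xy: "x \<in> basis_states Q" "y \<in> basis_states Q" and ok: "Dok x y"
      and mono: "\<And>e. e \<in> Ep \<union> Eq \<Longrightarrow> monotone_dir (dir e) (y (End1 e), y (End2 e))" for x y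
  proof -
    have "\<forall>v. \<exists>s. v \<in> nodes N \<longrightarrow> (\<forall>r\<in>held N ?k v. x r = X s r \<and> y r = Y s r)"
      using ok unfolding Dok_def by blast
    from choice[OF this] obtain sv where
      sv: "\<And>v r. v \<in> nodes N \<Longrightarrow> r \<in> held N ?k v \<Longrightarrow> x r = X (sv v) r \<and> y r = Y (sv v) r" by blast
    have yp: "y (End1 e) = sv (end1 N e)" "y (End2 e) = sv (end2 N e)" if "e \<in> Ep" for e
    proof -
      have e: "e \<in> edges N" using that EpN by blast
      show "y (End1 e) = sv (end1 N e)" "y (End2 e) = sv (end2 N e)"
        using sv[OF inQ(3,1)[OF e]] sv[OF inQ(4,2)[OF e]] that by (auto simp: Y_def Pq_def)
    qed
    have yq: "y (End1 e) = (\<not> sv (end1 N e))" "y (End2 e) = (\<not> sv (end2 N e))" if "e \<in> Eq" for e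
    proof -
      have e: "e \<in> edges N" using that EqN by blast
      have "End1 e \<in> Qq" "End2 e \<in> Qq" using that by (auto simp: Qq_def)
      moreover from this have "End1 e \<notin> Pq" "End2 e \<notin> Pq" using PQ by blast+
      ultimately show "y (End1 e) = (\<not> sv (end1 N e))" "y (End2 e) = (\<not> sv (end2 N e))"
        using sv[OF inQ(3,1)[OF e]] sv[OF inQ(4,2)[OF e]] by (auto simp: Y_def)
    qed
    have mp: "sv (if d then end1 N e else end2 N e) \<longrightarrow> sv (if d then end2 N e else end1 N e)"
      if "(e, d) \<in> set pe" for e d
    proof -
      have e: "e \<in> Ep" using that unfolding Ep_def by force
      show ?thesis using mono[of e] yp[OF e] dir_p[OF that] e
        by (cases d) (auto simp: monotone_dir_def)
    qed
    have mq: "sv (if d then end2 N e else end1 N e) \<longrightarrow> sv (if d then end1 N e else end2 N e)"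
      if "(e, d) \<in> set qe" for e d
    proof -
      have e: "e \<in> Eq" using that unfolding Eq_def by force
      show ?thesis using mono[of e] yq[OF e] dir_q[OF that] e
        by (cases d) (auto simp: monotone_dir_def)
    qed
    \<comment> \<open>A bit 1 at \<open>A\<close> spreads forward along the first path to
      \<open>B\<close> and from there backward along the second; a bit 0 goes round the other
      way.\<close>
    have const: "sv (end1 N e) = sv A \<and> sv (end2 N e) = sv A" if "e \<in> Ep \<union> Eq" for e
    proof (cases "sv A")
      case True
      have p: "sv B \<and> (\<forall>e\<in>Ep. sv (end1 N e) \<and> sv (end2 N e))" unfolding Ep_def
        by (rule arc_walk_forward[OF pe(1), of sv]) (use True mp in blast)+
      have q: "sv A \<and> (\<forall>e\<in>Eq. sv (end1 N e) \<and> sv (end2 N e))" unfolding Eq_def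
        by (rule arc_walk_backward[OF qe(1), of sv]) (use p mq in blast)+
      show ?thesis using p q that True by blast
    next
      case False
      have q: "\<not> sv B \<and> (\<forall>e\<in>Eq. \<not> sv (end1 N e) \<and> \<not> sv (end2 N e))" unfolding Eq_def
        by (rule arc_walk_forward[OF qe(1), of "\<lambda>v. \<not> sv v"]) (use False mq in blast)+
      have p: "\<not> sv A \<and> (\<forall>e\<in>Ep. \<not> sv (end1 N e) \<and> \<not> sv (end2 N e))" unfolding Ep_def
        by (rule arc_walk_backward[OF pe(1), of "\<lambda>v. \<not> sv v"]) (use q mp in blast)+
      show ?thesis using p q that False by blast
    qed
    have "x r = X (sv A) r \<and> y r = Y (sv A) r" if r: "r \<in> Q" for r
    proof -
      have h: "holder N r \<in> nodes N" "r \<in> held N ?k (holder N r)"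
        using r N by (auto simp: Q_def held_def qubits_def quantum_network_def)
      show ?thesis
      proof (cases "r \<in> Pq \<union> Qq")
        case True
        then obtain e where "e \<in> Ep \<union> Eq" "r = End1 e \<or> r = End2 e" by (auto simp: Pq_def Qq_def)
        then have "sv (holder N r) = sv A" using const by auto
        then show ?thesis using sv[OF h] by simp
      next
        case False
        then have "r \<noteq> a" "r \<noteq> b" using a(2) b(2) unfolding Pq_def by blast+
        then show ?thesis using sv[OF h] False by (simp add: X_def Y_def)
      qed
    qed
    then have "x = Xb (sv A) \<and> y = Yb (sv A)"
      using xy unfolding Xb_def Yb_def by (auto simp: fun_eq_iff restrict_def PiE_def extensional_def)
    then show ?thesis ..
  qed
  have DokXY: "Dok (Xb s) (Yb s)" for s
    unfolding Dok_def Xb_def Yb_def by (intro ballI exI[of _ s]) (auto simp: held_def Q_def)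
  \<comment> \<open>In \<open>Yb s\<close> the two qubits of every edge carry equal bits, so only
    entries normalised to 1 occur, also in the coherence between \<open>Yb False\<close> and
    \<open>Yb True\<close>.\<close>
  have \<rho>1_YY: "\<rho>1 (Yb s) (Yb t) = 1" for s t
    unfolding \<rho>1[OF YbB YbB]
  proof (rule prod.neutral, intro ballI)
    fix e assume e: "e \<in> edges N"
    have "End1 e \<in> Q" "End2 e \<in> Q" using inQ[OF e] by (auto simp: held_def Q_def)
    moreover have "(End1 e \<in> Pq) = (End2 e \<in> Pq)" "(End1 e \<in> Qq) = (End2 e \<in> Qq)"
      by (auto simp: Pq_def Qq_def)
    ultimately have "Yb s (End1 e) = Yb s (End2 e)" for s by (simp add: Yb_def Y_def)
    then show "\<tau> e $ (Yb s (End1 e), Yb s (End2 e)) $ (Yb t (End1 e), Yb t (End2 e)) = 1"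
      using \<tau>1[OF e] by simp
  qed
  have Xinj: "Xb s = Xb t \<longleftrightarrow> s = t" for s t
  proof
    assume "Xb s = Xb t"
    then have "Xb s a = Xb t a" by simp
    then show "s = t" using abQ by (simp add: Xb_def X_def)
  qed simp
  \<comment> \<open>A nonzero entry of \<open>\<rho>1\<close> makes \<open>y\<close> and
    \<open>y'\<close> monotone on all path edges, so \<open>rigid\<close> applies to both; the
    unknown entries of the filtered edges never enter.\<close>
  have term_val: "of_bool (Dok x y) * \<rho>1 y y' * cnj (of_bool (Dok x' y'))
      = of_bool (\<exists>s t. x = Xb s \<and> y = Yb s \<and> x' = Xb t \<and> y' = Yb t)"
    if B: "x \<in> basis_states Q" "x' \<in> basis_states Q" "y \<in> basis_states Q" "y' \<in> basis_states Q" for x x' y y'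
  proof (cases "\<exists>s t. x = Xb s \<and> y = Yb s \<and> x' = Xb t \<and> y' = Yb t")
    case True
    then show ?thesis using DokXY \<rho>1_YY by auto
  next
    case False
    have "Dok x y \<and> Dok x' y' \<longrightarrow> \<rho>1 y y' = 0"
    proof (rule ccontr)
      assume "\<not> ?thesis"
      then have *: "Dok x y" "Dok x' y'" "\<rho>1 y y' \<noteq> 0" by auto
      have "monotone_dir (dir e) (y (End1 e), y (End2 e)) \<and> monotone_dir (dir e) (y' (End1 e), y' (End2 e))"
        if e: "e \<in> Ep \<union> Eq" for e
      proof (rule ccontr)
        assume "\<not> ?thesis"
        then have "\<tau> e $ (y (End1 e), y (End2 e)) $ (y' (End1 e), y' (End2 e)) = 0" using \<tau>0[OF e] by blast
        moreover have "e \<in> edges N" using e EpN EqN by blast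
        ultimately have "\<rho>1 y y' = 0" unfolding \<rho>1[OF B(3,4)] using finE by (intro prod_zero) auto
        with *(3) show False by simp
      qed
      then show False using rigid[OF B(1,3) *(1)] rigid[OF B(2,4) *(2)] False by blast
    qed
    then show ?thesis using False by auto
  qed
  have \<rho>2_val: "\<rho>2 x x' = of_bool ((\<exists>s. x = Xb s) \<and> (\<exists>t. x' = Xb t))"
    if B: "x \<in> basis_states Q" "x' \<in> basis_states Q" for x x'
  proof -
    have "\<rho>2 x x' = (\<Sum>y\<in>basis_states Q. \<Sum>y'\<in>basis_states Q.
        of_bool (\<exists>s t. x = Xb s \<and> y = Yb s \<and> x' = Xb t \<and> y' = Yb t))"
      unfolding \<rho>2[OF B] conj_term_def by (intro sum.cong refl) (rule term_val[OF B])
    also have "\<dots> = of_bool ((\<exists>s. x = Xb s) \<and> (\<exists>t. x' = Xb t))"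
    proof (cases "(\<exists>s. x = Xb s) \<and> (\<exists>t. x' = Xb t)")
      case True
      then obtain s t where st: "x = Xb s" "x' = Xb t" by blast
      have "(\<Sum>y\<in>basis_states Q. \<Sum>y'\<in>basis_states Q.
          (of_bool (\<exists>s t. x = Xb s \<and> y = Yb s \<and> x' = Xb t \<and> y' = Yb t) :: complex))
        = (\<Sum>y\<in>basis_states Q. if y = Yb s then (\<Sum>y'\<in>basis_states Q. if y' = Yb t then 1 else 0) else 0)"
        by (intro sum.cong refl) (auto simp: st Xinj intro!: sum.cong)
      also have "\<dots> = 1" using YbB finite_basis_states[OF finQ] by simp
      finally show ?thesis using True by simp
    next
      case False
      then show ?thesis by (auto intro!: sum.neutral)
    qed
    finally show ?thesis .
  qed
  have "\<forall>(v, K)\<in>set (l1 @ l2). v \<in> nodes N" using vs(2) by (auto simp: l1_def l2_def)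
  from filters_realizable[OF N this, of ?k "initial_state N ?k"]
  obtain P c where c: "c > 0" and P: "locc_protocol N ?k P"
    "outcome N ?k (initial_state N ?k) P (\<lambda>x y. complex_of_real c * \<rho>2 x y)"
    unfolding run_filters_append \<rho>1_def[symmetric] \<rho>2_def[symmetric] by blast
  define \<sigma> where "\<sigma> = (\<lambda>x y. complex_of_real c * \<rho>2 x y)"
  have "(\<Sum>x\<in>basis_states Q. \<sigma> x x) = (\<Sum>x\<in>{Xb False, Xb True}. \<sigma> x x)"
  proof (rule sum.mono_neutral_right)
    show "\<forall>x\<in>basis_states Q - {Xb False, Xb True}. \<sigma> x x = 0"
    proof
      fix x assume x: "x \<in> basis_states Q - {Xb False, Xb True}"
      then have "x \<noteq> Xb s" for s by (cases s) auto
      then show "\<sigma> x x = 0" using x by (simp add: \<sigma>_def \<rho>2_val)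
    qed
  qed (use finite_basis_states[OF finQ] XbB in auto)
  also have "\<dots> = 2 * complex_of_real c"
  proof -
    have "\<rho>2 (Xb s) (Xb s) = 1" for s unfolding \<rho>2_val[OF XbB XbB] by auto
    then show ?thesis using Xinj[of False True] by (simp add: \<sigma>_def)
  qed
  finally have tr: "trace_reg Q \<sigma> = 2 * c" by (simp add: trace_reg_def)
  have red: "reduce_pair Q a b \<sigma> $ i $ j = complex_of_real c * of_bool (fst i = snd i \<and> fst j = snd j)" for i j
  proof -
    define x0 where "x0 = restrict (\<lambda>_. False) (Q - {a, b})"
    have x0: "x0 \<in> basis_states (Q - {a, b})" by (simp add: x0_def)
    \<comment> \<open>Both values of \<open>s\<close> leave the same all-zero state on the
      traced-out qubits, which is why the coherence survives the partial trace.\<close>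
    have iff: "(\<exists>s. x(a := fst i, b := snd i) = Xb s) \<longleftrightarrow> x = x0 \<and> fst i = snd i"
      if x: "x \<in> basis_states (Q - {a, b})" for x i
    proof
      assume "\<exists>s. x(a := fst i, b := snd i) = Xb s"
      then obtain s where s: "x(a := fst i, b := snd i) = Xb s" ..
      have "fst i = s" "snd i = s"
        using fun_cong[OF s, of a] fun_cong[OF s, of b] ab abQ by (auto simp: Xb_def X_def)
      moreover have "x r = x0 r" for r
      proof (cases "r \<in> Q - {a, b}")
        case True
        then show ?thesis using fun_cong[OF s, of r] by (simp add: Xb_def X_def x0_def)
      next
        case False
        then show ?thesis using x x0 by (auto simp: PiE_def extensional_def)
      qed
      ultimately show "x = x0 \<and> fst i = snd i" by auto
    next
      assume h: "x = x0 \<and> fst i = snd i"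
      have "x0(a := snd i, b := snd i) = Xb (snd i)"
        using abQ by (auto simp: fun_eq_iff Xb_def X_def x0_def restrict_def)
      then show "\<exists>s. x(a := fst i, b := snd i) = Xb s" using h by auto
    qed
    have B: "x(a := fst i, b := snd i) \<in> basis_states Q" if "x \<in> basis_states (Q - {a, b})" for x i
      using that abQ by (auto simp: PiE_def extensional_def)
    have "reduce_pair Q a b \<sigma> $ i $ j = (\<Sum>x\<in>basis_states (Q - {a, b}).
        if x = x0 then complex_of_real c * of_bool (fst i = snd i \<and> fst j = snd j) else 0)"
      unfolding reduce_pair_def vec_lambda_beta
    proof (intro sum.cong refl)
      fix x assume x: "x \<in> basis_states (Q - {a, b})"
      show "\<sigma> (x(a := fst i, b := snd i)) (x(a := fst j, b := snd j))
        = (if x = x0 then complex_of_real c * of_bool (fst i = snd i \<and> fst j = snd j) else 0)"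
        unfolding \<sigma>_def \<rho>2_val[OF B[OF x] B[OF x]] iff[OF x] by simp
    qed
    also have "\<dots> = complex_of_real c * of_bool (fst i = snd i \<and> fst j = snd j)"
      using x0 finite_basis_states[of "Q - {a, b}"] finQ by simp
    finally show ?thesis .
  qed
  have "perfect_singlet ((1 / trace_reg Q \<sigma>) *\<^sub>R reduce_pair Q a b \<sigma>)"
    by (rule perfect_singletI)
      (use c in \<open>simp add: red tr scaleR_conv_of_real[where 'a = complex]\<close>)
  then show ?thesis
    unfolding singlet_generable_def
    using P a(1) b(1) c tr unfolding \<sigma>_def[symmetric] Q_def[symmetric]
    by (intro exI[of _ ?k] exI[of _ P] exI[of _ \<sigma>] exI[of _ a] exI[of _ b]) (auto simp: Q_def)
qed

theorem mainTheorem1: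
  fixes N :: "('v, 'e) network" and A B :: 'v
  assumes "quantum_network N"
    and "\<forall>e\<in>edges N. mixed (edge_state N e) \<and> entangled (edge_state N e)"
    and "A \<in> nodes N" and "B \<in> nodes N" and "A \<noteq> B"
  shows "singlet_generable N A B \<longleftrightarrow>
    (\<exists>p q. edge_path N A p B \<and> edge_path N A q B \<and> set p \<inter> set q = {} \<and>
      (\<forall>e\<in>set p \<union> set q. \<exists>\<alpha> \<gamma> l. 0 \<le> l \<and> l \<le> 1 \<and> 0 \<le> \<alpha> \<and> 0 \<le> \<gamma> \<and> \<alpha> + \<gamma> \<le> 1 \<and>
        lu_equivalent (edge_state N e) (rho_agl \<alpha> \<gamma> l)))"
proof
  assume gen: "singlet_generable N A B"
  define form where "form e \<longleftrightarrow> (\<exists>\<alpha> \<gamma> l. 0 \<le> l \<and> l \<le> 1 \<and> 0 \<le> \<alpha> \<and> 0 \<le> \<gamma> \<and> \<alpha> + \<gamma> \<le> 1 \<and>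
      lu_equivalent (edge_state N e) (rho_agl \<alpha> \<gamma> l))" for e
  define G where "G = {e \<in> edges N. form e}"
  have G: "finite G" "G \<subseteq> edges N" using assms(1) by (simp_all add: G_def quantum_network_def)
  have "\<not> (\<exists>X. A \<in> X \<and> B \<notin> X \<and> card {e\<in>G. (end1 N e \<in> X) \<noteq> (end2 N e \<in> X)} \<le> 1)"
  proof
    assume "\<exists>X. A \<in> X \<and> B \<notin> X \<and> card {e\<in>G. (end1 N e \<in> X) \<noteq> (end2 N e \<in> X)} \<le> 1"
    then obtain X where X: "A \<in> X" "B \<notin> X" "card {e\<in>G. (end1 N e \<in> X) \<noteq> (end2 N e \<in> X)} \<le> 1" by blast
    have "finite {e\<in>G. (end1 N e \<in> X) \<noteq> (end2 N e \<in> X)}" using G(1) by simp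
    from card_le_Suc0_iff_eq[OF this]
    have one: "e = e'" if "e \<in> G" "e' \<in> G" "(end1 N e \<in> X) \<noteq> (end2 N e \<in> X)" "(end1 N e' \<in> X) \<noteq> (end2 N e' \<in> X)"
      for e e' using X(3) that by auto
    show False
    proof (rule no_singlet_across_cut[OF assms(1) _ gen X(1,2), of G])
      show "\<forall>e\<in>edges N. mixed (edge_state N e)" using assms(2) by blast
      show "\<not> (\<exists>\<alpha> \<gamma> l. 0 \<le> l \<and> l \<le> 1 \<and> 0 \<le> \<alpha> \<and> 0 \<le> \<gamma> \<and> \<alpha> + \<gamma> \<le> 1 \<and>
        lu_equivalent (edge_state N e) (rho_agl \<alpha> \<gamma> l))" if "e \<in> edges N" "e \<notin> G" for e
        using that unfolding G_def form_def by blast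
    qed (rule one)
  qed
  with two_disjoint_paths_or_cut[OF G, of A B]
  obtain p q where "edge_path N A p B" "edge_path N A q B" "set p \<inter> set q = {}" "set p \<union> set q \<subseteq> G" by blast
  moreover from this(4) have "\<forall>e\<in>set p \<union> set q. form e" unfolding G_def by blast
  ultimately show "\<exists>p q. edge_path N A p B \<and> edge_path N A q B \<and> set p \<inter> set q = {} \<and>
      (\<forall>e\<in>set p \<union> set q. \<exists>\<alpha> \<gamma> l. 0 \<le> l \<and> l \<le> 1 \<and> 0 \<le> \<alpha> \<and> 0 \<le> \<gamma> \<and> \<alpha> + \<gamma> \<le> 1 \<and>
        lu_equivalent (edge_state N e) (rho_agl \<alpha> \<gamma> l))"
    unfolding form_def by blast
next
  assume "\<exists>p q. edge_path N A p B \<and> edge_path N A q B \<and> set p \<inter> set q = {} \<and>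
      (\<forall>e\<in>set p \<union> set q. \<exists>\<alpha> \<gamma> l. 0 \<le> l \<and> l \<le> 1 \<and> 0 \<le> \<alpha> \<and> 0 \<le> \<gamma> \<and> \<alpha> + \<gamma> \<le> 1 \<and>
        lu_equivalent (edge_state N e) (rho_agl \<alpha> \<gamma> l))"
  then obtain p q where pq: "edge_path N A p B" "edge_path N A q B" "set p \<inter> set q = {}"
    "\<forall>e\<in>set p \<union> set q. \<exists>\<alpha> \<gamma> l. 0 \<le> l \<and> l \<le> 1 \<and> 0 \<le> \<alpha> \<and> 0 \<le> \<gamma> \<and> \<alpha> + \<gamma> \<le> 1 \<and>
        lu_equivalent (edge_state N e) (rho_agl \<alpha> \<gamma> l)" by blast
  have "\<forall>e\<in>edges N. entangled (edge_state N e)" using assms(2) by blast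
  from two_paths_suffice[OF assms(1) this assms(5) pq] show "singlet_generable N A B" .
qed

end
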